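(* Consider the symmetric balanced detection problem SymBal-MSLR-D (defined in the context) with $(\beta_1,\beta_2)\sim\mathcal{P}_{\|\beta\|_2}(\mathcal{D})$ and bounded amplitude signals, i.e. $\beta_{\min}=\Theta(\|\beta\|_\infty)$, in the regime $p\to\infty$, $k=o(\sqrt p)$. For sample sizes $n$ with $$n=\omega(\max\{k,\log p\})\qquad\text{and}\qquad n=o\!\left(\frac{k^2(\mathrm{SNR}+1)^2}{\mathrm{SNR}^2}\cdot\frac{1}{\log p}\right),$$ the Low-Degree Conjecture (stated in the context) implies that any randomized algorithm requires running time $$\exp\!\left(\tilde\Omega\!\left(\min\left\{\frac{k^2(\mathrm{SNR}+1)^2}{n\,\mathrm{SNR}^2},\,n\right\}\right)\right)$$ to solve SymBal-MSLR-D (i.e. to achieve strong detection).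
   Context: **Signal prior.** For $\mathcal{D}\subseteq\mathbb{R}$, $\mathcal{P}_{\|\beta\|_2}(\mathcal{D})$ denotes a joint distribution of a pair $(\beta_1,\beta_2)$ such that each of $\beta_1,\beta_2$ is marginally uniform over $k$-sparse vectors of $\mathbb{R}^p$ (exactly $k$ nonzero entries) whose nonzero entries lie in $\mathcal{D}$, and such that $\beta_1,\beta_2$ have the same fixed Euclidean norm, denoted $\|\beta\|_2$. It is assumed that $\beta_{\min}:=\min\{|b|:b\in\mathcal{D}\}>0$. $\|\beta\|_\infty$ denotes the largest absolute value of an entry of the signals. $\mathrm{SNR}:=\|\beta\|_2^2/\sigma^2$. **Detection problem MSLR-D.** Let $\sigma>0$, $\phi$ the mixture parameter. $X\in\mathbb{R}^{n\times p}$ has i.i.d. $\mathcal{N}(0,1)$ entries, $w\in\mathbb{R}^n$ has i.i.d. $\mathcal{N}(0,1)$ entries, $z\in\{0,1\}^n$ has i.i.d. Bernoulli$(\phi)$ entries, $(\beta_1,\beta_2)\sim\mathcal{P}_{\|\beta\|_2}(\mathcal{D})$, all independent. One observes $(X,y)$ and must distinguish the null $\mathbb{P}(X)\otimes\mathbb{P}(y)$: $y=\sqrt{\|\beta\|_2^2/\sigma^2+1}\;w$, from the alternative $\mathbb{P}(X,y)$: $y=\frac1\sigma X\beta_1\odot z+\frac1\sigma X\beta_2\odot(1-z)+w$ ($\odot$ is the entrywise product). **SymBal-MSLR-D** is MSLR-D in the regime $\phi=1/2$ and $\beta_1=-\beta_2$. **Strong detection:** a test succeeds with probability $1-o(1)$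 as $p\to\infty$ (under both hypotheses). **Low-degree chi-square divergence.** For distributions $\mathbb{P}_N\ll\mathbb{Q}_N$ on $\mathbb{R}^N$ with likelihood ratio $L=d\mathbb{P}_N/d\mathbb{Q}_N$, let $L^{\le D}$ be the orthogonal projection of $L$ in $L^2(\mathbb{Q}_N)$ onto polynomials of degree at most $D$, and $\chi^2_{\le D}(\mathbb{P}_N\|\mathbb{Q}_N):=\mathbb{E}_{\mathbb{Q}_N}[(L^{\le D})^2]-1$. **Low-Degree Conjecture.** If $\chi^2_{\le D}(\mathbb{P}_N\|\mathbb{Q}_N)=O(1)$ for some $D=\omega(\log N)$, then strong detection between $\mathbb{P}_N$ and $\mathbb{Q}_N$ has no polynomial-time algorithm and furthermore requires runtime $\exp(\tilde\Omega(D))$. (If $\chi^2_{\le D}=o(1)$ for some $D=\omega(\log N)$, the same holds for weak detection, i.e. success with probability $\frac12+\epsilon$ for a constant $\epsilon>0$.) Here $N=np+n$ is the dimension of the data $(X,y)$. $\tilde\Omega$ hides polylogarithmic factors. *)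

theory Defs
  imports "HOL-Probability.Probability" "HOL-Library.Landau_Symbols"
begin

section \<open>Low-degree chi-square divergence\<close>

abbreviation Rn :: "nat \<Rightarrow> (nat \<Rightarrow> real) measure" where
  "Rn N \<equiv> Pi\<^sub>M {..<N} (\<lambda>_. borel)"

definition polys :: "nat \<Rightarrow> nat \<Rightarrow> ((nat \<Rightarrow> real) \<Rightarrow> real) set" where
  "polys N D = {f. \<exists>(S :: (nat \<Rightarrow> nat) set) c. finite S \<and> (\<forall>a\<in>S. (\<Sum>i<N. a i) \<le> D) \<and>
                     f = (\<lambda>x. \<Sum>a\<in>S. c a * (\<Prod>i<N. x i ^ a i))}"

definition likelihood_ratio :: "'a measure \<Rightarrow> 'a measure \<Rightarrow> 'a \<Rightarrow> real" where
  "likelihood_ratio P Q x = enn2real (RN_deriv Q P x)"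

text \<open>The projection is unique up to a null set of \<open>Q\<close>, so the choice does not affect
  \<open>chi2_low_degree\<close>. It exists for the pairs singled out by \<open>testing_pair\<close>.\<close>

definition low_degree_projection ::
  "nat \<Rightarrow> nat \<Rightarrow> (nat \<Rightarrow> real) measure \<Rightarrow> ((nat \<Rightarrow> real) \<Rightarrow> real) \<Rightarrow> (nat \<Rightarrow> real) \<Rightarrow> real" where
  "low_degree_projection N D Q L =
     (SOME f. f \<in> polys N D \<and> (\<forall>g\<in>polys N D. (\<integral>x. (L x - f x) * g x \<partial>Q) = 0))"

definition chi2_low_degree ::
  "nat \<Rightarrow> nat \<Rightarrow> (nat \<Rightarrow> real) measure \<Rightarrow> (nat \<Rightarrow> real) measure \<Rightarrow> real" where
  "chi2_low_degree N D P Q =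
     (\<integral>x. (low_degree_projection N D Q (likelihood_ratio P Q) x)\<^sup>2 \<partial>Q) - 1"

definition testing_pair ::
  "nat \<Rightarrow> (nat \<Rightarrow> real) measure \<Rightarrow> (nat \<Rightarrow> real) measure \<Rightarrow> bool" where
  "testing_pair N P Q \<longleftrightarrow>
     prob_space P \<and> prob_space Q \<and> sets P = sets (Rn N) \<and> sets Q = sets (Rn N) \<and>
     absolutely_continuous Q P \<and>
     integrable Q (\<lambda>x. (likelihood_ratio P Q x)\<^sup>2) \<and>
     (\<forall>D. \<forall>f\<in>polys N D. integrable Q (\<lambda>x. (f x)\<^sup>2))"


section \<open>Randomized algorithms and running time\<close>

text \<open>A random access machine over the reals with exact arithmetic, comparisons and fair coins at
  unit cost, and no rounding operation. Jump targets are absolute. The machine halts when the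
  program counter leaves the program.\<close>

datatype instr =
    LoadConst nat real
  | AddReg nat nat nat
  | SubReg nat nat nat
  | MulReg nat nat nat
  | DivReg nat nat nat
  | Coin nat
  | JumpIfPos nat nat

text \<open>A configuration consists of the program counter, the registers, and the number of coins
  tossed so far; \<open>\<omega>\<close> is the sequence of coin tosses.\<close>

type_synonym config = "nat \<times> (nat \<Rightarrow> real) \<times> nat"

fun exec :: "(nat \<Rightarrow> bool) \<Rightarrow> instr \<Rightarrow> config \<Rightarrow> config" where
  "exec \<omega> (LoadConst d c) (pc, R, t) = (Suc pc, R(d := c), t)"
| "exec \<omega> (AddReg d a b) (pc, R, t) = (Suc pc, R(d := R a + R b), t)"
| "exec \<omega> (SubReg d a b) (pc, R, t) = (Suc pc, R(d := R a - R b), t)"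
| "exec \<omega> (MulReg d a b) (pc, R, t) = (Suc pc, R(d := R a * R b), t)"
| "exec \<omega> (DivReg d a b) (pc, R, t) = (Suc pc, R(d := R a / R b), t)"
| "exec \<omega> (Coin d) (pc, R, t) = (Suc pc, R(d := of_bool (\<omega> t)), Suc t)"
| "exec \<omega> (JumpIfPos a l) (pc, R, t) = (if R a > 0 then l else Suc pc, R, t)"

definition step :: "instr list \<Rightarrow> (nat \<Rightarrow> bool) \<Rightarrow> config \<Rightarrow> config" where
  "step prog \<omega> s = (if fst s < length prog then exec \<omega> (prog ! fst s) s else s)"

definition run ::
  "instr list \<Rightarrow> nat \<Rightarrow> (nat \<Rightarrow> real) \<Rightarrow> (nat \<Rightarrow> bool) \<Rightarrow> nat \<Rightarrow> config" where
  "run prog N x \<omega> t = (step prog \<omega> ^^ t) (0, (\<lambda>j. if j < N then x j else 0), 0)"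

definition halted :: "instr list \<Rightarrow> config \<Rightarrow> bool" where
  "halted prog s \<longleftrightarrow> length prog \<le> fst s"

text \<open>An algorithm for a sequence of testing problems is a sequence of programs, which may thus
  depend on the size and on the known parameters of the problem. For this not to give advice free
  of charge, the length of the program counts towards the (worst-case) running time. The strict
  inequality charges one unit for reading off the output.\<close>

definition runs_in_time :: "instr list \<Rightarrow> nat \<Rightarrow> nat \<Rightarrow> bool" where
  "runs_in_time prog N T \<longleftrightarrow>
     (\<forall>x \<omega>. \<exists>t. length prog + t < T \<and> halted prog (run prog N x \<omega> t))"

text \<open>Accepting means deciding for the alternative.\<close>

definition accepts :: "instr list \<Rightarrow> nat \<Rightarrow> (nat \<Rightarrow> real) \<Rightarrow> (nat \<Rightarrow> bool) \<Rightarrow> bool" where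
  "accepts prog N x \<omega> \<longleftrightarrow>
     (\<exists>t. halted prog (run prog N x \<omega> t) \<and> fst (snd (run prog N x \<omega> t)) 0 > 0)"

definition coins :: "(nat \<Rightarrow> bool) measure" where
  "coins = Pi\<^sub>M UNIV (\<lambda>_. measure_pmf (bernoulli_pmf (1/2)))"

definition accept_prob :: "instr list \<Rightarrow> nat \<Rightarrow> (nat \<Rightarrow> real) measure \<Rightarrow> real" where
  "accept_prob prog N M =
     measure (M \<Otimes>\<^sub>M coins) {(x, \<omega>) \<in> space (M \<Otimes>\<^sub>M coins). accepts prog N x \<omega>}"

text \<open>In the following, a sequence of testing problems is given by the dimensions \<open>N\<close>, the
  alternatives \<open>P\<close> and the null distributions \<open>Q\<close>.\<close>

definition strongly_detects ::
  "(nat \<Rightarrow> instr list) \<Rightarrow> (nat \<Rightarrow> nat) \<Rightarrow> (nat \<Rightarrow> (nat \<Rightarrow> real) measure) \<Rightarrow>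
   (nat \<Rightarrow> (nat \<Rightarrow> real) measure) \<Rightarrow> bool" where
  "strongly_detects A N P Q \<longleftrightarrow>
     (\<lambda>i. accept_prob (A i) (N i) (P i)) \<longlonglongrightarrow> 1 \<and>
     (\<lambda>i. accept_prob (A i) (N i) (Q i)) \<longlonglongrightarrow> 0"

definition detectable_in_time ::
  "(nat \<Rightarrow> nat) \<Rightarrow> (nat \<Rightarrow> (nat \<Rightarrow> real) measure) \<Rightarrow> (nat \<Rightarrow> (nat \<Rightarrow> real) measure) \<Rightarrow>
   (nat \<Rightarrow> nat) \<Rightarrow> bool" where
  "detectable_in_time N P Q T \<longleftrightarrow>
     (\<exists>A. (\<forall>i. runs_in_time (A i) (N i) (T i)) \<and> strongly_detects A N P Q)"

text \<open>Running time \<open>exp (\<Omega>\<^sup>~(D))\<close>, where the factors hidden by the tilde are polylogarithmic in the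
  dimension \<open>N\<close> of the data.\<close>

definition requires_exp_time ::
  "(nat \<Rightarrow> nat) \<Rightarrow> (nat \<Rightarrow> (nat \<Rightarrow> real) measure) \<Rightarrow> (nat \<Rightarrow> (nat \<Rightarrow> real) measure) \<Rightarrow>
   (nat \<Rightarrow> real) \<Rightarrow> bool" where
  "requires_exp_time N P Q D \<longleftrightarrow>
     (\<forall>T. detectable_in_time N P Q T \<longrightarrow>
        (\<exists>c>0. \<exists>C::nat. (\<lambda>i. real (T i)) \<in> \<Omega>(\<lambda>i. exp (c * D i / ln (real (N i)) ^ C))))"


section \<open>The Low-Degree Conjecture\<close>

text \<open>This is the conjecture for one given sequence of testing problems. It is not quantified over
  all sequences here, since in that generality it is refuted by artificial examples (such as product
  distributions with a marginal that matches all low moments of the null). Nothing is required of the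
  dimensions beyond \<open>N \<longrightarrow> \<infinity>\<close>, so it may be invoked for any subsequence of a given sequence of problems.\<close>

definition low_degree_conjecture ::
  "(nat \<Rightarrow> nat) \<Rightarrow> (nat \<Rightarrow> (nat \<Rightarrow> real) measure) \<Rightarrow> (nat \<Rightarrow> (nat \<Rightarrow> real) measure) \<Rightarrow> bool" where
  "low_degree_conjecture N P Q \<longleftrightarrow>
     (\<forall>D :: nat \<Rightarrow> nat.
        filterlim N at_top sequentially \<and>
        (\<forall>i. testing_pair (N i) (P i) (Q i)) \<and>
        (\<lambda>i. real (D i)) \<in> \<omega>(\<lambda>i. ln (real (N i))) \<and>
        (\<lambda>i. chi2_low_degree (N i) (D i) (P i) (Q i)) \<in> O(\<lambda>_. 1)
        \<longrightarrow>
        (\<nexists>T C. detectable_in_time N P Q T \<and> (\<lambda>i. real (T i)) \<in> O(\<lambda>i. real (N i) ^ C)) \<and>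
        requires_exp_time N P Q (\<lambda>i. real (D i)))"


section \<open>The signal prior\<close>

definition signals :: "nat \<Rightarrow> nat \<Rightarrow> real set \<Rightarrow> real \<Rightarrow> (nat \<Rightarrow> real) set" where
  "signals p k \<D> b =
     {\<beta> \<in> space (Rn p). card {j. j < p \<and> \<beta> j \<noteq> 0} = k \<and>
        (\<forall>j<p. \<beta> j \<noteq> 0 \<longrightarrow> \<beta> j \<in> \<D>) \<and> L2_set \<beta> {..<p} = b}"

text \<open>As \<open>\<D>\<close> may be infinite, so may be the set of signals. The uniform distribution on a set is
  taken to be its normalized Hausdorff measure of the appropriate dimension \<open>s\<close> (with respect to the
  Euclidean distance). On a nonempty finite set this is the usual uniform distribution, with
  \<open>s = 0\<close>.\<close>

definition diam :: "nat \<Rightarrow> (nat \<Rightarrow> real) set \<Rightarrow> real" where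
  "diam p U = Sup {L2_set (\<lambda>j. x j - y j) {..<p} | x y. x \<in> U \<and> y \<in> U}"

definition hausdorff_size :: "nat \<Rightarrow> real \<Rightarrow> (nat \<Rightarrow> real) set \<Rightarrow> ennreal" where
  "hausdorff_size p s U =
     (if U = {} then 0 else if s = 0 then 1 else ennreal (diam p U powr s))"

definition hausdorff_measure :: "nat \<Rightarrow> real \<Rightarrow> (nat \<Rightarrow> real) set \<Rightarrow> ennreal" where
  "hausdorff_measure p s A =
     (SUP \<delta>\<in>{0<..}.
        INF U \<in> {U :: nat \<Rightarrow> (nat \<Rightarrow> real) set. A \<subseteq> (\<Union>i. U i) \<and>
                   (\<forall>i. \<forall>x\<in>U i. \<forall>y\<in>U i. L2_set (\<lambda>j. x j - y j) {..<p} \<le> \<delta>)}.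
          (\<Sum>i. hausdorff_size p s (U i)))"

definition uniform_on :: "nat \<Rightarrow> (nat \<Rightarrow> real) set \<Rightarrow> (nat \<Rightarrow> real) measure \<Rightarrow> bool" where
  "uniform_on p B \<mu> \<longleftrightarrow>
     sets \<mu> = sets (Rn p) \<and>
     (\<exists>s\<ge>0. 0 < hausdorff_measure p s B \<and> hausdorff_measure p s B < \<infinity> \<and>
        (\<forall>A\<in>sets \<mu>. emeasure \<mu> A = hausdorff_measure p s (A \<inter> B) / hausdorff_measure p s B))"

text \<open>Laws of pairs \<open>(\<beta>\<^sub>1, \<beta>\<^sub>2)\<close> of signals with common norm \<open>b\<close>.\<close>

definition signal_prior ::
  "nat \<Rightarrow> nat \<Rightarrow> real set \<Rightarrow> real \<Rightarrow> ((nat \<Rightarrow> real) \<times> (nat \<Rightarrow> real)) measure \<Rightarrow> bool" where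
  "signal_prior p k \<D> b \<mu> \<longleftrightarrow>
     prob_space \<mu> \<and> sets \<mu> = sets (Rn p \<Otimes>\<^sub>M Rn p) \<and>
     uniform_on p (signals p k \<D> b) (distr \<mu> (Rn p) fst) \<and>
     uniform_on p (signals p k \<D> b) (distr \<mu> (Rn p) snd)"

definition beta_min :: "real set \<Rightarrow> real" where
  "beta_min \<D> = Inf (abs ` \<D>)"

definition beta_sup :: "nat \<Rightarrow> nat \<Rightarrow> real set \<Rightarrow> real \<Rightarrow> real" where
  "beta_sup p k \<D> b = Sup {\<bar>\<beta> j\<bar> | \<beta> j. \<beta> \<in> signals p k \<D> b \<and> j < p}"


section \<open>The detection problem MSLR-D\<close>

definition data_dim :: "nat \<Rightarrow> nat \<Rightarrow> nat" where
  "data_dim n p = n * p + n"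

text \<open>The data \<open>(X, y)\<close> are stored as one vector, \<open>X\<close> row by row followed by \<open>y\<close>.\<close>

definition data_vector ::
  "nat \<Rightarrow> nat \<Rightarrow> (nat \<times> nat \<Rightarrow> real) \<Rightarrow> (nat \<Rightarrow> real) \<Rightarrow> nat \<Rightarrow> real" where
  "data_vector n p X y =
     (\<lambda>i\<in>{..<data_dim n p}. if i < n * p then X (i div p, i mod p) else y (i - n * p))"

definition design :: "nat \<Rightarrow> nat \<Rightarrow> (nat \<times> nat \<Rightarrow> real) measure" where
  "design n p = Pi\<^sub>M ({..<n} \<times> {..<p}) (\<lambda>_. std_normal_distribution)"

definition noise :: "nat \<Rightarrow> (nat \<Rightarrow> real) measure" where
  "noise n = Pi\<^sub>M {..<n} (\<lambda>_. std_normal_distribution)"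

definition labels :: "nat \<Rightarrow> real \<Rightarrow> (nat \<Rightarrow> bool) measure" where
  "labels n \<phi> = Pi\<^sub>M {..<n} (\<lambda>_. measure_pmf (bernoulli_pmf \<phi>))"

definition snr :: "real \<Rightarrow> real \<Rightarrow> real" where
  "snr b \<sigma> = b\<^sup>2 / \<sigma>\<^sup>2"

definition mslr_null :: "nat \<Rightarrow> nat \<Rightarrow> real \<Rightarrow> real \<Rightarrow> (nat \<Rightarrow> real) measure" where
  "mslr_null n p b \<sigma> =
     distr (design n p \<Otimes>\<^sub>M noise n) (Rn (data_dim n p))
       (\<lambda>(X, w). data_vector n p X (\<lambda>i. sqrt (b\<^sup>2 / \<sigma>\<^sup>2 + 1) * w i))"

definition mslr_alternative ::
  "nat \<Rightarrow> nat \<Rightarrow> real \<Rightarrow> real \<Rightarrow> ((nat \<Rightarrow> real) \<times> (nat \<Rightarrow> real)) measure \<Rightarrow> (nat \<Rightarrow> real) measure" where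
  "mslr_alternative n p \<phi> \<sigma> \<mu> =
     distr (design n p \<Otimes>\<^sub>M (noise n \<Otimes>\<^sub>M (labels n \<phi> \<Otimes>\<^sub>M \<mu>))) (Rn (data_dim n p))
       (\<lambda>(X, w, z, \<beta>1, \<beta>2). data_vector n p X
          (\<lambda>i. 1 / \<sigma> * (\<Sum>j<p. X (i, j) * \<beta>1 j) * of_bool (z i)
             + 1 / \<sigma> * (\<Sum>j<p. X (i, j) * \<beta>2 j) * (1 - of_bool (z i))
             + w i))"

definition antisymmetric_pairs ::
  "nat \<Rightarrow> ((nat \<Rightarrow> real) \<times> (nat \<Rightarrow> real)) measure \<Rightarrow> bool" where
  "antisymmetric_pairs p \<mu> \<longleftrightarrow> (AE (\<beta>1, \<beta>2) in \<mu>. \<forall>j<p. \<beta>1 j = - \<beta>2 j)"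

end

theory Submission
  imports Defs
begin

text \<open>
  Let \<open>V = SNR + 1\<close>, and let \<open>H\<^sub>b(t, x)\<close> be the Hermite polynomials for variance \<open>t\<close>. Conditionally on the
  signal, averaging a single observation over its label leaves only the even terms of the Mehler expansion
  \<open>\<Sum>\<^sub>b H\<^sub>b(SNR, a) H\<^sub>b(V, y) / (b! V\<^sup>b)\<close> of the likelihood ratio, where \<open>a = \<langle>x, \<beta>\<rangle> / \<sigma>\<close>. Against polynomials of degree at
  most \<open>D\<close>, the likelihood ratio of all the observations acts like the sum of the products of such terms of total degree
  at most \<open>D\<close> in \<open>y\<close>. These products are orthogonal, also across different signals, so the divergence is bounded by the
  mean over two independent signals of \<open>\<Sum>\<^sub>b \<tau>\<^bsup>\<bar>b\<bar>\<^esup>\<close>, where \<open>\<tau> = \<langle>\<beta>, \<beta>'\<rangle> / (\<sigma>\<^sup>2 V)\<close> and \<open>b\<close> runs over the even multi-indices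
  with \<open>\<bar>b\<bar> \<le> D\<close>. If \<open>D\<close> is smaller than the target exponent by a factor \<open>(ln N)\<^sup>2\<close>, this sum is at most \<open>e 3\<^sup>l\<close>, with \<open>l\<close> the
  size of the intersection of the two supports. By exchangeability of the coordinates, the mean of \<open>3\<^sup>l\<close> is at most
  \<open>(1 + 2k/p)\<^sup>k\<close>, which is bounded for \<open>k = o(\<surd>p)\<close>.

  The conjecture needs \<open>D = \<omega>(ln N)\<close>. It is therefore applied to the subsequence on which the target exponent exceeds
  \<open>(ln N)\<^sup>4\<close>; elsewhere the claimed lower bound is a constant once a factor \<open>(ln N)\<^sup>4\<close> is hidden.
\<close>

section \<open>Square-integrable functions and orthogonal projection\<close>

text \<open>The sum over the even multi-indices must be cut at total degree D: for a large overlap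
  \<tau> may be close to 1, and the full sum (1 - \<tau>^2)^(-n) is far too big. Let \<Delta> be the
  target exponent. If l is small against \<Delta>, then n \<tau>^2 is at most l / 2 and even the
  full sum is at most e^l. If l is large, the cut costs a factor (n + 1)^D, and D is so small that
  this too is at most e^l. Of the two logarithms divided out of \<Delta>, one pays for ln (n + 1),
  the other absorbs the constant from the amplitude ratio. Exponents above (ln N)^4 then leave a D
  of order at least (ln N)^2. The cut concerns the degree in y only. What remains need not be a
  polynomial of degree at most D, but its inner products with such polynomials are those of the
  likelihood ratio, so by Cauchy-Schwarz its norm bounds that of the projection. As \<D> is
  arbitrary, the uniform law is a Hausdorff measure of unknown dimension. The argument relies on two
  properties: it is carried by the signals, and it is invariant under transpositions of coordinates,
  which are isometries.\<close>

lemma product_sigma_finite_prob_space: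
  "(\<And>i. prob_space (M i)) \<Longrightarrow> product_sigma_finite M"
  by (intro product_sigma_finite.intro prob_space_imp_sigma_finite)

definition square_integrable :: "'a measure \<Rightarrow> ('a \<Rightarrow> real) \<Rightarrow> bool" where
  "square_integrable M f \<longleftrightarrow> f \<in> borel_measurable M \<and> integrable M (\<lambda>x. (f x)\<^sup>2)"

lemma square_integrableD:
  assumes "square_integrable M f"
  shows "f \<in> borel_measurable M" "integrable M (\<lambda>x. (f x)\<^sup>2)"
  using assms by (auto simp: square_integrable_def)

lemma square_integrable_mult:
  assumes "square_integrable M f" "square_integrable M g"
  shows "integrable M (\<lambda>x. f x * g x)"
proof (rule Bochner_Integration.integrable_bound)
  show "integrable M (\<lambda>x. (f x)\<^sup>2 + (g x)\<^sup>2)"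
    using assms by (auto simp: square_integrable_def)
  show "(\<lambda>x. f x * g x) \<in> borel_measurable M"
    using assms by (auto simp: square_integrable_def)
  have "\<bar>a * b\<bar> \<le> a\<^sup>2 + b\<^sup>2" for a b :: real
    using sum_squares_bound[of "\<bar>a\<bar>" "\<bar>b\<bar>"] abs_ge_zero[of "a * b"]
    unfolding abs_mult power2_abs by linarith
  then show "AE x in M. norm (f x * g x) \<le> norm ((f x)\<^sup>2 + (g x)\<^sup>2)"
    by simp
qed

lemma square_integrable_add:
  assumes "square_integrable M f" "square_integrable M g"
  shows "square_integrable M (\<lambda>x. f x + g x)"
  using assms square_integrable_mult[OF assms]
  by (auto simp: square_integrable_def power2_sum mult.assoc)

lemma square_integrable_cmult:
  assumes "square_integrable M f"
  shows "square_integrable M (\<lambda>x. c * f x)"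
  using assms by (auto simp: square_integrable_def power_mult_distrib)

lemma square_integrable_minus:
  assumes "square_integrable M f" "square_integrable M g"
  shows "square_integrable M (\<lambda>x. f x - g x)"
  using square_integrable_add[OF assms(1) square_integrable_cmult[OF assms(2), of "-1"]] by simp

lemma square_integrable_sum:
  assumes "\<And>i. i \<in> I \<Longrightarrow> square_integrable M (f i)"
  shows "square_integrable M (\<lambda>x. \<Sum>i\<in>I. f i x)"
  using assms
proof (induction I rule: infinite_finite_induct)
  case (insert i I)
  then show ?case using square_integrable_add[of M "f i" "\<lambda>x. \<Sum>i\<in>I. f i x"] by simp
qed (auto simp: square_integrable_def)

lemma (in finite_measure) square_integrable_imp_integrable:
  assumes "square_integrable M f"
  shows "integrable M f"
  using square_integrable_mult[OF assms, of "\<lambda>_. 1"] by (simp add: square_integrable_def)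

lemma Cauchy_Schwarz_integral:
  assumes "square_integrable M f" "square_integrable M g"
  shows "(\<integral>x. f x * g x \<partial>M)\<^sup>2 \<le> (\<integral>x. (f x)\<^sup>2 \<partial>M) * (\<integral>x. (g x)\<^sup>2 \<partial>M)"
proof -
  define A B C where "A = (\<integral>x. (f x)\<^sup>2 \<partial>M)" "B = (\<integral>x. f x * g x \<partial>M)" "C = (\<integral>x. (g x)\<^sup>2 \<partial>M)"
  \<comment> \<open>This is the squared norm of s f - t g. With two scalars the form stays
    homogeneous, so both cases below are mere substitutions.\<close>
  have q: "0 \<le> A * s\<^sup>2 - 2 * B * s * t + C * t\<^sup>2" for s t
  proof -
    have "0 \<le> (\<integral>x. (s * f x - t * g x)\<^sup>2 \<partial>M)" by simp
    also have "\<dots> = (\<integral>x. s\<^sup>2 * (f x)\<^sup>2 - 2 * s * t * (f x * g x) + t\<^sup>2 * (g x)\<^sup>2 \<partial>M)"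
      by (intro Bochner_Integration.integral_cong) (auto simp: power2_eq_square algebra_simps)
    also have "\<dots> = s\<^sup>2 * A - 2 * s * t * B + t\<^sup>2 * C"
      using assms square_integrable_mult[OF assms]
      by (simp add: A_B_C_def square_integrable_def)
    finally show ?thesis by (simp add: algebra_simps)
  qed
  have "A \<ge> 0" "C \<ge> 0" by (auto simp: A_B_C_def)
  have "B\<^sup>2 \<le> A * C"
  proof (cases "C = 0")
    case True
    have "B = 0"
    proof (rule ccontr)
      assume "B \<noteq> 0"
      \<comment> \<open>With C = 0 the form is affine in t, and this choice of t makes it equal to -
        A - 2.\<close>
      have "0 \<le> A * 1\<^sup>2 - 2 * B * 1 * ((A + 1) / B) + C * ((A + 1) / B)\<^sup>2" by (rule q)
      then show False using \<open>B \<noteq> 0\<close> \<open>A \<ge> 0\<close> True by simp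
    qed
    then show ?thesis using True by simp
  next
    case False
    with \<open>C \<ge> 0\<close> have "C > 0" by simp
    have "0 \<le> A * C\<^sup>2 - 2 * B * C * B + C * B\<^sup>2" by (rule q)
    also have "\<dots> = C * (A * C - B\<^sup>2)" by (simp add: power2_eq_square algebra_simps)
    finally show ?thesis using \<open>C > 0\<close> by (simp add: zero_le_mult_iff)
  qed
  then show ?thesis by (simp add: A_B_C_def)
qed

text \<open>A Gram-Schmidt step for each new function: \<open>u\<close> is the part of
  \<open>e k\<close> orthogonal to the earlier functions, and the residual \<open>r\<close> of
  \<open>L\<close> is corrected by a multiple of \<open>u\<close>. Linear independence is not
  assumed, so \<open>u\<close> may vanish almost everywhere.\<close>

lemma L2_projection_exists:
  fixes e :: "'i \<Rightarrow> 'a \<Rightarrow> real"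
  assumes "finite I" "\<And>i. i \<in> I \<Longrightarrow> square_integrable M (e i)" "square_integrable M L"
  shows "\<exists>c. \<forall>j\<in>I. (\<integral>x. (L x - (\<Sum>i\<in>I. c i * e i x)) * e j x \<partial>M) = 0"
  using assms
proof (induction I arbitrary: L rule: finite_induct)
  case empty
  then show ?case by simp
next
  case (insert k I)
  have sq: "square_integrable M (\<lambda>x. \<Sum>i\<in>I. c i * e i x)" for c
    using insert.prems by (intro square_integrable_sum square_integrable_cmult) auto
  obtain c where c: "\<And>j. j \<in> I \<Longrightarrow> (\<integral>x. (L x - (\<Sum>i\<in>I. c i * e i x)) * e j x \<partial>M) = 0"
    using insert.IH[of L] insert.prems by auto
  obtain d where d: "\<And>j. j \<in> I \<Longrightarrow> (\<integral>x. (e k x - (\<Sum>i\<in>I. d i * e i x)) * e j x \<partial>M) = 0"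
    using insert.IH[of "e k"] insert.prems by auto
  define r where "r = (\<lambda>x. L x - (\<Sum>i\<in>I. c i * e i x))"
  define u where "u = (\<lambda>x. e k x - (\<Sum>i\<in>I. d i * e i x))"
  have su: "square_integrable M u" and sr: "square_integrable M r"
    unfolding u_def r_def using sq insert.prems by (auto intro!: square_integrable_minus)
  have se: "square_integrable M (e j)" if "j \<in> insert k I" for j
    using insert.prems that by auto
  \<comment> \<open>If \<open>u\<close> is null, division by zero gives t = 0; equation
    \<open>ru\<close> then still holds, because Cauchy-Schwarz makes its left side 0.\<close>
  define t where "t = (\<integral>x. r x * u x \<partial>M) / (\<integral>x. (u x)\<^sup>2 \<partial>M)"
  have ru: "(\<integral>x. r x * u x \<partial>M) = t * (\<integral>x. (u x)\<^sup>2 \<partial>M)"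
    using Cauchy_Schwarz_integral[OF sr su] by (cases "(\<integral>x. (u x)\<^sup>2 \<partial>M) = 0") (auto simp: t_def)
  define v where "v = (\<lambda>x. r x - t * u x)"
  have sv: "square_integrable M v"
    unfolding v_def using su sr by (intro square_integrable_minus square_integrable_cmult)
  have vI: "(\<integral>x. v x * e j x \<partial>M) = 0" if "j \<in> I" for j
  proof -
    have "(\<integral>x. v x * e j x \<partial>M) = (\<integral>x. r x * e j x - t * (u x * e j x) \<partial>M)"
      by (intro Bochner_Integration.integral_cong) (auto simp: v_def algebra_simps)
    also have "\<dots> = (\<integral>x. r x * e j x \<partial>M) - t * (\<integral>x. u x * e j x \<partial>M)"
      using that square_integrable_mult[OF sr se] square_integrable_mult[OF su se] by simp
    finally show ?thesis using c[OF that] d[OF that] by (simp add: r_def u_def)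
  qed
  have vu: "(\<integral>x. v x * u x \<partial>M) = 0"
  proof -
    have "(\<integral>x. v x * u x \<partial>M) = (\<integral>x. r x * u x - t * (u x)\<^sup>2 \<partial>M)"
      by (intro Bochner_Integration.integral_cong) (auto simp: v_def algebra_simps power2_eq_square)
    also have "\<dots> = (\<integral>x. r x * u x \<partial>M) - t * (\<integral>x. (u x)\<^sup>2 \<partial>M)"
      using square_integrable_mult[OF sr su] su by (simp add: square_integrable_def)
    finally show ?thesis using ru by simp
  qed
  have vk: "(\<integral>x. v x * e k x \<partial>M) = 0"
  proof -
    have "(\<integral>x. v x * e k x \<partial>M) = (\<integral>x. v x * u x + (\<Sum>i\<in>I. d i * (v x * e i x)) \<partial>M)"
      by (intro Bochner_Integration.integral_cong)
         (auto simp: u_def algebra_simps sum_distrib_left)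
    also have "\<dots> = (\<integral>x. v x * u x \<partial>M) + (\<Sum>i\<in>I. d i * (\<integral>x. v x * e i x \<partial>M))"
      using square_integrable_mult[OF sv su] square_integrable_mult[OF sv se]
      by (subst Bochner_Integration.integral_add) auto
    finally show ?thesis using vI vu by simp
  qed
  have v: "v x = L x - (\<Sum>i\<in>insert k I. (if i = k then t else c i - t * d i) * e i x)" for x
  proof -
    have "(\<Sum>i\<in>I. (if i = k then t else c i - t * d i) * e i x) = (\<Sum>i\<in>I. c i * e i x - t * (d i * e i x))"
      using insert.hyps by (intro sum.cong) (auto simp: algebra_simps)
    then show ?thesis
      using insert.hyps
      by (simp add: v_def r_def u_def sum_subtractf sum_distrib_left algebra_simps)
  qed
  show ?case
    using vI vk unfolding v
    by (intro exI[of _ "\<lambda>i. if i = k then t else c i - t * d i"]) blast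
qed

lemma square_integrable_fst:
  assumes "prob_space N" "square_integrable M f"
  shows "square_integrable (M \<Otimes>\<^sub>M N) (\<lambda>x. f (fst x))"
proof -
  interpret N: prob_space N by fact
  have "integrable (distr (M \<Otimes>\<^sub>M N) M fst) (\<lambda>x. (f x)\<^sup>2)"
    using assms(2) N.distr_pair_fst[of M] by (simp add: square_integrable_def)
  then have "integrable (M \<Otimes>\<^sub>M N) (\<lambda>x. (f (fst x))\<^sup>2)"
    by (subst (asm) integrable_distr_eq) (use assms(2) in \<open>auto simp: square_integrable_def\<close>)
  then show ?thesis
    using assms(2) by (auto simp: square_integrable_def)
qed

text \<open>The product of two square-integrable functions on the product space is integrable, which
  is what Fubini requires. This lets the integral over the signal be exchanged with inner products
  against functions of the data.\<close>

lemma integral_mult_mixture: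
  assumes "prob_space M" "prob_space N"
    and f: "square_integrable M f" and g: "square_integrable (M \<Otimes>\<^sub>M N) (\<lambda>(x, y). g x y)"
  shows "integrable N (\<lambda>y. \<integral>x. f x * g x y \<partial>M)"
    and "(\<integral>x. f x * (\<integral>y. g x y \<partial>N) \<partial>M) = (\<integral>y. (\<integral>x. f x * g x y \<partial>M) \<partial>N)"
proof -
  interpret M: prob_space M by fact
  interpret N: prob_space N by fact
  interpret pair_sigma_finite M N ..
  have *: "integrable (M \<Otimes>\<^sub>M N) (\<lambda>(x, y). f x * g x y)"
    using square_integrable_mult[OF square_integrable_fst[OF assms(2) f] g] by (simp add: case_prod_unfold)
  show "integrable N (\<lambda>y. \<integral>x. f x * g x y \<partial>M)"
    by (rule integrable_snd[OF *])
  show "(\<integral>x. f x * (\<integral>y. g x y \<partial>N) \<partial>M) = (\<integral>y. (\<integral>x. f x * g x y \<partial>M) \<partial>N)"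
    using Fubini_integral[OF *] by simp
qed

lemma (in prob_space) square_integral_le:
  assumes "square_integrable M f"
  shows "(\<integral>x. f x \<partial>M)\<^sup>2 \<le> (\<integral>x. (f x)\<^sup>2 \<partial>M)"
  using Cauchy_Schwarz_integral[OF assms, of "\<lambda>_. 1"] by (simp add: square_integrable_def prob_space)

text \<open>Jensen's inequality on almost every fibre: the square of the mixture is at most the
  mixture of the squares.\<close>

lemma square_integrable_mixture:
  assumes "prob_space M" "prob_space N"
    and g: "square_integrable (M \<Otimes>\<^sub>M N) (\<lambda>(x, y). g x y)"
  shows "square_integrable M (\<lambda>x. \<integral>y. g x y \<partial>N)"
proof -
  interpret M: prob_space M by fact
  interpret N: prob_space N by fact
  interpret pair_sigma_finite M N ..
  have m[measurable]: "(\<lambda>(x, y). g x y) \<in> borel_measurable (M \<Otimes>\<^sub>M N)"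
    and i: "integrable (M \<Otimes>\<^sub>M N) (\<lambda>(x, y). (g x y)\<^sup>2)"
    using g by (auto simp: square_integrable_def case_prod_unfold)
  have "integrable M (\<lambda>x. (\<integral>y. g x y \<partial>N)\<^sup>2)"
  proof (rule Bochner_Integration.integrable_bound)
    show "integrable M (\<lambda>x. \<integral>y. (g x y)\<^sup>2 \<partial>N)" using integrable_fst[OF i] .
    show "(\<lambda>x. (\<integral>y. g x y \<partial>N)\<^sup>2) \<in> borel_measurable M" by measurable
    have "AE x in M. integrable N (\<lambda>y. (g x y)\<^sup>2)" using AE_integrable_fst[OF i] .
    then show "AE x in M. norm ((\<integral>y. g x y \<partial>N)\<^sup>2) \<le> norm (\<integral>y. (g x y)\<^sup>2 \<partial>N)"
    proof (rule AE_mp, intro AE_I2 impI)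
      fix x assume x: "x \<in> space M" and "integrable N (\<lambda>y. (g x y)\<^sup>2)"
      then have "square_integrable N (g x)"
        by (simp add: square_integrable_def)
      from N.square_integral_le[OF this] show "norm ((\<integral>y. g x y \<partial>N)\<^sup>2) \<le> norm (\<integral>y. (g x y)\<^sup>2 \<partial>N)"
        by simp
    qed
  qed
  then show ?thesis by (simp add: square_integrable_def)
qed

text \<open>For use with \<open>y\<close> a signal: second moments in the data are bounded
  uniformly, but only for almost every signal, namely those of the prescribed norm.\<close>

lemma square_integrable_pairI:
  assumes "prob_space M" "prob_space N"
    and m[measurable]: "(\<lambda>(x, y). g x y) \<in> borel_measurable (M \<Otimes>\<^sub>M N)"
    and b: "AE y in N. (\<integral>\<^sup>+x. ennreal ((g x y)\<^sup>2) \<partial>M) \<le> ennreal C"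
  shows "square_integrable (M \<Otimes>\<^sub>M N) (\<lambda>(x, y). g x y)"
proof -
  interpret M: prob_space M by fact
  interpret N: prob_space N by fact
  interpret pair_sigma_finite M N ..
  have "(\<integral>\<^sup>+z. ennreal ((case z of (x, y) \<Rightarrow> g x y)\<^sup>2) \<partial>(M \<Otimes>\<^sub>M N)) = (\<integral>\<^sup>+y. \<integral>\<^sup>+x. ennreal ((g x y)\<^sup>2) \<partial>M \<partial>N)"
    by (subst nn_integral_snd[symmetric]) auto
  also have "\<dots> \<le> (\<integral>\<^sup>+y. ennreal C \<partial>N)"
    by (rule nn_integral_mono_AE) (use b in auto)
  also have "\<dots> < \<infinity>" by (simp add: N.emeasure_space_1)
  finally have "integrable (M \<Otimes>\<^sub>M N) (\<lambda>z. (case z of (x, y) \<Rightarrow> g x y)\<^sup>2)"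
    by (intro integrableI_bounded) auto
  then show ?thesis by (simp add: square_integrable_def)
qed

text \<open>Square integrability is not preserved by products, while finiteness of all absolute
  moments is. Polynomial expressions in Gaussian data thus get their integrability from closure
  rules alone.\<close>

definition all_moments :: "'a measure \<Rightarrow> ('a \<Rightarrow> real) \<Rightarrow> bool" where
  "all_moments M f \<longleftrightarrow> f \<in> borel_measurable M \<and> (\<forall>k. integrable M (\<lambda>x. \<bar>f x\<bar> ^ k))"

lemma all_moments_measurable: "all_moments M f \<Longrightarrow> f \<in> borel_measurable M"
  by (simp add: all_moments_def)

lemma all_moments_integrable:
  assumes "all_moments M f"
  shows "integrable M f"
proof -
  have "integrable M (\<lambda>x. \<bar>f x\<bar> ^ 1)" and [measurable]: "f \<in> borel_measurable M"
    using assms unfolding all_moments_def by blast+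
  then show ?thesis by (simp add: integrable_abs_iff)
qed

lemma all_moments_square_integrable:
  assumes "all_moments M f"
  shows "square_integrable M f"
proof -
  have "integrable M (\<lambda>x. \<bar>f x\<bar> ^ 2)" and "f \<in> borel_measurable M"
    using assms unfolding all_moments_def by blast+
  then show ?thesis by (simp add: square_integrable_def)
qed

lemma (in prob_space) all_moments_const: "all_moments M (\<lambda>_. c)"
  by (simp add: all_moments_def)

lemma all_moments_mult:
  assumes "all_moments M f" "all_moments M g"
  shows "all_moments M (\<lambda>x. f x * g x)"
proof -
  have m[measurable]: "f \<in> borel_measurable M" "g \<in> borel_measurable M"
    using assms by (auto simp: all_moments_def)
  have "integrable M (\<lambda>x. \<bar>f x * g x\<bar> ^ k)" for k
  proof -
    have "square_integrable M (\<lambda>x. \<bar>h x\<bar> ^ k)" if "all_moments M h" for h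
      using that by (auto simp: square_integrable_def all_moments_def power_mult[symmetric])
    from square_integrable_mult[OF this this, OF assms]
    show ?thesis by (simp add: abs_mult power_mult_distrib)
  qed
  then show ?thesis by (simp add: all_moments_def)
qed

lemma all_moments_add:
  assumes "all_moments M f" "all_moments M g"
  shows "all_moments M (\<lambda>x. f x + g x)"
proof -
  have m[measurable]: "f \<in> borel_measurable M" "g \<in> borel_measurable M"
    using assms by (auto simp: all_moments_def)
  have "integrable M (\<lambda>x. \<bar>f x + g x\<bar> ^ k)" for k
  proof (rule Bochner_Integration.integrable_bound)
    show "integrable M (\<lambda>x. 2 ^ k * (\<bar>f x\<bar> ^ k + \<bar>g x\<bar> ^ k))"
      using assms by (auto simp: all_moments_def)
    have "\<bar>a + b\<bar> ^ k \<le> 2 ^ k * (\<bar>a\<bar> ^ k + \<bar>b\<bar> ^ k)" for a b :: real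
    proof -
      have "\<bar>a + b\<bar> ^ k \<le> (2 * max \<bar>a\<bar> \<bar>b\<bar>) ^ k"
        by (intro power_mono) auto
      also have "\<dots> \<le> 2 ^ k * (\<bar>a\<bar> ^ k + \<bar>b\<bar> ^ k)"
        by (auto simp: power_mult_distrib max_def)
      finally show ?thesis .
    qed
    then show "AE x in M. norm (\<bar>f x + g x\<bar> ^ k) \<le> norm (2 ^ k * (\<bar>f x\<bar> ^ k + \<bar>g x\<bar> ^ k))"
      by (simp add: abs_mult)
  qed measurable
  then show ?thesis by (simp add: all_moments_def)
qed

lemma (in prob_space) all_moments_cmult: "all_moments M f \<Longrightarrow> all_moments M (\<lambda>x. c * f x)"
  by (intro all_moments_mult all_moments_const)

lemma (in prob_space) all_moments_diff:
  "all_moments M f \<Longrightarrow> all_moments M g \<Longrightarrow> all_moments M (\<lambda>x. f x - g x)"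
  using all_moments_add[OF _ all_moments_cmult[of g "-1"], of f] by simp

lemma (in prob_space) all_moments_sum:
  "(\<And>i. i \<in> I \<Longrightarrow> all_moments M (f i)) \<Longrightarrow> all_moments M (\<lambda>x. \<Sum>i\<in>I. f i x)"
  by (induction I rule: infinite_finite_induct) (auto intro: all_moments_const all_moments_add)

lemma (in prob_space) all_moments_prod:
  "(\<And>i. i \<in> I \<Longrightarrow> all_moments M (f i)) \<Longrightarrow> all_moments M (\<lambda>x. \<Prod>i\<in>I. f i x)"
  by (induction I rule: infinite_finite_induct) (auto intro: all_moments_const all_moments_mult)

lemma (in prob_space) all_moments_power: "all_moments M f \<Longrightarrow> all_moments M (\<lambda>x. f x ^ d)"
  by (induction d) (auto intro: all_moments_const all_moments_mult)

lemma all_moments_distr: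
  assumes "all_moments (distr M N h) f" "h \<in> measurable M N"
  shows "all_moments M (\<lambda>x. f (h x))"
proof -
  have [measurable]: "f \<in> borel_measurable N" using assms by (simp add: all_moments_def)
  have "integrable M (\<lambda>x. \<bar>f (h x)\<bar> ^ k)" for k
  proof -
    have "integrable (distr M N h) (\<lambda>x. \<bar>f x\<bar> ^ k)" using assms by (simp add: all_moments_def)
    then show ?thesis by (subst (asm) integrable_distr_eq) (use assms(2) in auto)
  qed
  then show ?thesis using assms(2) by (simp add: all_moments_def)
qed

lemma all_moments_distrI:
  assumes "all_moments M (\<lambda>x. f (h x))" "h \<in> measurable M N" "f \<in> borel_measurable N"
  shows "all_moments (distr M N h) f"
  using assms by (auto simp: all_moments_def integrable_distr_eq)

lemma all_moments_PiM_component: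
  assumes "\<And>i. i \<in> I \<Longrightarrow> prob_space (M i)" "i \<in> I" "all_moments (M i) f"
  shows "all_moments (PiM I M) (\<lambda>x. f (x i))"
proof (rule all_moments_distr[where N = "M i" and h = "\<lambda>x. x i"])
  show "all_moments (distr (PiM I M) (M i) (\<lambda>x. x i)) f"
    using assms(3) by (subst distr_PiM_component[OF assms(1,2)])
  show "(\<lambda>x. x i) \<in> measurable (PiM I M) (M i)"
    using assms(2) by (rule measurable_component_singleton)
qed

lemma all_moments_fst:
  assumes "prob_space N" "all_moments M f"
  shows "all_moments (M \<Otimes>\<^sub>M N) (\<lambda>x. f (fst x))"
proof -
  interpret N: prob_space N by fact
  have "all_moments (distr (M \<Otimes>\<^sub>M N) M fst) f"
    using assms(2) by (subst N.distr_pair_fst)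
  then show ?thesis by (rule all_moments_distr) (rule measurable_fst)
qed

lemma distr_pair_snd:
  assumes "prob_space M" "prob_space N"
  shows "distr (M \<Otimes>\<^sub>M N) N snd = N"
proof -
  interpret M: prob_space M by fact
  interpret N: prob_space N by fact
  interpret pair_sigma_finite M N ..
  show ?thesis
  proof (rule measure_eqI)
    fix A assume "A \<in> sets (distr (M \<Otimes>\<^sub>M N) N snd)"
    then have A: "A \<in> sets N" by simp
    then have "snd -` A \<inter> space (M \<Otimes>\<^sub>M N) = space M \<times> A"
      using sets.sets_into_space[OF A] by (auto simp: space_pair_measure)
    then show "emeasure (distr (M \<Otimes>\<^sub>M N) N snd) A = emeasure N A"
      using A by (simp add: emeasure_distr N.emeasure_pair_measure_Times M.emeasure_space_1)
  qed simp
qed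

lemma all_moments_snd:
  assumes "prob_space M" "prob_space N" "all_moments N f"
  shows "all_moments (M \<Otimes>\<^sub>M N) (\<lambda>x. f (snd x))"
proof -
  have "all_moments (distr (M \<Otimes>\<^sub>M N) N snd) f"
    using assms(3) by (subst distr_pair_snd[OF assms(1,2)])
  then show ?thesis by (rule all_moments_distr) (rule measurable_snd)
qed

section \<open>Hermite polynomials\<close>

text \<open>The monic orthogonal polynomials of N(0, t), with exponential generating function exp (x
  z - t z^2 / 2). The recurrence also makes sense at t = 0, where it yields the powers of x.\<close>

fun hermite :: "nat \<Rightarrow> real \<Rightarrow> real \<Rightarrow> real" where
  "hermite 0 t x = 1"
| "hermite (Suc 0) t x = x"
| "hermite (Suc (Suc n)) t x = x * hermite (Suc n) t x - real (Suc n) * t * hermite n t x"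

text \<open>At n = 0 the truncated index n - 1 is harmless, since its coefficient is 0.\<close>

lemma hermite_Suc: "hermite (Suc n) t x = x * hermite n t x - real n * t * hermite (n - 1) t x"
  by (cases n) auto

lemma hermite_scale: "hermite n (c\<^sup>2 * t) (c * x) = c ^ n * hermite n t x"
  by (induction n t x rule: hermite.induct) (auto simp: algebra_simps power2_eq_square)

lemma hermite_minus: "hermite n t (- x) = (-1) ^ n * hermite n t x"
  using hermite_scale[of n "-1" t x] by simp

text \<open>The generating function is multiplicative in the pair (t, x). In elementary terms, the
  right side satisfies the three-term recurrence of the left.\<close>

lemma hermite_add:
  "hermite n (s + t) (x + y) = (\<Sum>k\<le>n. real (n choose k) * hermite k s x * hermite (n - k) t y)"
proof (induction n rule: induct_nat_012)
  case (ge2 n)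
  define a where "a = (\<lambda>k. hermite k s x)"
  define b where "b = (\<lambda>k. hermite k t y)"
  define S where "S = (\<lambda>n. \<Sum>k\<le>n. real (n choose k) * a k * b (n - k))"
  let ?n = "Suc n"
  have a_Suc: "a (Suc k) = x * a k - real k * s * a (k - 1)" for k
    by (simp add: a_def hermite_Suc)
  have b_Suc: "b (Suc k) = y * b k - real k * t * b (k - 1)" for k
    by (simp add: b_def hermite_Suc)
  \<comment> \<open>Pascal's rule: the first sum raises the index of \<open>b\<close>, the second
    that of \<open>a\<close>. The recurrence for the raised factor then produces y and t, or x and
    s.\<close>
  have "S (Suc ?n) = (\<Sum>k\<le>?n. real (?n choose k) * a k * b (Suc ?n - k)) + (\<Sum>k\<le>?n. real (?n choose k) * a (Suc k) * b (?n - k))"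
  proof -
    have "S (Suc ?n) = a 0 * b (Suc ?n) + (\<Sum>k\<le>?n. real (Suc ?n choose Suc k) * a (Suc k) * b (?n - k))"
      unfolding S_def by (subst sum.atMost_Suc_shift) simp
    also have "\<dots> = a 0 * b (Suc ?n) + (\<Sum>k\<le>?n. real (?n choose Suc k) * a (Suc k) * b (?n - k)) + (\<Sum>k\<le>?n. real (?n choose k) * a (Suc k) * b (?n - k))"
      by (simp only: binomial_Suc_Suc of_nat_add distrib_right sum.distrib add.assoc add.commute)
    also have "a 0 * b (Suc ?n) + (\<Sum>k\<le>?n. real (?n choose Suc k) * a (Suc k) * b (?n - k)) =
        (\<Sum>k\<le>Suc ?n. real (?n choose k) * a k * b (Suc ?n - k))"
      by (subst (2) sum.atMost_Suc_shift) simp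
    also have "\<dots> = (\<Sum>k\<le>?n. real (?n choose k) * a k * b (Suc ?n - k))"
      by (simp add: binomial_eq_0)
    finally show ?thesis .
  qed
  also have "(\<Sum>k\<le>?n. real (?n choose k) * a k * b (Suc ?n - k)) =
      (\<Sum>k\<le>?n. y * (real (?n choose k) * a k * b (?n - k)) - t * (real (?n - k) * real (?n choose k) * a k * b (?n - k - 1)))"
    by (intro sum.cong refl) (simp add: Suc_diff_le b_Suc algebra_simps)
  also have "\<dots> = y * S ?n - t * (\<Sum>k\<le>?n. real (?n - k) * real (?n choose k) * a k * b (?n - k - 1))"
    by (simp only: sum_subtractf sum_distrib_left[symmetric] S_def)
  \<comment> \<open>The absorption identities for binomial coefficients pull the factor out; the
    second sum below is treated in the same way.\<close>
  also have "(\<Sum>k\<le>?n. real (?n - k) * real (?n choose k) * a k * b (?n - k - 1)) = real ?n * S n"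
  proof -
    have "(\<Sum>k\<le>?n. real (?n - k) * real (?n choose k) * a k * b (?n - k - 1)) = (\<Sum>k\<le>n. real (?n - k) * real (?n choose k) * a k * b (?n - k - 1))"
      by simp
    also have "\<dots> = (\<Sum>k\<le>n. real ?n * (real (n choose k) * a k * b (n - k)))"
    proof (intro sum.cong refl)
      fix k assume "k \<in> {..n}"
      then have "(?n - k) * (?n choose k) = ?n * (n choose k)"
        using binomial_absorb_comp[of ?n k] by simp
      then have "real (?n - k) * real (?n choose k) = real ?n * real (n choose k)"
        by (simp only: of_nat_mult[symmetric])
      then show "real (?n - k) * real (?n choose k) * a k * b (?n - k - 1) = real ?n * (real (n choose k) * a k * b (n - k))"
        using \<open>k \<in> {..n}\<close> by (simp add: Suc_diff_le mult.assoc)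
    qed
    finally show ?thesis by (simp only: S_def sum_distrib_left)
  qed
  also have "(\<Sum>k\<le>?n. real (?n choose k) * a (Suc k) * b (?n - k)) =
      (\<Sum>k\<le>?n. x * (real (?n choose k) * a k * b (?n - k)) - s * (real k * real (?n choose k) * a (k - 1) * b (?n - k)))"
    by (intro sum.cong refl) (simp add: a_Suc algebra_simps)
  also have "\<dots> = x * S ?n - s * (\<Sum>k\<le>?n. real k * real (?n choose k) * a (k - 1) * b (?n - k))"
    by (simp only: sum_subtractf sum_distrib_left[symmetric] S_def)
  also have "(\<Sum>k\<le>?n. real k * real (?n choose k) * a (k - 1) * b (?n - k)) = real ?n * S n"
  proof -
    have "(\<Sum>k\<le>?n. real k * real (?n choose k) * a (k - 1) * b (?n - k)) = (\<Sum>k\<le>n. real (Suc k) * real (?n choose Suc k) * a k * b (n - k))"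
      by (subst sum.atMost_Suc_shift) simp
    also have "\<dots> = (\<Sum>k\<le>n. real ?n * (real (n choose k) * a k * b (n - k)))"
    proof (intro sum.cong refl)
      fix k
      have "Suc k * (?n choose Suc k) = ?n * (n choose k)"
        using binomial_absorption[of k ?n] by (simp only: diff_Suc_1)
      then have "real (Suc k) * real (?n choose Suc k) = real ?n * real (n choose k)"
        by (simp only: of_nat_mult[symmetric])
      then show "real (Suc k) * real (?n choose Suc k) * a k * b (n - k) = real ?n * (real (n choose k) * a k * b (n - k))"
        by (simp add: mult.assoc)
    qed
    finally show ?thesis by (simp only: S_def sum_distrib_left)
  qed
  finally have "S (Suc ?n) = (x + y) * S ?n - real ?n * (s + t) * S n"
    by (simp add: algebra_simps)
  then show ?case
    using ge2 by (simp add: S_def a_def b_def)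
qed (auto)

text \<open>The coefficients stay implicit, as later they are recovered by orthogonality.\<close>

lemma monomial_eq_hermite_sum: "\<exists>c. \<forall>x. x ^ d = (\<Sum>e\<le>d. c e * hermite e t x)"
proof (induction d)
  case 0
  show ?case by (rule exI[of _ "\<lambda>_. 1"]) simp
next
  case (Suc d)
  then obtain c where c: "\<And>x. x ^ d = (\<Sum>e\<le>d. c e * hermite e t x)" by blast
  \<comment> \<open>From x H_e = H_(e+1) + e t H_(e-1): the coefficient of H_e collects the
    contributions of degrees e - 1 and e + 1.\<close>
  define c' where "c' = (\<lambda>e. (if e = 0 then 0 else c (e - 1)) + (if e < d then c (Suc e) * real (Suc e) * t else 0))"
  have "x ^ Suc d = (\<Sum>e\<le>Suc d. c' e * hermite e t x)" for x
  proof -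
    have "x ^ Suc d = (\<Sum>e\<le>d. c e * (x * hermite e t x))"
      by (simp add: c sum_distrib_left algebra_simps)
    also have "\<dots> = (\<Sum>e\<le>d. c e * hermite (Suc e) t x + c e * real e * t * hermite (e - 1) t x)"
      by (intro sum.cong refl) (simp add: hermite_Suc algebra_simps)
    also have "\<dots> = (\<Sum>e\<le>d. c e * hermite (Suc e) t x) + (\<Sum>e\<le>d. c e * real e * t * hermite (e - 1) t x)"
      by (rule sum.distrib)
    also have "(\<Sum>e\<le>d. c e * hermite (Suc e) t x) = (\<Sum>e\<le>Suc d. (if e = 0 then 0 else c (e - 1)) * hermite e t x)"
      by (subst sum.atMost_Suc_shift) simp
    also have "(\<Sum>e\<le>d. c e * real e * t * hermite (e - 1) t x) = (\<Sum>e\<le>Suc d. (if e < d then c (Suc e) * real (Suc e) * t else 0) * hermite e t x)"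
    proof (cases d)
      case (Suc d')
      have "(\<Sum>e\<le>d. c e * real e * t * hermite (e - 1) t x) = (\<Sum>e\<le>d'. c (Suc e) * real (Suc e) * t * hermite e t x)"
        unfolding Suc by (subst sum.atMost_Suc_shift) simp
      also have "\<dots> = (\<Sum>e\<le>d'. (if e < d then c (Suc e) * real (Suc e) * t else 0) * hermite e t x)"
        using Suc by (intro sum.cong) auto
      finally show ?thesis using Suc by simp
    qed simp
    finally show ?thesis by (simp add: c'_def sum.distrib distrib_right)
  qed
  then show ?case by blast
qed

section \<open>Orthogonality of Hermite polynomials under the standard normal law\<close>

abbreviation std :: "real measure" where "std \<equiv> std_normal_distribution"

lemma prob_space_std: "prob_space std"
  by (rule prob_space_normal_density) simp

lemma integrable_std_power: "integrable std (\<lambda>x. x ^ k)"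
  by (subst integrable_density) (auto intro!: integrable_std_normal_moment)

text \<open>The Gaussian expectation as a functional on formal polynomials, so that
  \<open>pderiv\<close> is available and integration by parts becomes algebra.\<close>

definition gauss_poly :: "real poly \<Rightarrow> real" where
  "gauss_poly p = (\<integral>x. poly p x \<partial>std)"

lemma integrable_std_poly: "integrable std (\<lambda>x. poly p x)"
  unfolding poly_altdef by (intro Bochner_Integration.integrable_sum integrable_mult_right integrable_std_power)

lemma std_moment:
  "(\<integral>x. x ^ (2 * k) \<partial>std) = fact (2 * k) / (2 ^ k * fact k)"
  "(\<integral>x. x ^ (2 * k + 1) \<partial>std) = 0"
  by (subst integral_density; simp add: integral_std_normal_moment_even integral_std_normal_moment_odd[simplified])+

lemma std_moment_step: "(\<integral>x. x ^ Suc (Suc n) \<partial>std) = real (Suc n) * (\<integral>x. x ^ n \<partial>std)"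
proof (cases "even n")
  case True
  then obtain k where n: "n = 2 * k" by (auto elim: evenE)
  have eq: "Suc (Suc (2 * k)) = 2 * Suc k" by simp
  show ?thesis
    unfolding n eq std_moment by (simp add: divide_simps)
next
  case False
  then obtain k where n: "n = 2 * k + 1" by (auto elim: oddE)
  have "Suc (Suc n) = 2 * Suc k + 1" using n by simp
  then show ?thesis
    unfolding n using std_moment(2)[of k] std_moment(2)[of "Suc k"] by simp
qed

lemma gauss_poly_add: "gauss_poly (p + q) = gauss_poly p + gauss_poly q"
  by (simp add: gauss_poly_def integrable_std_poly)

lemma gauss_poly_smult: "gauss_poly (smult c p) = c * gauss_poly p"
  by (simp add: gauss_poly_def integrable_std_poly)

text \<open>Stein's identity E[x p(x)] = E[p'(x)]. By linearity it suffices to treat monomials,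
  where it is the recursion of the moments.\<close>

lemma gauss_poly_pCons: "gauss_poly (pCons 0 p) = gauss_poly (pderiv p)"
proof -
  have *: "gauss_poly (pCons 0 (\<Sum>i\<in>A. monom (c i) i)) = gauss_poly (pderiv (\<Sum>i\<in>A. monom (c i) i))"
    if "finite A" for A :: "nat set" and c :: "nat \<Rightarrow> real"
    using that
  proof (induction A rule: finite_induct)
    case (insert i A)
    have "gauss_poly (monom (c i) (Suc i)) = gauss_poly (pderiv (monom (c i) i))"
      using std_moment_step[of "i - 1"] std_moment(2)[of 0]
      by (cases i) (auto simp: gauss_poly_def poly_monom pderiv_monom integrable_std_power)
    then have "gauss_poly (pCons 0 (monom (c i) i)) = gauss_poly (pderiv (monom (c i) i))"
      by (simp add: monom_Suc)
    moreover have "pCons 0 (p + q) = pCons 0 p + pCons 0 q" for p q :: "real poly" by simp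
    ultimately show ?case
      using insert by (simp only: sum.insert[OF insert.hyps] gauss_poly_add pderiv_add)
  qed (simp add: gauss_poly_def)
  show ?thesis using *[of "{..degree p}" "coeff p"] by (simp add: poly_as_sum_of_monoms)
qed

fun hermite_poly :: "nat \<Rightarrow> real poly" where
  "hermite_poly 0 = 1"
| "hermite_poly (Suc 0) = [:0, 1:]"
| "hermite_poly (Suc (Suc n)) = pCons 0 (hermite_poly (Suc n)) - smult (real (Suc n)) (hermite_poly n)"

lemma poly_hermite_poly: "poly (hermite_poly n) x = hermite n 1 x"
  by (induction n rule: hermite_poly.induct) auto

lemma pderiv_hermite_poly: "pderiv (hermite_poly (Suc n)) = smult (real (Suc n)) (hermite_poly n)"
proof (induction n rule: induct_nat_012)
  case (ge2 n)
  have "pderiv (hermite_poly (Suc (Suc (Suc n)))) =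
      pCons 0 (pderiv (hermite_poly (Suc (Suc n)))) + hermite_poly (Suc (Suc n))
      - smult (real (Suc (Suc n))) (pderiv (hermite_poly (Suc n)))"
    by (simp only: hermite_poly.simps(3)[of "Suc n"] pderiv_diff pderiv_pCons pderiv_smult add.commute)
  also have "\<dots> = smult (real (Suc (Suc (Suc n)))) (hermite_poly (Suc (Suc n)))"
    unfolding ge2 by (intro poly_eqI) (simp add: algebra_simps coeff_pCons split: nat.split)
  finally show ?case .
qed (simp_all add: pderiv_pCons one_pCons)

text \<open>H_(a+1) = x H_a - H_a', so raising the index is adjoint to differentiation, by Stein's
  identity. Iterating this moves all derivatives onto the other factor and gives
  orthogonality.\<close>

lemma gauss_poly_hermite_Suc: "gauss_poly (hermite_poly (Suc a) * q) = gauss_poly (hermite_poly a * pderiv q)"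
proof -
  define d where "d = pderiv (hermite_poly a)"
  have "hermite_poly (Suc a) + d = pCons 0 (hermite_poly a)"
    unfolding d_def by (cases a) (simp_all add: pderiv_hermite_poly one_pCons pderiv_pCons)
  then have "gauss_poly (hermite_poly (Suc a) * q) + gauss_poly (d * q) = gauss_poly (pCons 0 (hermite_poly a * q))"
    by (metis gauss_poly_add distrib_right mult_pCons_left smult_0_left add_0)
  also have "\<dots> = gauss_poly (hermite_poly a * pderiv q) + gauss_poly (d * q)"
    by (simp add: gauss_poly_pCons pderiv_mult d_def gauss_poly_add mult.commute)
  finally show ?thesis by simp
qed

lemma gauss_poly_hermite_mult:
  "gauss_poly (hermite_poly a * hermite_poly b) = (if a = b then fact a else 0)"
proof (induction a arbitrary: b)
  case 0
  have "gauss_poly 1 = 1"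
    by (simp add: gauss_poly_def prob_space.prob_space[OF prob_space_std, simplified])
  moreover have "gauss_poly (hermite_poly (Suc b')) = 0" for b'
    using gauss_poly_hermite_Suc[of b' 1] by (simp add: gauss_poly_def)
  ultimately show ?case by (cases b) auto
next
  case (Suc a)
  show ?case
  proof (cases b)
    case 0
    then show ?thesis using gauss_poly_hermite_Suc[of a 1] by (simp add: gauss_poly_def)
  next
    case (Suc b')
    then show ?thesis
      by (simp only: gauss_poly_hermite_Suc pderiv_hermite_poly mult_smult_right gauss_poly_smult Suc.IH) simp
  qed
qed

lemma integral_hermite_mult:
  "(\<integral>x. hermite a 1 x * hermite b 1 x \<partial>std) = (if a = b then fact a else 0)"
  using gauss_poly_hermite_mult[of a b] by (simp add: gauss_poly_def poly_hermite_poly)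

lemma integrable_hermite_mult: "integrable std (\<lambda>x. hermite a 1 x * hermite b 1 x)"
  using integrable_std_poly[of "hermite_poly a * hermite_poly b"] by (simp add: poly_hermite_poly)

lemma hermite_add_scaled:
  "hermite n (s + u\<^sup>2) (x + u * w) = (\<Sum>k\<le>n. real (n choose k) * u ^ k * hermite (n - k) s x * hermite k 1 w)"
  using hermite_add[of n "u\<^sup>2 * 1" s "u * w" x] unfolding hermite_scale by (simp add: add.commute ac_simps)

text \<open>Integrates out one Gaussian coordinate that enters two linear forms with weights u and
  v. Both factors are expanded by the addition formula, and orthogonality keeps the equal
  indices.\<close>

lemma integral_hermite_shifted:
  "(\<integral>w. hermite a (s + u\<^sup>2) (x + u * w) * hermite b (t + v\<^sup>2) (y + v * w) \<partial>std) =
   (\<Sum>c\<le>min a b. real (a choose c) * real (b choose c) * fact c * (u * v) ^ c * (hermite (a - c) s x * hermite (b - c) t y))"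
proof -
  define A where "A = (\<lambda>k. real (a choose k) * u ^ k * hermite (a - k) s x)"
  define B where "B = (\<lambda>k. real (b choose k) * v ^ k * hermite (b - k) t y)"
  have "(\<integral>w. hermite a (s + u\<^sup>2) (x + u * w) * hermite b (t + v\<^sup>2) (y + v * w) \<partial>std) =
      (\<integral>w. (\<Sum>k\<le>a. \<Sum>l\<le>b. A k * B l * (hermite k 1 w * hermite l 1 w)) \<partial>std)"
    unfolding hermite_add_scaled sum_product by (simp add: A_def B_def ac_simps)
  also have "\<dots> = (\<Sum>k\<le>a. (\<integral>w. (\<Sum>l\<le>b. A k * B l * (hermite k 1 w * hermite l 1 w)) \<partial>std))"
    by (intro Bochner_Integration.integral_sum Bochner_Integration.integrable_sum integrable_mult_right integrable_hermite_mult)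
  also have "\<dots> = (\<Sum>k\<le>a. \<Sum>l\<le>b. (\<integral>w. A k * B l * (hermite k 1 w * hermite l 1 w) \<partial>std))"
    by (intro sum.cong refl Bochner_Integration.integral_sum integrable_mult_right integrable_hermite_mult)
  also have "\<dots> = (\<Sum>k\<le>a. \<Sum>l\<le>b. A k * B l * (if k = l then fact k else 0))"
    by (simp only: integral_mult_right_zero integral_hermite_mult)
  also have "\<dots> = (\<Sum>k\<le>a. if k \<le> b then A k * B k * fact k else 0)"
    by (intro sum.cong refl) (simp add: if_distrib[of "\<lambda>x. _ * x"] sum.delta cong: if_cong)
  also have "\<dots> = (\<Sum>k\<le>min a b. A k * B k * fact k)"
    by (intro sum.mono_neutral_cong_right) auto
  finally show ?thesis
    by (simp add: A_def B_def power_mult_distrib ac_simps)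
qed

text \<open>Averaging over independent noise lowers the variance parameter by the variance of the
  noise. Hence V = SNR + 1 for the response is paired with SNR for the signal part.\<close>

lemma integral_hermite_smooth:
  "(\<integral>w. hermite a (s + u\<^sup>2) (x + u * w) \<partial>std) = hermite a s x"
  using integral_hermite_shifted[of a s u x 0 0 0 0] by simp

section \<open>Gaussian vectors\<close>

lemma all_moments_std: "all_moments std (\<lambda>x. x)"
proof -
  have "integrable std (\<lambda>x. \<bar>x\<bar> ^ k)" for k
    using integrable_std_power[of k, THEN integrable_abs] by (simp add: power_abs)
  then show ?thesis by (simp add: all_moments_def)
qed

lemma (in prob_space) all_moments_hermite:
  assumes "all_moments M f"
  shows "all_moments M (\<lambda>x. hermite n t (f x))"
  by (induction n t "0::real" rule: hermite.induct)
     (auto intro!: all_moments_const assms all_moments_diff all_moments_mult all_moments_cmult)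

lemma borel_measurable_hermite[measurable]: "hermite n t \<in> borel_measurable borel"
  by (induction n rule: induct_nat_012) auto

abbreviation gauss :: "'i set \<Rightarrow> ('i \<Rightarrow> real) measure" where
  "gauss J \<equiv> Pi\<^sub>M J (\<lambda>_. std)"

lemma prob_space_gauss: "prob_space (gauss J)"
  by (intro prob_space_PiM prob_space_std)

lemma all_moments_gauss_coord: "j \<in> J \<Longrightarrow> all_moments (gauss J) (\<lambda>x. x j)"
  by (rule all_moments_PiM_component[OF prob_space_std _ all_moments_std])

lemma all_moments_gauss_linear: "all_moments (gauss J) (\<lambda>x. \<Sum>j\<in>J. x j * u j)"
proof -
  interpret prob_space "gauss J" by (rule prob_space_gauss)
  show ?thesis
    by (intro all_moments_sum all_moments_mult all_moments_const all_moments_gauss_coord)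
qed

text \<open>Hermite polynomials of two linear forms, each taken at the variance of its form, are
  orthogonal for different degrees even if the forms differ. The coordinates are integrated out one
  at a time.\<close>

lemma integral_gauss_hermite:
  assumes "finite J"
  shows "(\<integral>x. hermite a (\<Sum>j\<in>J. (u j)\<^sup>2) (\<Sum>j\<in>J. x j * u j) * hermite b (\<Sum>j\<in>J. (v j)\<^sup>2) (\<Sum>j\<in>J. x j * v j) \<partial>gauss J)
    = (if a = b then fact a * (\<Sum>j\<in>J. u j * v j) ^ a else 0)"
  using assms
proof (induction J arbitrary: a b rule: finite_induct)
  case empty
  \<comment> \<open>Without coordinates the variance is 0 and the Hermite polynomials are powers,
    evaluated at 0.\<close>
  have 0: "hermite n 0 0 = (if n = 0 then 1 else 0)" for n
    by (induction n rule: induct_nat_012) auto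
  interpret prob_space "gauss {}" by (rule prob_space_gauss)
  show ?case by (auto simp: 0 prob_space[simplified])
next
  case (insert i J)
  interpret product_sigma_finite "\<lambda>_. std"
    by (intro product_sigma_finite_prob_space prob_space_std)
  interpret J: prob_space "gauss J" by (rule prob_space_gauss)
  interpret iJ: prob_space "gauss (insert i J)" by (rule prob_space_gauss)
  let ?h = "\<lambda>J a u x. hermite a (\<Sum>j\<in>J. (u j)\<^sup>2) (\<Sum>j\<in>J. x j * u j)"
  let ?H = "\<lambda>J a b x. ?h J a u x * ?h J b v x"
  have am: "all_moments (gauss J) (?H J a b)" for J a b
    by (intro all_moments_mult prob_space.all_moments_hermite prob_space_gauss all_moments_gauss_linear)
  have upd: "(\<Sum>j\<in>insert i J. (x(i := y)) j * w j) = (\<Sum>j\<in>J. x j * w j) + w i * y" for x w :: "'a \<Rightarrow> real" and y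
  proof -
    have "(\<Sum>j\<in>J. (x(i := y)) j * w j) = (\<Sum>j\<in>J. x j * w j)"
      using insert.hyps by (intro sum.cong) auto
    then show ?thesis using insert.hyps by (simp add: add.commute mult.commute)
  qed
  have "(\<integral>x. ?H (insert i J) a b x \<partial>gauss (insert i J)) = (\<integral>x. \<integral>y. ?H (insert i J) a b (x(i := y)) \<partial>std \<partial>gauss J)"
    using insert.hyps by (intro product_integral_insert all_moments_integrable am)
  also have "\<dots> = (\<integral>x. (\<Sum>c\<le>min a b. real (a choose c) * real (b choose c) * fact c * (u i * v i) ^ c * ?H J (a - c) (b - c) x) \<partial>gauss J)"
  proof -
    have sq: "(\<Sum>j\<in>insert i J. (w j)\<^sup>2) = (\<Sum>j\<in>J. (w j)\<^sup>2) + (w i)\<^sup>2" for w :: "'a \<Rightarrow> real"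
      using insert.hyps by simp
    show ?thesis by (simp only: upd sq integral_hermite_shifted)
  qed
  also have "\<dots> = (\<Sum>c\<le>min a b. real (a choose c) * real (b choose c) * fact c * (u i * v i) ^ c * (\<integral>x. ?H J (a - c) (b - c) x \<partial>gauss J))"
    by (subst Bochner_Integration.integral_sum)
       (auto intro!: integrable_mult_right all_moments_integrable am simp del: mult_eq_0_iff)
  also have "\<dots> = (\<Sum>c\<le>min a b. if a = b then real (a choose c) * real (a choose c) * fact c * fact (a - c) * (u i * v i) ^ c * (\<Sum>j\<in>J. u j * v j) ^ (a - c) else 0)"
    by (intro sum.cong refl) (auto simp: insert.IH)
  \<comment> \<open>The squared binomial coefficient times c! (a - c)! is a! times the binomial
    coefficient, so the binomial theorem collects the terms.\<close>
  also have "\<dots> = (if a = b then fact a * (\<Sum>j\<in>insert i J. u j * v j) ^ a else 0)"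
  proof -
    have bin: "real (a choose c) * real (a choose c) * fact c * fact (a - c) * X * Y = fact a * (real (a choose c) * X * Y)" if "c \<le> a" for c X Y
    proof -
      have "fact c * fact (a - c) * real (a choose c) = fact a"
        using binomial_fact_lemma[OF that] by (metis of_nat_fact of_nat_mult)
      then show ?thesis by (simp add: mult_ac)
    qed
    have "(\<Sum>c\<le>a. real (a choose c) * real (a choose c) * fact c * fact (a - c) * (u i * v i) ^ c * (\<Sum>j\<in>J. u j * v j) ^ (a - c))
        = fact a * (u i * v i + (\<Sum>j\<in>J. u j * v j)) ^ a"
      unfolding binomial_ring sum_distrib_left by (intro sum.cong refl bin) simp
    then show ?thesis by (cases "a = b") (use insert.hyps in simp_all)
  qed
  finally show ?case .
qed

section \<open>Laws of linear forms in Gaussian vectors\<close>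

lemma indep_vars_PiM_coordinates:
  assumes "\<And>i. i \<in> I \<Longrightarrow> prob_space (M i)" "I \<noteq> {}"
  shows "prob_space.indep_vars (PiM I M) M (\<lambda>i x. x i) I"
proof -
  interpret prob_space "PiM I M" by (intro prob_space_PiM assms)
  have "distr (PiM I M) (PiM I M) (\<lambda>x. \<lambda>i\<in>I. x i) = distr (PiM I M) (PiM I M) (\<lambda>x. x)"
    by (intro distr_cong) (auto simp: space_PiM)
  also have "\<dots> = PiM I M" by simp
  also have "\<dots> = PiM I (\<lambda>i. distr (PiM I M) (M i) (\<lambda>x. x i))"
    by (intro PiM_cong refl distr_PiM_component[symmetric] assms)
  finally show ?thesis
    using assms by (subst indep_vars_iff_distr_eq_PiM') auto
qed

abbreviation normal0 :: "real \<Rightarrow> real measure" where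
  "normal0 V \<equiv> density lborel (\<lambda>x. ennreal (normal_density 0 (sqrt V) x))"

lemma prob_space_normal0: "V > 0 \<Longrightarrow> prob_space (normal0 V)"
  by (rule prob_space_normal_density) simp

lemma distr_gauss_linear:
  assumes "finite J" "(\<Sum>j\<in>J. (u j)\<^sup>2) > 0"
  shows "distr (gauss J) lborel (\<lambda>x. \<Sum>j\<in>J. x j * u j) = normal0 (\<Sum>j\<in>J. (u j)\<^sup>2)"
proof -
  interpret prob_space "gauss J" by (rule prob_space_gauss)
  \<comment> \<open>Terms with coefficient 0 have no density, so only the others enter the sum of
    independent normal variables.\<close>
  define K where "K = {j\<in>J. u j \<noteq> 0}"
  have K: "K \<subseteq> J" "finite K" using assms by (auto simp: K_def)
  have "K \<noteq> {}"
  proof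
    assume "K = {}"
    then have "(\<Sum>j\<in>J. (u j)\<^sup>2) = 0" by (intro sum.neutral) (auto simp: K_def)
    then show False using assms(2) by simp
  qed
  have "J \<noteq> {}" using K \<open>K \<noteq> {}\<close> by auto
  have "distributed (gauss J) lborel (\<lambda>x. x j) (\<lambda>x. ennreal (std_normal_density x))" if "j \<in> J" for j
  proof -
    have "distr (gauss J) std (\<lambda>x. x j) = std" by (rule distr_PiM_component) (use that prob_space_std in auto)
    moreover have "distr (gauss J) std (\<lambda>x. x j) = distr (gauss J) lborel (\<lambda>x. x j)" by (intro distr_cong) auto
    moreover have "(\<lambda>x. x j) \<in> measurable (gauss J) lborel"
      using measurable_component_singleton[OF that, of "\<lambda>_. std"] by simp
    ultimately show ?thesis by (simp add: distributed_def)
  qed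
  then have d: "distributed (gauss J) lborel (\<lambda>x. x j * u j) (\<lambda>x. ennreal (normal_density 0 \<bar>u j\<bar> x))" if "j \<in> K" for j
    using normal_density_affine[of "\<lambda>x. x j" 0 1 "u j" 0] that by (auto simp: K_def mult.commute)
  have "indep_vars (\<lambda>_. std) (\<lambda>j x. x j) J"
    by (rule indep_vars_PiM_coordinates[OF prob_space_std \<open>J \<noteq> {}\<close>])
  then have "indep_vars (\<lambda>_. borel) (\<lambda>j x. x j * u j) J"
    by (rule indep_vars_compose2[where Y = "\<lambda>j y. y * u j"]) simp
  then have "indep_vars (\<lambda>_. borel) (\<lambda>j x. x j * u j) K"
    by (rule indep_vars_subset) (rule K)
  from sum_indep_normal[OF K(2) \<open>K \<noteq> {}\<close> this, of "\<lambda>j. \<bar>u j\<bar>" "\<lambda>_. 0"] d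
  have "distributed (gauss J) lborel (\<lambda>x. \<Sum>j\<in>K. x j * u j) (\<lambda>x. ennreal (normal_density 0 (sqrt (\<Sum>j\<in>K. (u j)\<^sup>2)) x))"
    by (auto simp: K_def)
  moreover have "(\<Sum>j\<in>K. x j * u j) = (\<Sum>j\<in>J. x j * u j)" for x
    using assms by (intro sum.mono_neutral_left) (auto simp: K_def)
  moreover have "(\<Sum>j\<in>K. (u j)\<^sup>2) = (\<Sum>j\<in>J. (u j)\<^sup>2)"
    using assms by (intro sum.mono_neutral_left) (auto simp: K_def)
  ultimately show ?thesis by (simp add: distributed_def)
qed

lemma distr_std_scale:
  assumes "V > 0"
  shows "distr std lborel (\<lambda>w. sqrt V * w) = normal0 V"
proof -
  interpret prob_space std by (rule prob_space_std)
  have "distr std lborel (\<lambda>x. x) = distr std std (\<lambda>x. x)" by (intro distr_cong) auto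
  then have "distributed std lborel (\<lambda>x. x) (\<lambda>x. ennreal (std_normal_density x))"
    by (simp add: distributed_def)
  from normal_density_affine[OF this, of "sqrt V" 0] assms show ?thesis
    by (simp add: distributed_def)
qed

lemma distr_std_shift: "distr std lborel (\<lambda>w. c + w) = density lborel (\<lambda>x. ennreal (normal_density c 1 x))"
proof -
  interpret prob_space std by (rule prob_space_std)
  have "distr std lborel (\<lambda>x. x) = distr std std (\<lambda>x. x)" by (intro distr_cong) auto
  then have "distributed std lborel (\<lambda>x. x) (\<lambda>x. ennreal (std_normal_density x))"
    by (simp add: distributed_def)
  from normal_density_affine[OF this, of 1 c] show ?thesis
    by (simp add: distributed_def)
qed

lemma all_moments_normal0: "V > 0 \<Longrightarrow> all_moments (normal0 V) (\<lambda>x. x)"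
  unfolding distr_std_scale[symmetric]
  by (rule all_moments_distrI) (auto intro!: prob_space.all_moments_cmult prob_space_std all_moments_std)

lemma integral_normal0:
  fixes f :: "real \<Rightarrow> real"
  assumes "V > 0" "f \<in> borel_measurable borel"
  shows "(\<integral>y. f y \<partial>normal0 V) = (\<integral>w. f (sqrt V * w) \<partial>std)"
  unfolding distr_std_scale[OF assms(1), symmetric] using assms(2) by (subst integral_distr) auto

lemma integral_normal0_hermite:
  assumes "V > 0"
  shows "(\<integral>y. hermite a V y * hermite b V y \<partial>normal0 V) = (if a = b then fact a * V ^ a else 0)"
proof -
  have "hermite n V (sqrt V * w) = sqrt V ^ n * hermite n 1 w" for n w
    using hermite_scale[of n "sqrt V" 1 w] assms by simp
  then have "(\<integral>y. hermite a V y * hermite b V y \<partial>normal0 V) = (\<integral>w. (sqrt V ^ a * sqrt V ^ b) * (hermite a 1 w * hermite b 1 w) \<partial>std)"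
    using assms by (subst integral_normal0) (auto simp: ac_simps)
  also have "\<dots> = (sqrt V ^ a * sqrt V ^ b) * (if a = b then fact a else 0)"
    by (simp only: integral_mult_right_zero integral_hermite_mult)
  finally show ?thesis using assms by (simp add: power_mult_distrib[symmetric])
qed

text \<open>Likelihood ratio of one response with mean c and unit noise against the null response,
  of variance V.\<close>

definition shift_ratio :: "real \<Rightarrow> real \<Rightarrow> real \<Rightarrow> real" where
  "shift_ratio V c y = normal_density c 1 y / normal_density 0 (sqrt V) y"

lemma shift_ratio_nonneg: "shift_ratio V c y \<ge> 0"
  by (simp add: shift_ratio_def)

lemma borel_measurable_shift_ratio[measurable]:
  assumes [measurable]: "f \<in> borel_measurable M" "g \<in> borel_measurable M"
  shows "(\<lambda>x. shift_ratio V (f x) (g x)) \<in> borel_measurable M"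
  unfolding shift_ratio_def normal_density_def by measurable

lemma nn_integral_shift_ratio:
  assumes "V > 0" and [measurable]: "f \<in> borel_measurable borel"
  shows "(\<integral>\<^sup>+y. ennreal (shift_ratio V c y) * f y \<partial>normal0 V) = (\<integral>\<^sup>+w. f (c + w) \<partial>std)"
proof -
  have "(\<integral>\<^sup>+y. ennreal (shift_ratio V c y) * f y \<partial>normal0 V) = (\<integral>\<^sup>+y. ennreal (normal_density c 1 y) * f y \<partial>lborel)"
    using normal_density_pos[of "sqrt V" 0] assms
    by (subst nn_integral_density)
       (auto intro!: nn_integral_cong simp: mult.assoc[symmetric] ennreal_mult[symmetric] shift_ratio_nonneg shift_ratio_def
          less_imp_neq[symmetric])
  also have "\<dots> = (\<integral>\<^sup>+w. f (c + w) \<partial>std)"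
  proof -
    have "(\<integral>\<^sup>+y. f y \<partial>distr std lborel (\<lambda>w. c + w)) = (\<integral>\<^sup>+w. f (c + w) \<partial>std)"
      by (rule nn_integral_distr) auto
    then show ?thesis unfolding distr_std_shift by (subst (asm) nn_integral_density) auto
  qed
  finally show ?thesis .
qed

lemma integral_shift_ratio:
  assumes "V > 0" and [measurable]: "f \<in> borel_measurable borel"
  shows "(\<integral>y. f y * shift_ratio V c y \<partial>normal0 V) = (\<integral>w. f (c + w) \<partial>std)"
    and "integrable (normal0 V) (\<lambda>y. f y * shift_ratio V c y) \<longleftrightarrow> integrable std (\<lambda>w. f (c + w))"
proof -
  have [simp]: "normal_density 0 (sqrt V) y * (f y * shift_ratio V c y) = normal_density c 1 y * f y" for y
    using normal_density_pos[of "sqrt V" 0 y] assms by (simp add: shift_ratio_def)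
  have "(\<integral>y. f y \<partial>distr std lborel (\<lambda>w. c + w)) = (\<integral>w. f (c + w) \<partial>std)"
    by (rule integral_distr) auto
  then show "(\<integral>y. f y * shift_ratio V c y \<partial>normal0 V) = (\<integral>w. f (c + w) \<partial>std)"
    unfolding distr_std_shift by (simp add: integral_density)
  have "integrable (distr std lborel (\<lambda>w. c + w)) f \<longleftrightarrow> integrable std (\<lambda>w. f (c + w))"
    by (rule integrable_distr_eq) auto
  then show "integrable (normal0 V) (\<lambda>y. f y * shift_ratio V c y) \<longleftrightarrow> integrable std (\<lambda>w. f (c + w))"
    unfolding distr_std_shift by (simp add: integrable_density)
qed

text \<open>The average over one fair label: for antisymmetric pairs the label only decides the sign
  of the mean.\<close>

definition sym_ratio :: "real \<Rightarrow> real \<Rightarrow> real \<Rightarrow> real" where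
  "sym_ratio V c y = (shift_ratio V c y + shift_ratio V (- c) y) / 2"

lemma sym_ratio_nonneg: "sym_ratio V c y \<ge> 0"
  by (simp add: sym_ratio_def shift_ratio_nonneg)

lemma borel_measurable_sym_ratio[measurable]:
  assumes [measurable]: "f \<in> borel_measurable M" "g \<in> borel_measurable M"
  shows "(\<lambda>x. sym_ratio V (f x) (g x)) \<in> borel_measurable M"
  unfolding sym_ratio_def by measurable

text \<open>Unit noise smooths the polynomial from variance s + 1 to variance s; averaging over c
  and -c then cancels odd degrees by parity.\<close>

lemma integral_hermite_sym_ratio:
  assumes "s \<ge> 0"
  shows "(\<integral>y. hermite e (s + 1) y * sym_ratio (s + 1) c y \<partial>normal0 (s + 1)) = (if even e then hermite e s c else 0)"
    and "integrable (normal0 (s + 1)) (\<lambda>y. hermite e (s + 1) y * sym_ratio (s + 1) c y)"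
proof -
  interpret prob_space std by (rule prob_space_std)
  let ?V = "s + 1"
  have V: "?V > 0" using assms by simp
  have i: "integrable std (\<lambda>w. hermite e ?V (c + w))" for c
    by (intro all_moments_integrable all_moments_hermite all_moments_add all_moments_const all_moments_std)
  have I: "integrable (normal0 ?V) (\<lambda>y. hermite e ?V y * shift_ratio ?V c y)" for c
    using i[of c] V by (subst integral_shift_ratio) auto
  have v: "(\<integral>y. hermite e ?V y * shift_ratio ?V c y \<partial>normal0 ?V) = hermite e s c" for c
    using V integral_hermite_smooth[of e s 1 c] by (subst integral_shift_ratio) auto
  have eq: "hermite e ?V y * sym_ratio ?V c y = (hermite e ?V y * shift_ratio ?V c y + hermite e ?V y * shift_ratio ?V (- c) y) / 2" for y
    by (simp add: sym_ratio_def algebra_simps)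
  show "integrable (normal0 ?V) (\<lambda>y. hermite e ?V y * sym_ratio ?V c y)"
    unfolding eq using I by (intro integrable_divide Bochner_Integration.integrable_add) auto
  show "(\<integral>y. hermite e ?V y * sym_ratio ?V c y \<partial>normal0 ?V) = (if even e then hermite e s c else 0)"
    unfolding eq using I v by (simp add: hermite_minus)
qed

text \<open>Paired with a power of y, the Hermite expansion of the ratio terminates, because degrees
  above that of the power are orthogonal to it. The infinite Mehler series is never formed.\<close>

lemma integral_power_sym_ratio:
  assumes "s \<ge> 0"
  defines "V \<equiv> s + 1"
  shows "(\<integral>y. y ^ d * sym_ratio V c y \<partial>normal0 V) =
    (\<Sum>e\<in>{e. e \<le> d \<and> even e}. hermite e s c / (fact e * V ^ e) * (\<integral>y. y ^ d * hermite e V y \<partial>normal0 V))"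
    and "d < e \<Longrightarrow> (\<integral>y. y ^ d * hermite e V y \<partial>normal0 V) = 0"
    and "integrable (normal0 V) (\<lambda>y. y ^ d * sym_ratio V c y)"
proof -
  have V: "V > 0" using assms by simp
  interpret prob_space "normal0 V" using V by (rule prob_space_normal0)
  obtain \<gamma> where \<gamma>: "\<And>y. y ^ d = (\<Sum>e\<le>d. \<gamma> e * hermite e V y)"
    using monomial_eq_hermite_sum[of d V] by blast
  have ie: "integrable (normal0 V) (\<lambda>y. hermite e V y * hermite e' V y)" for e e'
    using V by (intro all_moments_integrable all_moments_mult all_moments_hermite all_moments_normal0)
  have c: "(\<integral>y. y ^ d * hermite e V y \<partial>normal0 V) = (if e \<le> d then \<gamma> e * (fact e * V ^ e) else 0)" for e
  proof -
    have "(\<integral>y. y ^ d * hermite e V y \<partial>normal0 V) = (\<integral>y. (\<Sum>e'\<le>d. \<gamma> e' * (hermite e' V y * hermite e V y)) \<partial>normal0 V)"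
      by (simp add: \<gamma> sum_distrib_right mult.assoc)
    also have "\<dots> = (\<Sum>e'\<le>d. \<gamma> e' * (\<integral>y. hermite e' V y * hermite e V y \<partial>normal0 V))"
      by (subst Bochner_Integration.integral_sum) (auto intro!: integrable_mult_right ie)
    also have "\<dots> = (\<Sum>e'\<le>d. if e' = e then \<gamma> e * (fact e * V ^ e) else 0)"
      using V by (intro sum.cong refl) (auto simp: integral_normal0_hermite)
    finally show ?thesis by simp
  qed
  then show "d < e \<Longrightarrow> (\<integral>y. y ^ d * hermite e V y \<partial>normal0 V) = 0" by simp
  have eq: "y ^ d * sym_ratio V c y = (\<Sum>e\<le>d. \<gamma> e * (hermite e V y * sym_ratio V c y))" for y
    by (simp add: \<gamma> sum_distrib_right mult.assoc)
  have I: "integrable (normal0 V) (\<lambda>y. hermite e V y * sym_ratio V c y)" for e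
    using integral_hermite_sym_ratio(2)[OF assms(1)] by (simp add: V_def)
  show "integrable (normal0 V) (\<lambda>y. y ^ d * sym_ratio V c y)"
    unfolding eq by (intro Bochner_Integration.integrable_sum integrable_mult_right I)
  have "(\<integral>y. y ^ d * sym_ratio V c y \<partial>normal0 V) = (\<Sum>e\<le>d. \<gamma> e * (if even e then hermite e s c else 0))"
    unfolding eq using integral_hermite_sym_ratio(1)[OF assms(1), folded V_def]
    by (subst Bochner_Integration.integral_sum) (auto intro!: integrable_mult_right I simp del: mult_eq_0_iff)
  also have "\<dots> = (\<Sum>e\<in>{e. e \<le> d \<and> even e}. \<gamma> e * hermite e s c)"
    by (intro sum.mono_neutral_cong_right) auto
  also have "\<dots> = (\<Sum>e\<in>{e. e \<le> d \<and> even e}. hermite e s c / (fact e * V ^ e) * (\<integral>y. y ^ d * hermite e V y \<partial>normal0 V))"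
    using V by (intro sum.cong refl) (auto simp: c)
  finally show "(\<integral>y. y ^ d * sym_ratio V c y \<partial>normal0 V) =
    (\<Sum>e\<in>{e. e \<le> d \<and> even e}. hermite e s c / (fact e * V ^ e) * (\<integral>y. y ^ d * hermite e V y \<partial>normal0 V))" .
qed

lemma nn_integral_shift_ratio_square:
  assumes "V \<ge> 1"
  shows "(\<integral>\<^sup>+y. ennreal ((shift_ratio V c y)\<^sup>2) \<partial>normal0 V) = ennreal (V / sqrt (2 * V - 1) * exp (c\<^sup>2 / (2 * V - 1)))"
proof -
  \<comment> \<open>Completing the square in - (y - c)^2 + y^2 / (2 V) leaves a normal density with
    mean m and standard deviation \<tau>.\<close>
  define m where "m = 2 * V * c / (2 * V - 1)"
  define \<tau> where "\<tau> = sqrt (V / (2 * V - 1))"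
  have V: "V > 0" "2 * V - 1 > 0" using assms by auto
  then have \<tau>: "\<tau> > 0" "\<tau>\<^sup>2 = V / (2 * V - 1)" by (auto simp: \<tau>_def)
  have eq: "normal_density 0 (sqrt V) y * (shift_ratio V c y)\<^sup>2 = V / sqrt (2 * V - 1) * exp (c\<^sup>2 / (2 * V - 1)) * normal_density m \<tau> y" for y
  proof -
    have e: "- (y - c)\<^sup>2 + y\<^sup>2 / (2 * V) = c\<^sup>2 / (2 * V - 1) - (y - m)\<^sup>2 / (2 * \<tau>\<^sup>2)"
      unfolding \<tau> m_def using V by (simp add: field_simps) (simp add: power2_eq_square algebra_simps)
    have "normal_density 0 (sqrt V) y * (shift_ratio V c y)\<^sup>2 = (normal_density c 1 y)\<^sup>2 / normal_density 0 (sqrt V) y"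
      using normal_density_pos[of "sqrt V" 0 y] V by (simp add: shift_ratio_def power2_eq_square)
    also have "\<dots> = (1 / (2 * pi)) * sqrt (2 * pi * V) * (exp (- (y - c)\<^sup>2) * exp (y\<^sup>2 / (2 * V)))"
      using V by (simp add: normal_density_def power_divide power2_eq_square exp_minus field_simps exp_add[symmetric])
    also have "exp (- (y - c)\<^sup>2) * exp (y\<^sup>2 / (2 * V)) = exp (c\<^sup>2 / (2 * V - 1)) * exp (- (y - m)\<^sup>2 / (2 * \<tau>\<^sup>2))"
      using e by (simp add: exp_add[symmetric])
    also have "(1 / (2 * pi)) * sqrt (2 * pi * V) = V / sqrt (2 * V - 1) * (1 / sqrt (2 * pi * \<tau>\<^sup>2))"
    proof -
      have "sqrt (2 * pi * \<tau>\<^sup>2) = sqrt (2 * pi * V) / sqrt (2 * V - 1)"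
        unfolding \<tau> using V by (simp add: real_sqrt_divide)
      moreover have "sqrt (2 * pi * V) * sqrt (2 * pi * V) = 2 * pi * V" using V by simp
      ultimately show ?thesis using V by (simp add: field_simps)
    qed
    finally show ?thesis by (simp add: normal_density_def mult_ac)
  qed
  have "(\<integral>\<^sup>+y. ennreal ((shift_ratio V c y)\<^sup>2) \<partial>normal0 V) = (\<integral>\<^sup>+y. ennreal (V / sqrt (2 * V - 1) * exp (c\<^sup>2 / (2 * V - 1)) * normal_density m \<tau> y) \<partial>lborel)"
    by (subst nn_integral_density) (auto intro!: nn_integral_cong simp: ennreal_mult[symmetric] eq)
  also have "\<dots> = ennreal (V / sqrt (2 * V - 1) * exp (c\<^sup>2 / (2 * V - 1)) * (\<integral>y. normal_density m \<tau> y \<partial>lborel))"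
    using V \<tau> by (subst nn_integral_eq_integral) auto
  finally show ?thesis using \<tau> by simp
qed

text \<open>With V = s + 1 one has 2 V - 1 = 2 s + 1, so this is the average over c of the
  exponential factor in \<open>nn_integral_shift_ratio_square\<close>. It is finite because 1 / (2 s
  + 1) < 1 / (2 s), and its value cancels the square root there.\<close>

lemma nn_integral_normal0_exp_square:
  assumes "s > 0"
  shows "(\<integral>\<^sup>+x. ennreal (exp (x\<^sup>2 / (2 * s + 1))) \<partial>normal0 s) = ennreal (sqrt (2 * s + 1))"
proof -
  define \<tau> where "\<tau> = sqrt (s * (2 * s + 1))"
  have \<tau>: "\<tau> > 0" "\<tau>\<^sup>2 = s * (2 * s + 1)" using assms by (auto simp: \<tau>_def)
  have eq: "normal_density 0 (sqrt s) x * exp (x\<^sup>2 / (2 * s + 1)) = sqrt (2 * s + 1) * normal_density 0 \<tau> x" for x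
  proof -
    have e: "- x\<^sup>2 / (2 * s) + x\<^sup>2 / (2 * s + 1) = - x\<^sup>2 / (2 * \<tau>\<^sup>2)"
      unfolding \<tau> using assms by (simp add: field_simps)
    have "normal_density 0 (sqrt s) x * exp (x\<^sup>2 / (2 * s + 1)) = 1 / sqrt (2 * pi * s) * exp (- x\<^sup>2 / (2 * \<tau>\<^sup>2))"
      using assms e by (simp add: normal_density_def exp_add[symmetric])
    also have "1 / sqrt (2 * pi * s) = sqrt (2 * s + 1) / sqrt (2 * pi * \<tau>\<^sup>2)"
      unfolding \<tau> using assms by (simp add: real_sqrt_mult)
    finally show ?thesis by (simp add: normal_density_def)
  qed
  have "(\<integral>\<^sup>+x. ennreal (exp (x\<^sup>2 / (2 * s + 1))) \<partial>normal0 s) = (\<integral>\<^sup>+x. ennreal (sqrt (2 * s + 1) * normal_density 0 \<tau> x) \<partial>lborel)"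
    by (subst nn_integral_density) (auto simp: eq[symmetric] ennreal_mult[symmetric])
  also have "\<dots> = ennreal (sqrt (2 * s + 1) * (\<integral>y. normal_density 0 \<tau> y \<partial>lborel))"
    using assms \<tau> by (subst nn_integral_eq_integral) auto
  finally show ?thesis using \<tau> by simp
qed

section \<open>A single observation\<close>

lemma integral_pair_mult:
  fixes f :: "'a \<Rightarrow> real" and g :: "'b \<Rightarrow> real"
  assumes "prob_space M" "prob_space N"
    and "integrable (M \<Otimes>\<^sub>M N) (\<lambda>z. f (fst z) * g (snd z))"
  shows "(\<integral>z. f (fst z) * g (snd z) \<partial>(M \<Otimes>\<^sub>M N)) = (\<integral>x. f x \<partial>M) * (\<integral>y. g y \<partial>N)"
proof -
  interpret M: prob_space M by fact
  interpret N: prob_space N by fact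
  interpret pair_sigma_finite M N ..
  show ?thesis using integral_fst'[OF assms(3)] by simp
qed

abbreviation lin :: "nat \<Rightarrow> (nat \<Rightarrow> real) \<Rightarrow> (nat \<Rightarrow> real) \<Rightarrow> real" where
  "lin p x u \<equiv> \<Sum>j<p. x j * u j"

definition obs :: "nat \<Rightarrow> real \<Rightarrow> ((nat \<Rightarrow> real) \<times> real) measure" where
  "obs p V = gauss {..<p} \<Otimes>\<^sub>M normal0 V"

lemma prob_space_obs: "V > 0 \<Longrightarrow> prob_space (obs p V)"
  unfolding obs_def by (intro prob_space_pair prob_space_gauss prob_space_normal0)

lemma measurable_lin[measurable (raw)]:
  assumes [measurable]: "\<And>j. j < p \<Longrightarrow> (\<lambda>z. f z j) \<in> borel_measurable M" "\<And>j. j < p \<Longrightarrow> (\<lambda>z. u z j) \<in> borel_measurable M"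
  shows "(\<lambda>z. lin p (f z) (u z)) \<in> borel_measurable M"
  by (intro borel_measurable_sum borel_measurable_times assms) auto

lemma all_moments_obs_fst:
  assumes "V > 0" "all_moments (gauss {..<p}) f"
  shows "all_moments (obs p V) (\<lambda>z. f (fst z))"
  unfolding obs_def by (intro all_moments_fst prob_space_normal0 assms)

lemma all_moments_obs_snd:
  assumes "V > 0" "all_moments (normal0 V) f"
  shows "all_moments (obs p V) (\<lambda>z. f (snd z))"
  unfolding obs_def by (intro all_moments_snd prob_space_gauss prob_space_normal0 assms)

lemma measurable_obs_lin[measurable]: "(\<lambda>z. lin p (fst z) u) \<in> borel_measurable (obs p V)"
  unfolding obs_def by (intro measurable_lin) (auto intro: measurable_compose[OF measurable_fst] measurable_component_singleton[of _ _ "\<lambda>_. std", simplified])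

lemma measurable_obs_snd[measurable]: "(\<lambda>z. snd z) \<in> borel_measurable (obs p V)"
  unfolding obs_def by (simp add: measurable_snd')

text \<open>Under the null the linear form has law N(0, s), independent of y, and the second moment
  of the ratio for either sign is exactly V. Convexity of the square passes to the average of the
  two.\<close>

lemma square_integrable_sym_ratio:
  assumes "(\<Sum>j<p. (u j)\<^sup>2) = s" "s > 0"
  defines "V \<equiv> s + 1"
  shows "(\<integral>\<^sup>+z. ennreal ((sym_ratio V (lin p (fst z) u) (snd z))\<^sup>2) \<partial>obs p V) \<le> ennreal V"
    and "square_integrable (obs p V) (\<lambda>z. sym_ratio V (lin p (fst z) u) (snd z))"
proof -
  have V: "V \<ge> 1" "V > 0" using assms by auto
  have sV: "2 * s + 1 = 2 * V - 1" by (simp add: V_def)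
  define h :: real where "h = 1 / 2"
  have h: "h \<ge> 0" "h * x + h * x = x" "2 * h = 1" for x by (simp_all add: h_def)
  interpret G: prob_space "gauss {..<p}" by (rule prob_space_gauss)
  interpret N: prob_space "normal0 V" using V by (intro prob_space_normal0)
  have ml: "(\<lambda>z. lin p z u) \<in> borel_measurable (gauss {..<p})"
    using all_moments_gauss_linear by (rule all_moments_measurable)
  have *: "(\<integral>\<^sup>+z. ennreal ((shift_ratio V (c * lin p (fst z) u) (snd z))\<^sup>2) \<partial>obs p V) = ennreal V" if "c\<^sup>2 = 1" for c
  proof -
    have "(\<integral>\<^sup>+z. ennreal ((shift_ratio V (c * lin p (fst z) u) (snd z))\<^sup>2) \<partial>obs p V) =
       (\<integral>\<^sup>+x. \<integral>\<^sup>+y. ennreal ((shift_ratio V (c * lin p x u) y)\<^sup>2) \<partial>normal0 V \<partial>gauss {..<p})"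
      unfolding obs_def by (subst N.nn_integral_fst[symmetric]) (auto simp: obs_def[symmetric])
    also have "\<dots> = (\<integral>\<^sup>+x. ennreal (V / sqrt (2 * V - 1)) * ennreal (exp ((lin p x u)\<^sup>2 / (2 * V - 1))) \<partial>gauss {..<p})"
      using V that by (subst nn_integral_shift_ratio_square) (auto simp: power_mult_distrib ennreal_mult[symmetric])
    also have "\<dots> = ennreal (V / sqrt (2 * V - 1)) * (\<integral>\<^sup>+x. ennreal (exp ((lin p x u)\<^sup>2 / (2 * V - 1))) \<partial>gauss {..<p})"
      using ml by (intro nn_integral_cmult) auto
    also have "(\<integral>\<^sup>+x. ennreal (exp ((lin p x u)\<^sup>2 / (2 * V - 1))) \<partial>gauss {..<p}) =
        (\<integral>\<^sup>+a. ennreal (exp (a\<^sup>2 / (2 * V - 1))) \<partial>distr (gauss {..<p}) lborel (\<lambda>x. lin p x u))"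
      using ml by (intro nn_integral_distr[symmetric]) auto
    also have "\<dots> = ennreal (sqrt (2 * V - 1))"
      using assms(1,2) nn_integral_normal0_exp_square[OF assms(2), unfolded sV]
      by (subst distr_gauss_linear) simp_all
    also have "ennreal (V / sqrt (2 * V - 1)) * ennreal (sqrt (2 * V - 1)) = ennreal V"
      using V by (simp add: ennreal_mult[symmetric])
    finally show ?thesis .
  qed
  have "(\<integral>\<^sup>+z. ennreal ((sym_ratio V (lin p (fst z) u) (snd z))\<^sup>2) \<partial>obs p V) \<le>
     (\<integral>\<^sup>+z. ennreal h * ennreal ((shift_ratio V (1 * lin p (fst z) u) (snd z))\<^sup>2) + ennreal h * ennreal ((shift_ratio V ((-1) * lin p (fst z) u) (snd z))\<^sup>2) \<partial>obs p V)"
  proof (intro nn_integral_mono)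
    fix z
    have "((a + b) / 2)\<^sup>2 \<le> h * a\<^sup>2 + h * b\<^sup>2" for a b :: real
      using sum_squares_bound[of a b] by (simp add: h_def power_divide power2_sum field_simps)
    then show "ennreal ((sym_ratio V (lin p (fst z) u) (snd z))\<^sup>2) \<le> ennreal h * ennreal ((shift_ratio V (1 * lin p (fst z) u) (snd z))\<^sup>2) + ennreal h * ennreal ((shift_ratio V ((-1) * lin p (fst z) u) (snd z))\<^sup>2)"
      using h by (simp add: sym_ratio_def ennreal_mult[symmetric] ennreal_plus[symmetric] del: ennreal_plus)
  qed
  also have "\<dots> = ennreal h * ennreal V + ennreal h * ennreal V"
    by (subst nn_integral_add) (auto simp: nn_integral_cmult *[of 1, simplified] *[of "-1", simplified])
  also have "\<dots> = ennreal V"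
    using V h by (simp add: ennreal_mult[symmetric] ennreal_plus[symmetric] del: ennreal_plus)
  finally show le: "(\<integral>\<^sup>+z. ennreal ((sym_ratio V (lin p (fst z) u) (snd z))\<^sup>2) \<partial>obs p V) \<le> ennreal V" .
  have "integrable (obs p V) (\<lambda>z. (sym_ratio V (lin p (fst z) u) (snd z))\<^sup>2)"
    using le by (intro integrableI_bounded) (auto intro: le_less_trans)
  then show "square_integrable (obs p V) (\<lambda>z. sym_ratio V (lin p (fst z) u) (snd z))"
    by (simp add: square_integrable_def)
qed

text \<open>In normalized Hermite polynomials this is the e-th Mehler term with correlation sqrt (s
  / (s + 1)), which is the correlation between signal part and response, up to the sign set by the
  label.\<close>

definition mehler :: "nat \<Rightarrow> real \<Rightarrow> real \<Rightarrow> real \<Rightarrow> real" where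
  "mehler e s a y = hermite e s a * hermite e (s + 1) y / (fact e * (s + 1) ^ e)"

lemma all_moments_mehler:
  assumes "s \<ge> 0"
  shows "all_moments (obs p (s + 1)) (\<lambda>z. mehler e s (lin p (fst z) u) (snd z))"
proof -
  have V: "s + 1 > 0" using assms by simp
  interpret prob_space "obs p (s + 1)" by (rule prob_space_obs[OF V])
  have "all_moments (obs p (s + 1)) (\<lambda>z. (1 / (fact e * (s + 1) ^ e)) * (hermite e s (lin p (fst z) u) * hermite e (s + 1) (snd z)))"
    by (intro all_moments_cmult all_moments_mult all_moments_obs_fst[OF V] all_moments_obs_snd[OF V] prob_space.all_moments_hermite prob_space_gauss
        prob_space_normal0[OF V] all_moments_gauss_linear all_moments_normal0[OF V])
  then show ?thesis by (simp add: mehler_def)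
qed

text \<open>Covariates and response are independent under the null. For equal degrees the covariates
  contribute e! times the e-th power of the inner product, the response e! (s + 1)^e. That u and v
  may differ is what makes the second moment of a mixture computable.\<close>

lemma integral_mehler_mult:
  assumes "(\<Sum>j<p. (u j)\<^sup>2) = s" "(\<Sum>j<p. (v j)\<^sup>2) = s"
  shows "(\<integral>z. mehler e s (lin p (fst z) u) (snd z) * mehler e' s (lin p (fst z) v) (snd z) \<partial>obs p (s + 1)) =
     (if e = e' then ((\<Sum>j<p. u j * v j) / (s + 1)) ^ e else 0)"
proof -
  have s: "s \<ge> 0" using assms(1) by (auto intro: sum_nonneg)
  then have V: "s + 1 > 0" by simp
  let ?c = "1 / (fact e * (s + 1) ^ e) * (1 / (fact e' * (s + 1) ^ e'))"
  let ?f = "\<lambda>x. ?c * (hermite e s (lin p x u) * hermite e' s (lin p x v))"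
  let ?g = "\<lambda>y. hermite e (s + 1) y * hermite e' (s + 1) y"
  have eq: "mehler e s (lin p (fst z) u) (snd z) * mehler e' s (lin p (fst z) v) (snd z) = ?f (fst z) * ?g (snd z)" for z
    by (simp add: mehler_def)
  have "integrable (obs p (s + 1)) (\<lambda>z. mehler e s (lin p (fst z) u) (snd z) * mehler e' s (lin p (fst z) v) (snd z))"
    using s by (intro all_moments_integrable all_moments_mult all_moments_mehler)
  then have "(\<integral>z. ?f (fst z) * ?g (snd z) \<partial>obs p (s + 1)) = (\<integral>x. ?f x \<partial>gauss {..<p}) * (\<integral>y. ?g y \<partial>normal0 (s + 1))"
    unfolding eq obs_def by (intro integral_pair_mult prob_space_gauss prob_space_normal0 V)
  also have "(\<integral>x. ?f x \<partial>gauss {..<p}) = ?c * (if e = e' then fact e * (\<Sum>j<p. u j * v j) ^ e else 0)"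
    using integral_gauss_hermite[of "{..<p}" e u e' v] assms by simp
  also have "(\<integral>y. ?g y \<partial>normal0 (s + 1)) = (if e = e' then fact e * (s + 1) ^ e else 0)"
    by (rule integral_normal0_hermite[OF V])
  finally show ?thesis
    unfolding eq using V by (auto simp: power_divide)
qed

text \<open>The covariate part f is arbitrary: the power of the response alone decides which Mehler
  terms survive. This is why the truncation later counts the degree in the response.\<close>

lemma integral_sym_ratio_eq_mehler:
  assumes u: "(\<Sum>j<p. (u j)\<^sup>2) = s" and s: "s > 0" and f: "all_moments (gauss {..<p}) f"
  shows "(\<integral>z. f (fst z) * snd z ^ d * sym_ratio (s + 1) (lin p (fst z) u) (snd z) \<partial>obs p (s + 1)) =
     (\<Sum>e\<in>{e. e \<le> d \<and> even e}. \<integral>z. f (fst z) * snd z ^ d * mehler e s (lin p (fst z) u) (snd z) \<partial>obs p (s + 1))"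
    (is "?L = (\<Sum>e\<in>?E. ?R e)")
    and "d < e \<Longrightarrow> (\<integral>z. f (fst z) * snd z ^ d * mehler e s (lin p (fst z) u) (snd z) \<partial>obs p (s + 1)) = 0"
proof -
  let ?V = "s + 1"
  have V: "?V > 0" and s0: "s \<ge> 0" using s by auto
  interpret G: prob_space "gauss {..<p}" by (rule prob_space_gauss)
  interpret N: prob_space "normal0 ?V" using V by (intro prob_space_normal0)
  interpret O: prob_space "obs p ?V" by (rule prob_space_obs[OF V])
  interpret pair_sigma_finite "gauss {..<p}" "normal0 ?V" ..
  have fy: "all_moments (obs p ?V) (\<lambda>z. f (fst z) * snd z ^ d)"
    by (intro all_moments_mult O.all_moments_power all_moments_obs_fst[OF V] f all_moments_obs_snd[OF V] all_moments_normal0 V)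
  have i1: "integrable (obs p ?V) (\<lambda>z. f (fst z) * snd z ^ d * sym_ratio ?V (lin p (fst z) u) (snd z))"
    by (intro square_integrable_mult all_moments_square_integrable fy square_integrable_sym_ratio u s)
  have i2: "integrable (obs p ?V) (\<lambda>z. f (fst z) * snd z ^ d * mehler e s (lin p (fst z) u) (snd z))" for e
    by (intro all_moments_integrable all_moments_mult fy all_moments_mehler s0)
  have L: "?L = (\<integral>x. f x * (\<integral>y. y ^ d * sym_ratio ?V (lin p x u) y \<partial>normal0 ?V) \<partial>gauss {..<p})"
    using integral_fst'[OF i1[unfolded obs_def], symmetric] by (simp add: obs_def mult.assoc)
  have R: "?R e = (\<integral>x. f x * (hermite e s (lin p x u) / (fact e * ?V ^ e) * (\<integral>y. y ^ d * hermite e ?V y \<partial>normal0 ?V)) \<partial>gauss {..<p})" for e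
  proof -
    have "?R e = (\<integral>x. \<integral>y. (f x * (hermite e s (lin p x u) / (fact e * ?V ^ e))) * (y ^ d * hermite e ?V y) \<partial>normal0 ?V \<partial>gauss {..<p})"
      using integral_fst'[OF i2[unfolded obs_def, of e], symmetric] by (simp add: obs_def mehler_def mult_ac)
    then show ?thesis by (simp add: mult.assoc)
  qed
  show "d < e \<Longrightarrow> ?R e = 0"
    unfolding R using integral_power_sym_ratio(2)[OF s0] by simp
  have "?L = (\<integral>x. (\<Sum>e\<in>?E. f x * (hermite e s (lin p x u) / (fact e * ?V ^ e) * (\<integral>y. y ^ d * hermite e ?V y \<partial>normal0 ?V))) \<partial>gauss {..<p})"
    unfolding L integral_power_sym_ratio(1)[OF s0] by (simp only: sum_distrib_left)
  also have "\<dots> = (\<Sum>e\<in>?E. ?R e)"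
    unfolding R
  proof (intro Bochner_Integration.integral_sum)
    fix e
    have "all_moments (gauss {..<p}) (\<lambda>x. ((\<integral>y. y ^ d * hermite e ?V y \<partial>normal0 ?V) / (fact e * ?V ^ e)) * (f x * hermite e s (lin p x u)))"
      by (intro G.all_moments_cmult all_moments_mult f G.all_moments_hermite all_moments_gauss_linear)
    from all_moments_integrable[OF this]
    show "integrable (gauss {..<p}) (\<lambda>x. f x * (hermite e s (lin p x u) / (fact e * ?V ^ e) * (\<integral>y. y ^ d * hermite e ?V y \<partial>normal0 ?V)))"
      by (simp add: mult_ac)
  qed
  finally show "?L = (\<Sum>e\<in>?E. ?R e)" .
qed

section \<open>The null distribution and the truncated Mehler expansion\<close>

text \<open>Lays out independent observations in the order used by \<open>data_vector\<close>, so
  that the null law becomes the image of a product over observations.\<close>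

definition encode :: "nat \<Rightarrow> nat \<Rightarrow> (nat \<Rightarrow> (nat \<Rightarrow> real) \<times> real) \<Rightarrow> nat \<Rightarrow> real" where
  "encode n p \<zeta> = (\<lambda>t\<in>{..<n * p + n}. if t < n * p then fst (\<zeta> (t div p)) (t mod p) else snd (\<zeta> (t - n * p)))"

definition sample :: "nat \<Rightarrow> nat \<Rightarrow> real \<Rightarrow> (nat \<Rightarrow> (nat \<Rightarrow> real) \<times> real) measure" where
  "sample n p V = Pi\<^sub>M {..<n} (\<lambda>_. obs p V)"

definition null_law :: "nat \<Rightarrow> nat \<Rightarrow> real \<Rightarrow> (nat \<Rightarrow> real) measure" where
  "null_law n p V = distr (sample n p V) (Rn (n * p + n)) (encode n p)"

lemma row_index_less: "i < n \<Longrightarrow> j < p \<Longrightarrow> i * p + j < n * (p::nat)"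
  by (metis add_strict_left_mono less_le_trans mult_Suc mult_le_mono1 Suc_leI add.commute)

lemma encode_row [simp]: "i < n \<Longrightarrow> j < p \<Longrightarrow> encode n p \<zeta> (i * p + j) = fst (\<zeta> i) j"
  using row_index_less[of i n j p] by (simp add: encode_def)

lemma encode_response [simp]: "i < n \<Longrightarrow> encode n p \<zeta> (n * p + i) = snd (\<zeta> i)"
  by (simp add: encode_def)

lemma measurable_encode[measurable]: "encode n p \<in> measurable (sample n p V) (Rn (n * p + n))"
  unfolding encode_def
proof (rule measurable_restrict)
  fix t assume t: "t \<in> {..<n * p + n}"
  show "(\<lambda>\<zeta>. if t < n * p then fst (\<zeta> (t div p)) (t mod p) else snd (\<zeta> (t - n * p))) \<in> borel_measurable (sample n p V)"
  proof (cases "t < n * p")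
    case True
    then have "p > 0" by (cases p) auto
    then have *: "t div p < n" "t mod p < p"
      using True by (auto simp: less_mult_imp_div_less)
    have "(\<lambda>\<zeta>. \<zeta> (t div p)) \<in> measurable (sample n p V) (gauss {..<p} \<Otimes>\<^sub>M normal0 V)"
      unfolding sample_def obs_def using * by (intro measurable_component_singleton) auto
    from measurable_compose[OF this measurable_fst]
    have "(\<lambda>\<zeta>. fst (\<zeta> (t div p)) (t mod p)) \<in> measurable (sample n p V) std"
      by (rule measurable_compose) (use * in \<open>auto intro!: measurable_component_singleton\<close>)
    then show ?thesis using True by simp
  next
    case False
    then have "t - n * p < n" using t by auto
    then have "(\<lambda>\<zeta>. \<zeta> (t - n * p)) \<in> measurable (sample n p V) (gauss {..<p} \<Otimes>\<^sub>M normal0 V)"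
      unfolding sample_def obs_def by (intro measurable_component_singleton) auto
    from measurable_compose[OF this measurable_snd] show ?thesis using False by simp
  qed
qed

lemma prob_space_sample: "V > 0 \<Longrightarrow> prob_space (sample n p V)"
  unfolding sample_def by (intro prob_space_PiM prob_space_obs)

lemma prob_space_null_law: "V > 0 \<Longrightarrow> prob_space (null_law n p V)"
  unfolding null_law_def by (intro prob_space.prob_space_distr prob_space_sample measurable_encode)

lemma sets_null_law[measurable_cong]: "sets (null_law n p V) = sets (Rn (n * p + n))"
  by (simp add: null_law_def)

lemma product_sigma_finite_obs: "V > 0 \<Longrightarrow> product_sigma_finite (\<lambda>_. obs p V)"
  by (intro product_sigma_finite_prob_space prob_space_obs)

lemma integral_null_law:
  fixes f :: "(nat \<Rightarrow> real) \<Rightarrow> real"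
  assumes "f \<in> borel_measurable (Rn (n * p + n))"
  shows "(\<integral>v. f v \<partial>null_law n p V) = (\<integral>\<zeta>. f (encode n p \<zeta>) \<partial>sample n p V)"
  unfolding null_law_def by (intro integral_distr measurable_encode assms)

lemma integral_null_law_prod:
  fixes F :: "nat \<Rightarrow> (nat \<Rightarrow> real) \<times> real \<Rightarrow> real"
  assumes "V > 0" and m: "f \<in> borel_measurable (Rn (n * p + n))"
    and "\<And>\<zeta>. f (encode n p \<zeta>) = (\<Prod>i<n. F i (\<zeta> i))"
    and "\<And>i. i < n \<Longrightarrow> integrable (obs p V) (F i)"
  shows "(\<integral>v. f v \<partial>null_law n p V) = (\<Prod>i<n. \<integral>z. F i z \<partial>obs p V)"
proof -
  interpret product_sigma_finite "\<lambda>_. obs p V" by (rule product_sigma_finite_obs) fact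
  show ?thesis
    unfolding integral_null_law[OF m] assms(3) sample_def
    by (rule product_integral_prod) (use assms(4) in auto)
qed

lemma all_moments_null_law_coord:
  assumes V: "V > 0" and t: "t < n * p + n"
  shows "all_moments (null_law n p V) (\<lambda>v. v t)"
  unfolding null_law_def
proof (rule all_moments_distrI[OF _ measurable_encode])
  have c: "all_moments (sample n p V) (\<lambda>\<zeta>. f (\<zeta> i))" if "i < n" "all_moments (obs p V) f" for f i
    unfolding sample_def by (rule all_moments_PiM_component) (use that prob_space_obs V in auto)
  show "all_moments (sample n p V) (\<lambda>\<zeta>. encode n p \<zeta> t)"
  proof (cases "t < n * p")
    case True
    then have "p > 0" by (cases p) auto
    then have *: "t div p < n" "t mod p < p"
      using True by (auto simp: less_mult_imp_div_less)
    have "all_moments (sample n p V) (\<lambda>\<zeta>. fst (\<zeta> (t div p)) (t mod p))"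
      by (intro c * all_moments_obs_fst V all_moments_gauss_coord) (use * in auto)
    then show ?thesis using True by (simp add: encode_def)
  next
    case False
    then have *: "t - n * p < n" using t by auto
    have "all_moments (sample n p V) (\<lambda>\<zeta>. snd (\<zeta> (t - n * p)))"
      by (intro c * all_moments_obs_snd[where f = "\<lambda>x. x"] V all_moments_normal0)
    then show ?thesis using False t by (simp add: encode_def)
  qed
  show "(\<lambda>v. v t) \<in> borel_measurable (Rn (n * p + n))"
    using t by (intro measurable_component_singleton) auto
qed

definition lr_given :: "nat \<Rightarrow> nat \<Rightarrow> real \<Rightarrow> (nat \<Rightarrow> real) \<Rightarrow> (nat \<Rightarrow> real) \<Rightarrow> real" where
  "lr_given n p s u v = (\<Prod>i<n. sym_ratio (s + 1) (lin p (\<lambda>j. v (i * p + j)) u) (v (n * p + i)))"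

definition mehler_sum :: "nat \<Rightarrow> nat \<Rightarrow> real \<Rightarrow> (nat \<Rightarrow> nat) set \<Rightarrow> (nat \<Rightarrow> real) \<Rightarrow> (nat \<Rightarrow> real) \<Rightarrow> real" where
  "mehler_sum n p s B u v = (\<Sum>b\<in>B. \<Prod>i<n. mehler (b i) s (lin p (\<lambda>j. v (i * p + j)) u) (v (n * p + i)))"

definition even_degrees :: "nat \<Rightarrow> nat \<Rightarrow> (nat \<Rightarrow> nat) set" where
  "even_degrees n D = {b \<in> {..<n} \<rightarrow>\<^sub>E {..D}. (\<forall>i<n. even (b i)) \<and> (\<Sum>i<n. b i) \<le> D}"

lemma finite_even_degrees: "finite (even_degrees n D)"
  unfolding even_degrees_def by (rule finite_subset[OF _ finite_PiE[of "{..<n}" "\<lambda>_. {..D}"]]) auto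

lemma lin_encode: "i < n \<Longrightarrow> lin p (\<lambda>j. encode n p \<zeta> (i * p + j)) u = lin p (fst (\<zeta> i)) u"
  by (intro sum.cong) auto

lemma lr_given_encode: "lr_given n p s u (encode n p \<zeta>) = (\<Prod>i<n. sym_ratio (s + 1) (lin p (fst (\<zeta> i)) u) (snd (\<zeta> i)))"
  unfolding lr_given_def by (intro prod.cong) (auto simp: lin_encode)

lemma measurable_data_lin:
  assumes "sets M = sets (Rn (n * p + n))" "sets N = sets (Rn p)" "i < n"
  shows "(\<lambda>z. lin p (\<lambda>j. fst z (i * p + j)) (snd z)) \<in> borel_measurable (M \<Otimes>\<^sub>M N)"
    "(\<lambda>z. fst z (n * p + i)) \<in> borel_measurable (M \<Otimes>\<^sub>M N)"
proof -
  have m: "(\<lambda>z. fst z t) \<in> borel_measurable (M \<Otimes>\<^sub>M N)" if "t < n * p + n" for t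
  proof (rule measurable_compose[OF measurable_fst])
    show "(\<lambda>v. v t) \<in> borel_measurable M"
      unfolding measurable_cong_sets[OF assms(1) refl] using that by (intro measurable_component_singleton) auto
  qed
  have m2: "(\<lambda>z. snd z t) \<in> borel_measurable (M \<Otimes>\<^sub>M N)" if "t < p" for t
  proof (rule measurable_compose[OF measurable_snd])
    show "(\<lambda>v. v t) \<in> borel_measurable N"
      unfolding measurable_cong_sets[OF assms(2) refl] using that by (intro measurable_component_singleton) auto
  qed
  show "(\<lambda>z. lin p (\<lambda>j. fst z (i * p + j)) (snd z)) \<in> borel_measurable (M \<Otimes>\<^sub>M N)"
    using assms(3) row_index_less[of i n _ p] by (intro measurable_lin m m2) (auto intro: trans_less_add1)
  show "(\<lambda>z. fst z (n * p + i)) \<in> borel_measurable (M \<Otimes>\<^sub>M N)"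
    using assms(3) by (intro m) auto
qed

lemma measurable_lr_given:
  assumes "sets M = sets (Rn (n * p + n))" "sets N = sets (Rn p)"
  shows "(\<lambda>(v, u). lr_given n p s u v) \<in> borel_measurable (M \<Otimes>\<^sub>M N)"
  unfolding lr_given_def case_prod_unfold
  by (intro borel_measurable_prod borel_measurable_sym_ratio measurable_data_lin[OF assms]) auto

lemma measurable_mehler_sum:
  assumes "sets M = sets (Rn (n * p + n))" "sets N = sets (Rn p)"
  shows "(\<lambda>(v, u). mehler_sum n p s B u v) \<in> borel_measurable (M \<Otimes>\<^sub>M N)"
proof -
  have *: "(\<lambda>z. mehler e s (f z) (g z)) \<in> borel_measurable (M \<Otimes>\<^sub>M N)"
    if [measurable]: "f \<in> borel_measurable (M \<Otimes>\<^sub>M N)" "g \<in> borel_measurable (M \<Otimes>\<^sub>M N)" for e f g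
    unfolding mehler_def by measurable
  show ?thesis
    unfolding mehler_sum_def case_prod_unfold
    by (rule borel_measurable_sum, rule borel_measurable_prod, rule *) (auto intro: measurable_data_lin[OF assms])
qed

lemma measurable_lr_given_data:
  assumes "sets M = sets (Rn (n * p + n))" "u \<in> space (Rn p)"
  shows "lr_given n p s u \<in> borel_measurable M"
  using measurable_Pair1'[of u "Rn p" M] measurable_lr_given[OF assms(1) refl, of s] assms(2)
  by (auto dest: measurable_compose)

lemma all_moments_null_law_mehler:
  assumes "s \<ge> 0" "i < n"
  shows "all_moments (null_law n p (s + 1)) (\<lambda>v. mehler e s (lin p (\<lambda>j. v (i * p + j)) u) (v (n * p + i)))"
proof -
  have V: "s + 1 > 0" using assms by simp
  interpret prob_space "null_law n p (s + 1)" by (rule prob_space_null_law[OF V])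
  have "i * p + j < n * p + n" if "j < p" for j
    using row_index_less[OF assms(2) that] by simp
  then have "all_moments (null_law n p (s + 1)) (\<lambda>v. (1 / (fact e * (s + 1) ^ e)) * (hermite e s (lin p (\<lambda>j. v (i * p + j)) u) * hermite e (s + 1) (v (n * p + i))))"
    using assms
    by (intro all_moments_cmult all_moments_mult all_moments_hermite all_moments_sum all_moments_const all_moments_null_law_coord[OF V]) auto
  then show ?thesis by (simp add: mehler_def)
qed

lemma all_moments_mehler_sum:
  assumes "s \<ge> 0"
  shows "all_moments (null_law n p (s + 1)) (mehler_sum n p s B u)"
proof -
  interpret prob_space "null_law n p (s + 1)" using assms by (intro prob_space_null_law) auto
  show ?thesis
    unfolding mehler_sum_def
    using all_moments_null_law_mehler[OF assms] by (intro all_moments_sum all_moments_prod) auto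
qed

text \<open>Two different extensional multi-indices differ at some i < n, and the factor of that
  observation vanishes. Only the diagonal terms remain, also when the signals u and v
  differ.\<close>

lemma integral_mehler_sum_mult:
  assumes u: "(\<Sum>j<p. (u j)\<^sup>2) = s" and v: "(\<Sum>j<p. (v j)\<^sup>2) = s"
    and B: "finite B" "B \<subseteq> extensional {..<n}"
  shows "(\<integral>x. mehler_sum n p s B u x * mehler_sum n p s B v x \<partial>null_law n p (s + 1)) =
    (\<Sum>b\<in>B. \<Prod>i<n. ((\<Sum>j<p. u j * v j) / (s + 1)) ^ b i)"
proof -
  have s: "s \<ge> 0" using u by (auto intro: sum_nonneg)
  then have V: "s + 1 > 0" by simp
  interpret prob_space "null_law n p (s + 1)" by (rule prob_space_null_law[OF V])
  define m where "m = (\<lambda>e u i x. mehler e s (lin p (\<lambda>j. x (i * p + j)) u) (x (n * p + i)))"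
  define F where "F = (\<lambda>b b' x. \<Prod>i<n. m (b i) u i x * m (b' i) v i x)"
  have am: "all_moments (null_law n p (s + 1)) (F b b')" for b b'
    unfolding F_def m_def
    by (intro all_moments_prod all_moments_mult all_moments_null_law_mehler s) auto
  have "(\<integral>x. mehler_sum n p s B u x * mehler_sum n p s B v x \<partial>null_law n p (s + 1)) =
      (\<integral>x. (\<Sum>b\<in>B. \<Sum>b'\<in>B. F b b' x) \<partial>null_law n p (s + 1))"
    unfolding mehler_sum_def sum_product F_def m_def by (simp add: prod.distrib)
  also have "\<dots> = (\<Sum>b\<in>B. \<integral>x. (\<Sum>b'\<in>B. F b b' x) \<partial>null_law n p (s + 1))"
    by (intro Bochner_Integration.integral_sum Bochner_Integration.integrable_sum all_moments_integrable am)
  also have "\<dots> = (\<Sum>b\<in>B. \<Sum>b'\<in>B. \<integral>x. F b b' x \<partial>null_law n p (s + 1))"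
    by (intro sum.cong refl Bochner_Integration.integral_sum all_moments_integrable am)
  also have "\<dots> = (\<Sum>b\<in>B. \<Sum>b'\<in>B. if b = b' then (\<Prod>i<n. ((\<Sum>j<p. u j * v j) / (s + 1)) ^ b i) else 0)"
  proof (intro sum.cong refl)
    fix b b' assume b: "b \<in> B" "b' \<in> B"
    have "F b b' \<in> borel_measurable (null_law n p (s + 1))" using am by (rule all_moments_measurable)
    then have "F b b' \<in> borel_measurable (Rn (n * p + n))"
      by (simp add: measurable_cong_sets[OF sets_null_law refl])
    then have "(\<integral>x. F b b' x \<partial>null_law n p (s + 1)) =
        (\<Prod>i<n. \<integral>z. mehler (b i) s (lin p (fst z) u) (snd z) * mehler (b' i) s (lin p (fst z) v) (snd z) \<partial>obs p (s + 1))"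
      using s by (intro integral_null_law_prod V)
        (auto simp: F_def m_def lin_encode intro!: prod.cong all_moments_integrable all_moments_mult all_moments_mehler)
    also have "\<dots> = (\<Prod>i<n. if b i = b' i then ((\<Sum>j<p. u j * v j) / (s + 1)) ^ b i else 0)"
      by (simp add: integral_mehler_mult[OF u v])
    also have "\<dots> = (if b = b' then (\<Prod>i<n. ((\<Sum>j<p. u j * v j) / (s + 1)) ^ b i) else 0)"
    proof (cases "b = b'")
      case False
      then obtain i where "i < n" "b i \<noteq> b' i"
        using b B(2) extensionalityI[of b "{..<n}" b'] by auto
      then show ?thesis using False by (auto intro!: prod_zero)
    qed simp
    finally show "(\<integral>x. F b b' x \<partial>null_law n p (s + 1)) = (if b = b' then (\<Prod>i<n. ((\<Sum>j<p. u j * v j) / (s + 1)) ^ b i) else 0)" .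
  qed
  also have "\<dots> = (\<Sum>b\<in>B. \<Prod>i<n. ((\<Sum>j<p. u j * v j) / (s + 1)) ^ b i)"
    using B(1) by (intro sum.cong refl) simp
  finally show ?thesis .
qed

lemma nn_integral_lr_given_square:
  assumes u: "(\<Sum>j<p. (u j)\<^sup>2) = s" "u \<in> space (Rn p)" and s: "s > 0"
  shows "(\<integral>\<^sup>+v. ennreal ((lr_given n p s u v)\<^sup>2) \<partial>null_law n p (s + 1)) \<le> ennreal ((s + 1) ^ n)"
proof -
  have V: "s + 1 > 0" using s by simp
  interpret product_sigma_finite "\<lambda>_. obs p (s + 1)" by (rule product_sigma_finite_obs[OF V])
  have [measurable]: "lr_given n p s u \<in> borel_measurable (Rn (n * p + n))"
    by (intro measurable_lr_given_data u refl)
  have "(\<integral>\<^sup>+v. ennreal ((lr_given n p s u v)\<^sup>2) \<partial>null_law n p (s + 1)) =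
      (\<integral>\<^sup>+\<zeta>. (\<Prod>i<n. ennreal ((sym_ratio (s + 1) (lin p (fst (\<zeta> i)) u) (snd (\<zeta> i)))\<^sup>2)) \<partial>sample n p (s + 1))"
    unfolding null_law_def by (subst nn_integral_distr) (auto simp: lr_given_encode prod_power_distrib prod_ennreal)
  also have "\<dots> = (\<Prod>i<n. \<integral>\<^sup>+z. ennreal ((sym_ratio (s + 1) (lin p (fst z) u) (snd z))\<^sup>2) \<partial>obs p (s + 1))"
    unfolding sample_def by (rule product_nn_integral_prod) auto
  also have "\<dots> \<le> (\<Prod>i<n. ennreal (s + 1))"
    using square_integrable_sym_ratio(1)[OF u(1) s] by (induction n) (auto intro!: mult_mono)
  finally show ?thesis using V by (simp add: ennreal_power)
qed

lemma prod_data_index: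
  fixes f :: "nat \<Rightarrow> real"
  shows "(\<Prod>t<n * p + n. f t) = (\<Prod>i<n. (\<Prod>j<p. f (i * p + j)) * f (n * p + i))"
proof -
  have "(\<Prod>t<n * p + n. f t) = (\<Prod>t<n * p. f t) * (\<Prod>t=n * p..<n * p + n. f t)"
    using prod.atLeastLessThan_concat[of 0 "n * p" "n * p + n" f] by (simp add: lessThan_atLeast0)
  also have "(\<Prod>t<n * p. f t) = (\<Prod>i<n. \<Prod>t=i * p..<i * p + p. f t)"
    by (rule prod.nat_group[symmetric])
  also have "\<dots> = (\<Prod>i<n. \<Prod>j<p. f (i * p + j))"
    using prod.shift_bounds_nat_ivl[of f 0 "_ * p" p] by (simp add: add.commute lessThan_atLeast0)
  also have "(\<Prod>t=n * p..<n * p + n. f t) = (\<Prod>i<n. f (n * p + i))"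
    using prod.shift_bounds_nat_ivl[of f 0 "n * p" n] by (simp add: add.commute lessThan_atLeast0)
  finally show ?thesis by (simp add: prod.distrib)
qed

abbreviation monomial :: "nat \<Rightarrow> (nat \<Rightarrow> nat) \<Rightarrow> (nat \<Rightarrow> real) \<Rightarrow> real" where
  "monomial N a v \<equiv> \<Prod>t<N. v t ^ a t"

lemma all_moments_monomial:
  assumes V: "V > 0"
  shows "all_moments (null_law n p V) (monomial (n * p + n) a)"
proof -
  interpret prob_space "null_law n p V" by (rule prob_space_null_law[OF V])
  show ?thesis by (intro all_moments_prod all_moments_power all_moments_null_law_coord V) auto
qed

text \<open>Monomial and likelihood ratio both factor over the observations, so the
  single-observation expansion applies to each factor. The products of its terms are indexed by
  multi-indices below the exponents of the responses, whose sum is at most D.\<close>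

lemma integral_monomial_lr_given:
  assumes u: "(\<Sum>j<p. (u j)\<^sup>2) = s" "u \<in> space (Rn p)" and s: "s > 0"
    and a: "(\<Sum>t<n * p + n. a t) \<le> D"
  shows "(\<integral>v. monomial (n * p + n) a v * lr_given n p s u v \<partial>null_law n p (s + 1)) =
    (\<integral>v. monomial (n * p + n) a v * mehler_sum n p s (even_degrees n D) u v \<partial>null_law n p (s + 1))"
proof -
  have V: "s + 1 > 0" and s0: "s \<ge> 0" using s by simp_all
  interpret Q: prob_space "null_law n p (s + 1)" by (rule prob_space_null_law[OF V])
  interpret O: prob_space "obs p (s + 1)" by (rule prob_space_obs[OF V])
  interpret G: prob_space "gauss {..<p}" by (rule prob_space_gauss)
  let ?N = "n * p + n"
  \<comment> \<open>\<open>d i\<close> is the exponent of the i-th response in the monomial, and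
    \<open>\<phi> i\<close> collects the covariates of that observation.\<close>
  define d where "d = (\<lambda>i. a (n * p + i))"
  define \<phi> where "\<phi> = (\<lambda>i (x :: nat \<Rightarrow> real). \<Prod>j<p. x j ^ a (i * p + j))"
  define R where "R = (\<lambda>i e. \<integral>z. \<phi> i (fst z) * snd z ^ d i * mehler e s (lin p (fst z) u) (snd z) \<partial>obs p (s + 1))"
  have am_\<phi>: "all_moments (gauss {..<p}) (\<phi> i)" for i
    unfolding \<phi>_def by (intro G.all_moments_prod G.all_moments_power all_moments_gauss_coord) auto
  have am_\<phi>d: "all_moments (obs p (s + 1)) (\<lambda>z. \<phi> i (fst z) * snd z ^ d i)" for i
    by (intro all_moments_mult O.all_moments_power all_moments_obs_fst V am_\<phi> all_moments_obs_snd[where f = "\<lambda>x. x"] all_moments_normal0)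
  have mono_enc: "monomial ?N a (encode n p \<zeta>) = (\<Prod>i<n. \<phi> i (fst (\<zeta> i)) * snd (\<zeta> i) ^ d i)" for \<zeta>
    unfolding prod_data_index \<phi>_def d_def by (intro prod.cong arg_cong2[where f = "(*)"]) auto
  have m_mono: "monomial ?N a \<in> borel_measurable (Rn ?N)"
    by (intro borel_measurable_prod borel_measurable_power measurable_component_singleton)
  have m_lr: "lr_given n p s u \<in> borel_measurable (Rn ?N)"
    by (intro measurable_lr_given_data u refl)
  have "(\<integral>v. monomial ?N a v * lr_given n p s u v \<partial>null_law n p (s + 1)) =
      (\<Prod>i<n. \<integral>z. \<phi> i (fst z) * snd z ^ d i * sym_ratio (s + 1) (lin p (fst z) u) (snd z) \<partial>obs p (s + 1))"
  proof (rule integral_null_law_prod[OF V])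
    show "(\<lambda>v. monomial ?N a v * lr_given n p s u v) \<in> borel_measurable (Rn ?N)"
      using m_mono m_lr by (rule borel_measurable_times)
    show "monomial ?N a (encode n p \<zeta>) * lr_given n p s u (encode n p \<zeta>) =
        (\<Prod>i<n. \<phi> i (fst (\<zeta> i)) * snd (\<zeta> i) ^ d i * sym_ratio (s + 1) (lin p (fst (\<zeta> i)) u) (snd (\<zeta> i)))" for \<zeta>
      unfolding mono_enc lr_given_encode by (rule prod.distrib[symmetric])
    show "integrable (obs p (s + 1)) (\<lambda>z. \<phi> i (fst z) * snd z ^ d i * sym_ratio (s + 1) (lin p (fst z) u) (snd z))" for i
      by (intro square_integrable_mult all_moments_square_integrable am_\<phi>d square_integrable_sym_ratio u s)
  qed
  also have "\<dots> = (\<Prod>i<n. \<Sum>e\<in>{e. e \<le> d i \<and> even e}. R i e)"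
    unfolding R_def by (intro prod.cong refl integral_sym_ratio_eq_mehler(1) u s am_\<phi>)
  also have "\<dots> = (\<Sum>b\<in>Pi\<^sub>E {..<n} (\<lambda>i. {e. e \<le> d i \<and> even e}). \<Prod>i<n. R i (b i))"
    by (intro prod_sum_PiE) auto
  \<comment> \<open>The index set is enlarged to one that no longer depends on the monomial. The
    added terms vanish, having a Mehler degree above the exponent of some response.\<close>
  also have "\<dots> = (\<Sum>b\<in>even_degrees n D. \<Prod>i<n. R i (b i))"
  proof (intro sum.mono_neutral_left finite_even_degrees ballI)
    have d_sum: "(\<Sum>i<n. d i) \<le> D"
    proof -
      have "(\<Sum>i<n. d i) = (\<Sum>t\<in>(\<lambda>i. n * p + i) ` {..<n}. a t)"
        unfolding d_def by (subst sum.reindex) auto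
      also have "\<dots> \<le> (\<Sum>t<?N. a t)" by (intro sum_mono2) auto
      finally show ?thesis using a by simp
    qed
    show "Pi\<^sub>E {..<n} (\<lambda>i. {e. e \<le> d i \<and> even e}) \<subseteq> even_degrees n D"
    proof
      fix b assume b: "b \<in> Pi\<^sub>E {..<n} (\<lambda>i. {e. e \<le> d i \<and> even e})"
      then have le: "b i \<le> d i" "even (b i)" if "i < n" for i using that by (auto simp: PiE_iff)
      then have "(\<Sum>i<n. b i) \<le> D" using d_sum by (intro order_trans[OF sum_mono d_sum]) auto
      moreover have "b i \<le> D" if "i < n" for i
        using member_le_sum[of i "{..<n}" b] that calculation by simp
      ultimately show "b \<in> even_degrees n D"
        using b le by (auto simp: even_degrees_def PiE_iff)
    qed
    fix b assume "b \<in> even_degrees n D - Pi\<^sub>E {..<n} (\<lambda>i. {e. e \<le> d i \<and> even e})"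
    then obtain i where "i < n" "d i < b i" by (auto simp: even_degrees_def PiE_iff not_le)
    then show "(\<Prod>i<n. R i (b i)) = 0"
      unfolding R_def by (intro prod_zero bexI[of _ i]) (auto intro: integral_sym_ratio_eq_mehler(2) u s am_\<phi>)
  qed
  also have "\<dots> = (\<integral>v. (\<Sum>b\<in>even_degrees n D. monomial ?N a v * (\<Prod>i<n. mehler (b i) s (lin p (\<lambda>j. v (i * p + j)) u) (v (n * p + i)))) \<partial>null_law n p (s + 1))"
  proof -
    have am: "all_moments (null_law n p (s + 1)) (\<lambda>v. monomial ?N a v * (\<Prod>i<n. mehler (b i) s (lin p (\<lambda>j. v (i * p + j)) u) (v (n * p + i))))" for b
      by (intro all_moments_mult all_moments_monomial V Q.all_moments_prod all_moments_null_law_mehler s0) auto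
    have "(\<integral>v. monomial ?N a v * (\<Prod>i<n. mehler (b i) s (lin p (\<lambda>j. v (i * p + j)) u) (v (n * p + i))) \<partial>null_law n p (s + 1)) = (\<Prod>i<n. R i (b i))" for b
      unfolding R_def
    proof (rule integral_null_law_prod[OF V])
      show "(\<lambda>v. monomial ?N a v * (\<Prod>i<n. mehler (b i) s (lin p (\<lambda>j. v (i * p + j)) u) (v (n * p + i)))) \<in> borel_measurable (Rn ?N)"
        using all_moments_measurable[OF am[of b]] by (simp add: measurable_cong_sets[OF sets_null_law refl])
      show "monomial ?N a (encode n p \<zeta>) * (\<Prod>i<n. mehler (b i) s (lin p (\<lambda>j. encode n p \<zeta> (i * p + j)) u) (encode n p \<zeta> (n * p + i))) =
        (\<Prod>i<n. \<phi> i (fst (\<zeta> i)) * snd (\<zeta> i) ^ d i * mehler (b i) s (lin p (fst (\<zeta> i)) u) (snd (\<zeta> i)))" for \<zeta>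
        unfolding mono_enc prod.distrib by (intro arg_cong2[where f = "(*)"] prod.cong refl) (auto simp: lin_encode)
      show "integrable (obs p (s + 1)) (\<lambda>z. \<phi> i (fst z) * snd z ^ d i * mehler (b i) s (lin p (fst z) u) (snd z))" for i
        by (intro all_moments_integrable all_moments_mult am_\<phi>d all_moments_mehler s0)
    qed
    then show ?thesis
      by (subst Bochner_Integration.integral_sum) (auto intro!: all_moments_integrable am)
  qed
  also have "\<dots> = (\<integral>v. monomial ?N a v * mehler_sum n p s (even_degrees n D) u v \<partial>null_law n p (s + 1))"
    by (simp only: mehler_sum_def sum_distrib_left)
  finally show ?thesis .
qed

lemma all_moments_polys:
  assumes V: "V > 0" and "f \<in> polys (n * p + n) D"
  shows "all_moments (null_law n p V) f"
proof -
  interpret prob_space "null_law n p V" by (rule prob_space_null_law[OF V])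
  show ?thesis
    using assms(2) by (auto simp: polys_def intro!: all_moments_sum all_moments_cmult all_moments_monomial V)
qed

lemma integral_polys_lr_given:
  assumes u: "(\<Sum>j<p. (u j)\<^sup>2) = s" "u \<in> space (Rn p)" and s: "s > 0"
    and f: "f \<in> polys (n * p + n) D"
  shows "(\<integral>v. f v * lr_given n p s u v \<partial>null_law n p (s + 1)) =
    (\<integral>v. f v * mehler_sum n p s (even_degrees n D) u v \<partial>null_law n p (s + 1))"
proof -
  let ?N = "n * p + n" and ?Q = "null_law n p (s + 1)"
  have V: "s + 1 > 0" and s0: "s \<ge> 0" using s by simp_all
  obtain S c where S: "finite S" "\<And>a. a \<in> S \<Longrightarrow> (\<Sum>i<?N. a i) \<le> D" and f: "f = (\<lambda>x. \<Sum>a\<in>S. c a * monomial ?N a x)"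
    using f by (auto simp: polys_def)
  have sq: "square_integrable ?Q (lr_given n p s u)"
  proof -
    have [measurable]: "lr_given n p s u \<in> borel_measurable ?Q" by (intro measurable_lr_given_data u sets_null_law)
    have "integrable ?Q (\<lambda>v. (lr_given n p s u v)\<^sup>2)"
      using nn_integral_lr_given_square[OF u s, of n] by (intro integrableI_bounded) (auto intro: le_less_trans)
    then show ?thesis by (simp add: square_integrable_def)
  qed
  have lin: "(\<integral>v. f v * h v \<partial>?Q) = (\<Sum>a\<in>S. c a * (\<integral>v. monomial ?N a v * h v \<partial>?Q))" if "square_integrable ?Q h" for h
  proof -
    have "(\<integral>v. f v * h v \<partial>?Q) = (\<integral>v. (\<Sum>a\<in>S. c a * (monomial ?N a v * h v)) \<partial>?Q)"
      by (simp add: f sum_distrib_right mult.assoc)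
    also have "\<dots> = (\<Sum>a\<in>S. \<integral>v. c a * (monomial ?N a v * h v) \<partial>?Q)"
      by (intro Bochner_Integration.integral_sum integrable_mult_right
          square_integrable_mult[OF all_moments_square_integrable[OF all_moments_monomial[OF V]] that])
    finally show ?thesis by simp
  qed
  show ?thesis
    unfolding lin[OF sq] lin[OF all_moments_square_integrable[OF all_moments_mehler_sum[OF s0]]]
    by (intro sum.cong refl arg_cong2[where f = "(*)"] integral_monomial_lr_given u s S)
qed

section \<open>Bounding the low-degree chi-square divergence\<close>

text \<open>The inner product, under the null, of the truncated expansions belonging to the signals
  u and v of squared norm s.\<close>

definition signal_kernel :: "nat \<Rightarrow> nat \<Rightarrow> nat \<Rightarrow> real \<Rightarrow> (nat \<Rightarrow> real) \<Rightarrow> (nat \<Rightarrow> real) \<Rightarrow> real" where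
  "signal_kernel n p D s u v = (\<Sum>b\<in>even_degrees n D. \<Prod>i<n. ((\<Sum>j<p. u j * v j) / (s + 1)) ^ b i)"

text \<open>Shows that the choice in the definition is not vacuous: the polynomials of bounded
  degree are spanned by finitely many monomials, to which \<open>L2_projection_exists\<close>
  applies.\<close>

lemma low_degree_projection:
  assumes "\<And>a. square_integrable Q (monomial N a)" "square_integrable Q L"
  shows "low_degree_projection N D Q L \<in> polys N D"
    and "g \<in> polys N D \<Longrightarrow> (\<integral>x. (L x - low_degree_projection N D Q L x) * g x \<partial>Q) = 0"
proof -
  \<comment> \<open>Exponent functions may be arbitrary beyond N without changing the monomial;
    extensional representatives leave a finite set.\<close>
  define A where "A = {a \<in> {..<N} \<rightarrow>\<^sub>E {..D}. (\<Sum>i<N. a i) \<le> D}"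
  have finA: "finite A" unfolding A_def by (rule finite_subset[OF _ finite_PiE[of "{..<N}" "\<lambda>_. {..D}"]]) auto
  obtain c where c: "\<And>a. a \<in> A \<Longrightarrow> (\<integral>x. (L x - (\<Sum>a\<in>A. c a * monomial N a x)) * monomial N a x \<partial>Q) = 0"
    using L2_projection_exists[where e = "monomial N", OF finA assms(1,2)] by blast
  define f where "f = (\<lambda>x. \<Sum>a\<in>A. c a * monomial N a x)"
  have sf: "square_integrable Q (\<lambda>x. L x - f x)"
    unfolding f_def by (intro square_integrable_minus square_integrable_sum square_integrable_cmult assms)
  have "f \<in> polys N D" unfolding polys_def f_def using finA by (auto simp: A_def)
  moreover have "(\<integral>x. (L x - f x) * g x \<partial>Q) = 0" if g: "g \<in> polys N D" for g
  proof -
    obtain S c' where S: "finite S" "\<And>a. a \<in> S \<Longrightarrow> (\<Sum>i<N. a i) \<le> D" and g: "g = (\<lambda>x. \<Sum>a\<in>S. c' a * monomial N a x)"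
      using g by (auto simp: polys_def)
    have z: "(\<integral>x. (L x - f x) * monomial N a x \<partial>Q) = 0" if "a \<in> S" for a
    proof -
      have "a i \<le> D" if "i < N" for i
        using member_le_sum[of i "{..<N}" a] S(2)[OF \<open>a \<in> S\<close>] that by simp
      then have A: "restrict a {..<N} \<in> A"
        using S(2)[OF \<open>a \<in> S\<close>] by (auto simp: A_def)
      have eq: "monomial N (restrict a {..<N}) x = monomial N a x" for x
        by (intro prod.cong) auto
      show ?thesis using c[OF A] unfolding eq f_def .
    qed
    have "(\<integral>x. (L x - f x) * g x \<partial>Q) = (\<integral>x. (\<Sum>a\<in>S. c' a * ((L x - f x) * monomial N a x)) \<partial>Q)"
      by (simp add: g sum_distrib_left mult.left_commute)
    also have "\<dots> = (\<Sum>a\<in>S. \<integral>x. c' a * ((L x - f x) * monomial N a x) \<partial>Q)"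
      by (intro Bochner_Integration.integral_sum integrable_mult_right square_integrable_mult sf assms)
    finally show ?thesis using z by simp
  qed
  ultimately have "\<exists>f. f \<in> polys N D \<and> (\<forall>g\<in>polys N D. (\<integral>x. (L x - f x) * g x \<partial>Q) = 0)" by blast
  from someI_ex[OF this]
  show "low_degree_projection N D Q L \<in> polys N D"
    and "g \<in> polys N D \<Longrightarrow> (\<integral>x. (L x - low_degree_projection N D Q L x) * g x \<partial>Q) = 0"
    by (auto simp: low_degree_projection_def)
qed

section \<open>Second-moment bound for a mixture over a random signal of fixed norm\<close>

context
  fixes n p D :: nat and s :: real and \<nu> :: "(nat \<Rightarrow> real) measure" and P Q :: "(nat \<Rightarrow> real) measure"
  assumes s: "s > 0"
    and \<nu>: "prob_space \<nu>" "sets \<nu> = sets (Rn p)"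
    and norm: "AE u in \<nu>. (\<Sum>j<p. (u j)\<^sup>2) = s"
    and Q: "Q = null_law n p (s + 1)"
    and P: "prob_space P" "P = density Q (\<lambda>v. \<integral>\<^sup>+u. ennreal (lr_given n p s u v) \<partial>\<nu>)"
begin

lemma prob_space_Q: "prob_space Q"
  unfolding Q using s by (intro prob_space_null_law) simp

lemma AE_norm: "AE u in \<nu>. (\<Sum>j<p. (u j)\<^sup>2) = s \<and> u \<in> space (Rn p)"
  using norm by (rule AE_mp) (auto simp: sets_eq_imp_space_eq[OF \<nu>(2)] intro!: AE_I2)

lemma square_integrable_lr: "square_integrable (Q \<Otimes>\<^sub>M \<nu>) (\<lambda>(v, u). lr_given n p s u v)"
proof (rule square_integrable_pairI[OF prob_space_Q \<nu>(1)])
  show "(\<lambda>(v, u). lr_given n p s u v) \<in> borel_measurable (Q \<Otimes>\<^sub>M \<nu>)"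
    by (rule measurable_lr_given) (simp_all add: Q sets_null_law \<nu>)
  show "AE u in \<nu>. (\<integral>\<^sup>+v. ennreal ((lr_given n p s u v)\<^sup>2) \<partial>Q) \<le> ennreal ((s + 1) ^ n)"
    using AE_norm unfolding Q by eventually_elim (intro nn_integral_lr_given_square s; simp)
qed

lemma square_integrable_mehler_mixture:
  "square_integrable (Q \<Otimes>\<^sub>M \<nu>) (\<lambda>(v, u). mehler_sum n p s (even_degrees n D) u v)"
proof (rule square_integrable_pairI[OF prob_space_Q \<nu>(1)])
  show "(\<lambda>(v, u). mehler_sum n p s (even_degrees n D) u v) \<in> borel_measurable (Q \<Otimes>\<^sub>M \<nu>)"
    by (rule measurable_mehler_sum) (simp_all add: Q sets_null_law \<nu>)
  show "AE u in \<nu>. (\<integral>\<^sup>+v. ennreal ((mehler_sum n p s (even_degrees n D) u v)\<^sup>2) \<partial>Q)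
     \<le> ennreal (\<Sum>b\<in>even_degrees n D. \<Prod>i<n. (s / (s + 1)) ^ b i)"
    using AE_norm
  proof eventually_elim
    case (elim u)
    have "square_integrable Q (mehler_sum n p s (even_degrees n D) u)"
      unfolding Q using s by (intro all_moments_square_integrable all_moments_mehler_sum) simp
    then have "(\<integral>\<^sup>+v. ennreal ((mehler_sum n p s (even_degrees n D) u v)\<^sup>2) \<partial>Q) =
        ennreal (\<integral>v. (mehler_sum n p s (even_degrees n D) u v)\<^sup>2 \<partial>Q)"
      by (intro nn_integral_eq_integral) (auto simp: square_integrable_def)
    \<comment> \<open>The diagonal case of the orthogonality relation, where the inner product is s;
      the value is the same for almost all signals.\<close>
    also have "(\<integral>v. (mehler_sum n p s (even_degrees n D) u v)\<^sup>2 \<partial>Q) = (\<Sum>b\<in>even_degrees n D. \<Prod>i<n. (s / (s + 1)) ^ b i)"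
      using integral_mehler_sum_mult[of u p s u "even_degrees n D" n] elim finite_even_degrees[of n D]
      by (auto simp: Q power2_eq_square even_degrees_def PiE_def)
    finally show ?case by simp
  qed
qed

text \<open>Uniqueness of the Radon-Nikodym derivative. By Fubini almost every fibre is integrable,
  so the extended integral may be read as a real one.\<close>

lemma likelihood_ratio_eq: "AE v in Q. likelihood_ratio P Q v = (\<integral>u. lr_given n p s u v \<partial>\<nu>)"
proof -
  interpret Q: prob_space Q by (rule prob_space_Q)
  interpret \<nu>: prob_space \<nu> by (rule \<nu>)
  interpret pair_sigma_finite Q \<nu> ..
  interpret pair_prob_space Q \<nu> ..
  have m[measurable]: "(\<lambda>(v, u). lr_given n p s u v) \<in> borel_measurable (Q \<Otimes>\<^sub>M \<nu>)"
    using square_integrable_lr by (simp add: square_integrable_def)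
  have "(\<lambda>v. \<integral>\<^sup>+u. ennreal (lr_given n p s u v) \<partial>\<nu>) \<in> borel_measurable Q" by measurable
  from Q.RN_deriv_unique[OF this P(2)[symmetric]]
  have 1: "AE v in Q. (\<integral>\<^sup>+u. ennreal (lr_given n p s u v) \<partial>\<nu>) = RN_deriv Q P v" .
  have "integrable (Q \<Otimes>\<^sub>M \<nu>) (\<lambda>(v, u). lr_given n p s u v)"
    by (rule square_integrable_imp_integrable[OF square_integrable_lr])
  from AE_integrable_fst[OF this] 1 show ?thesis
  proof eventually_elim
    case (elim v)
    have nn: "lr_given n p s u v \<ge> 0" for u
      unfolding lr_given_def by (intro prod_nonneg ballI sym_ratio_nonneg)
    have "RN_deriv Q P v = ennreal (\<integral>u. lr_given n p s u v \<partial>\<nu>)"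
      unfolding elim(2)[symmetric] using elim(1) nn by (intro nn_integral_eq_integral) auto
    then show ?case
      using nn by (simp add: likelihood_ratio_def)
  qed
qed

lemma square_integrable_likelihood_ratio: "square_integrable Q (likelihood_ratio P Q)"
proof -
  let ?L = "\<lambda>v. \<integral>u. lr_given n p s u v \<partial>\<nu>"
  have L: "square_integrable Q ?L"
    by (rule square_integrable_mixture[OF prob_space_Q \<nu>(1) square_integrable_lr])
  have [measurable]: "likelihood_ratio P Q \<in> borel_measurable Q"
    unfolding likelihood_ratio_def by measurable
  have [measurable]: "?L \<in> borel_measurable Q" using L by (simp add: square_integrable_def)
  have "integrable Q (\<lambda>v. (likelihood_ratio P Q v)\<^sup>2) \<longleftrightarrow> integrable Q (\<lambda>v. (?L v)\<^sup>2)"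
    by (intro integrable_cong_AE) (use likelihood_ratio_eq in auto)
  then show ?thesis using L by (simp add: square_integrable_def)
qed

lemma testing_pair_mixture: "testing_pair (n * p + n) P Q"
  unfolding testing_pair_def
proof (intro conjI allI ballI)
  show "prob_space P" "prob_space Q" by (rule P(1) prob_space_Q)+
  show "sets Q = sets (Rn (n * p + n))" by (simp add: Q sets_null_law)
  then show "sets P = sets (Rn (n * p + n))" by (simp add: P(2))
  interpret Q: prob_space Q by (rule prob_space_Q)
  interpret \<nu>: prob_space \<nu> by (rule \<nu>)
  have [measurable]: "(\<lambda>(v, u). lr_given n p s u v) \<in> borel_measurable (Q \<Otimes>\<^sub>M \<nu>)"
    using square_integrable_lr by (simp add: square_integrable_def)
  show "absolutely_continuous Q P"
    unfolding P(2) by (rule absolutely_continuousI_density) measurable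
  show "integrable Q (\<lambda>x. (likelihood_ratio P Q x)\<^sup>2)"
    using square_integrable_likelihood_ratio by (simp add: square_integrable_def)
  fix d f assume "f \<in> polys (n * p + n) d"
  then show "integrable Q (\<lambda>x. (f x)\<^sup>2)"
    using all_moments_polys[of "s + 1" f n p d] s
    by (auto simp: Q dest: all_moments_square_integrable square_integrableD)
qed

text \<open>The projection f satisfies |f|^2 = <f, L> = <f, G>, where G is the mixture of the
  truncated expansions, whence |f| <= |G|. G itself may have degree up to 2 D in covariates and
  responses together, so this is an inequality.\<close>

lemma chi2_low_degree_le:
  "chi2_low_degree (n * p + n) D P Q \<le> (\<integral>u. \<integral>v. signal_kernel n p D s u v \<partial>\<nu> \<partial>\<nu>) - 1"
proof -
  interpret Q: prob_space Q by (rule prob_space_Q)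
  let ?N = "n * p + n" and ?L = "likelihood_ratio P Q"
  define M where "M = (\<lambda>u v. mehler_sum n p s (even_degrees n D) u v)"
  define G where "G = (\<lambda>v. \<integral>u. M u v \<partial>\<nu>)"
  define f where "f = low_degree_projection ?N D Q ?L"
  have V: "s + 1 > 0" using s by simp
  have sqM: "square_integrable (Q \<Otimes>\<^sub>M \<nu>) (\<lambda>(v, u). M u v)"
    unfolding M_def by (rule square_integrable_mehler_mixture)
  have sqG: "square_integrable Q G"
    unfolding G_def by (rule square_integrable_mixture[OF prob_space_Q \<nu>(1) sqM])
  have sq_mono: "square_integrable Q (monomial ?N a)" for a
    unfolding Q by (intro all_moments_square_integrable all_moments_monomial V)
  have sqL: "square_integrable Q ?L" by (rule square_integrable_likelihood_ratio)
  have f: "f \<in> polys ?N D"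
    unfolding f_def by (rule low_degree_projection(1)[OF sq_mono sqL])
  have sqf: "square_integrable Q f"
    unfolding Q by (rule all_moments_square_integrable[OF all_moments_polys[OF V f]])
  have "(\<integral>x. (?L x - f x) * f x \<partial>Q) = 0"
    unfolding f_def by (rule low_degree_projection(2)[OF sq_mono sqL f[unfolded f_def]])
  moreover have "(\<integral>x. (?L x - f x) * f x \<partial>Q) = (\<integral>x. f x * ?L x \<partial>Q) - (\<integral>x. (f x)\<^sup>2 \<partial>Q)"
    using square_integrable_mult[OF sqf sqL] sqf
    by (subst Bochner_Integration.integral_diff[symmetric])
       (auto simp: square_integrable_def algebra_simps power2_eq_square)
  ultimately have "(\<integral>x. (f x)\<^sup>2 \<partial>Q) = (\<integral>x. f x * ?L x \<partial>Q)" by simp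
  also have "\<dots> = (\<integral>x. f x * (\<integral>u. lr_given n p s u x \<partial>\<nu>) \<partial>Q)"
  proof (rule integral_cong_AE)
    have "square_integrable Q (\<lambda>x. \<integral>u. lr_given n p s u x \<partial>\<nu>)"
      by (rule square_integrable_mixture[OF prob_space_Q \<nu>(1) square_integrable_lr])
    then show "(\<lambda>x. f x * (\<integral>u. lr_given n p s u x \<partial>\<nu>)) \<in> borel_measurable Q"
      using sqf by (auto simp: square_integrable_def)
    show "(\<lambda>x. f x * ?L x) \<in> borel_measurable Q"
      using sqf sqL by (auto simp: square_integrable_def)
    show "AE x in Q. f x * ?L x = f x * (\<integral>u. lr_given n p s u x \<partial>\<nu>)"
      using likelihood_ratio_eq by eventually_elim simp
  qed
  also have "\<dots> = (\<integral>u. (\<integral>x. f x * lr_given n p s u x \<partial>Q) \<partial>\<nu>)"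
    by (rule integral_mult_mixture(2)[OF prob_space_Q \<nu>(1) sqf square_integrable_lr])
  also have "\<dots> = (\<integral>u. (\<integral>x. f x * M u x \<partial>Q) \<partial>\<nu>)"
  proof (rule integral_cong_AE)
    show "(\<lambda>u. \<integral>x. f x * lr_given n p s u x \<partial>Q) \<in> borel_measurable \<nu>"
      using integral_mult_mixture(1)[OF prob_space_Q \<nu>(1) sqf square_integrable_lr] by simp
    show "(\<lambda>u. \<integral>x. f x * M u x \<partial>Q) \<in> borel_measurable \<nu>"
      using integral_mult_mixture(1)[OF prob_space_Q \<nu>(1) sqf sqM] by simp
    show "AE u in \<nu>. (\<integral>x. f x * lr_given n p s u x \<partial>Q) = (\<integral>x. f x * M u x \<partial>Q)"
      using AE_norm unfolding M_def Q by eventually_elim (intro integral_polys_lr_given s f; simp)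
  qed
  also have "\<dots> = (\<integral>x. f x * G x \<partial>Q)"
    unfolding G_def by (rule integral_mult_mixture(2)[OF prob_space_Q \<nu>(1) sqf sqM, symmetric])
  finally have eq: "(\<integral>x. (f x)\<^sup>2 \<partial>Q) = (\<integral>x. f x * G x \<partial>Q)" .
  \<comment> \<open>Cauchy-Schwarz for <f, G>, divided by |f|^2 when this is not 0.\<close>
  have le: "(\<integral>x. (f x)\<^sup>2 \<partial>Q) \<le> (\<integral>x. (G x)\<^sup>2 \<partial>Q)"
  proof (cases "(\<integral>x. (f x)\<^sup>2 \<partial>Q) = 0")
    case False
    then have "(\<integral>x. (f x)\<^sup>2 \<partial>Q) > 0" by (simp add: order_less_le)
    moreover have "(\<integral>x. (f x)\<^sup>2 \<partial>Q) * (\<integral>x. (f x)\<^sup>2 \<partial>Q) \<le> (\<integral>x. (f x)\<^sup>2 \<partial>Q) * (\<integral>x. (G x)\<^sup>2 \<partial>Q)"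
      using Cauchy_Schwarz_integral[OF sqf sqG] eq by (simp add: power2_eq_square)
    ultimately show ?thesis by simp
  qed simp
  \<comment> \<open>The two factors are unfolded as mixtures one after the other, which leaves inner
    products for two independent signals.\<close>
  have "(\<integral>x. (G x)\<^sup>2 \<partial>Q) = (\<integral>x. G x * (\<integral>u. M u x \<partial>\<nu>) \<partial>Q)"
    by (simp add: G_def power2_eq_square)
  also have "\<dots> = (\<integral>u. (\<integral>x. G x * M u x \<partial>Q) \<partial>\<nu>)"
    by (rule integral_mult_mixture(2)[OF prob_space_Q \<nu>(1) sqG sqM])
  also have "\<dots> = (\<integral>u. \<integral>v. signal_kernel n p D s u v \<partial>\<nu> \<partial>\<nu>)"
  proof (rule integral_cong_AE)
    interpret \<nu>: prob_space \<nu> by (rule \<nu>)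
    have c: "(\<lambda>u. u j) \<in> borel_measurable \<nu>" if "j < p" for j
      unfolding measurable_cong_sets[OF \<nu>(2) refl] using that by (intro measurable_component_singleton) auto
    have [measurable]: "(\<lambda>(u, v). signal_kernel n p D s u v) \<in> borel_measurable (\<nu> \<Otimes>\<^sub>M \<nu>)"
      unfolding signal_kernel_def case_prod_unfold
      by (intro borel_measurable_sum borel_measurable_prod borel_measurable_power borel_measurable_divide borel_measurable_times
            measurable_compose[OF measurable_fst c] measurable_compose[OF measurable_snd c] borel_measurable_const) auto
    show "(\<lambda>u. \<integral>v. signal_kernel n p D s u v \<partial>\<nu>) \<in> borel_measurable \<nu>" by measurable
    show "(\<lambda>u. \<integral>x. G x * M u x \<partial>Q) \<in> borel_measurable \<nu>"
      using integral_mult_mixture(1)[OF prob_space_Q \<nu>(1) sqG sqM] by simp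
    show "AE u in \<nu>. (\<integral>x. G x * M u x \<partial>Q) = (\<integral>v. signal_kernel n p D s u v \<partial>\<nu>)"
      using AE_norm AE_space
    proof eventually_elim
      case u: (elim u)
      have sqMu: "square_integrable Q (M u)"
        unfolding Q M_def using s by (intro all_moments_square_integrable all_moments_mehler_sum) simp
      have "(\<integral>x. G x * M u x \<partial>Q) = (\<integral>x. M u x * (\<integral>v. M v x \<partial>\<nu>) \<partial>Q)"
        by (simp add: G_def mult.commute)
      also have "\<dots> = (\<integral>v. (\<integral>x. M u x * M v x \<partial>Q) \<partial>\<nu>)"
        by (rule integral_mult_mixture(2)[OF prob_space_Q \<nu>(1) sqMu sqM])
      also have "\<dots> = (\<integral>v. signal_kernel n p D s u v \<partial>\<nu>)"
      proof (rule integral_cong_AE)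
        show "(\<lambda>v. \<integral>x. M u x * M v x \<partial>Q) \<in> borel_measurable \<nu>"
          using integral_mult_mixture(1)[OF prob_space_Q \<nu>(1) sqMu sqM] by simp
        show "signal_kernel n p D s u \<in> borel_measurable \<nu>"
          using u by measurable
        show "AE v in \<nu>. (\<integral>x. M u x * M v x \<partial>Q) = signal_kernel n p D s u v"
          using AE_norm
        proof eventually_elim
          case (elim v)
          show ?case
            unfolding M_def Q signal_kernel_def using u elim
            by (intro integral_mehler_sum_mult finite_even_degrees) (auto simp: even_degrees_def PiE_def)
        qed
      qed
      finally show ?case .
    qed
  qed
  finally show ?thesis using le by (simp add: chi2_low_degree_def f_def)
qed

end

section \<open>The likelihood ratio of the mixture\<close>

lemma measure_eqI_Rn:
  assumes "prob_space P" "sets P = sets (Rn N)" "sets Q = sets (Rn N)"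
    and "\<And>A. (\<And>t. t < N \<Longrightarrow> A t \<in> sets borel) \<Longrightarrow> emeasure P (Pi\<^sub>E {..<N} A) = emeasure Q (Pi\<^sub>E {..<N} A)"
  shows "P = Q"
proof (rule measure_eqI_PiM_finite[where A = "\<lambda>_. Pi\<^sub>E {..<N} (\<lambda>_. UNIV)"])
  interpret prob_space P by fact
  show "emeasure P (Pi\<^sub>E {..<N} (\<lambda>_. UNIV)) \<noteq> \<infinity>" by simp
  show "range (\<lambda>_. Pi\<^sub>E {..<N} (\<lambda>_. UNIV)) \<subseteq> prod_algebra {..<N} (\<lambda>_. borel :: real measure)"
    by (auto intro!: prod_algebraI_finite)
qed (use assms in \<open>auto simp: space_PiM\<close>)

lemma data_vector_row [simp]: "i < n \<Longrightarrow> j < p \<Longrightarrow> data_vector n p X y (i * p + j) = X (i, j)"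
  using row_index_less[of i n j p] by (simp add: data_vector_def data_dim_def)

lemma data_vector_response [simp]: "i < n \<Longrightarrow> data_vector n p X y (n * p + i) = y i"
  by (simp add: data_vector_def data_dim_def)

lemma data_vector_restrict: "data_vector n p X (restrict y {..<n}) = data_vector n p X y"
  unfolding data_vector_def by (intro restrict_ext) (auto simp: data_dim_def)

lemma all_data_index: "(\<forall>t<n * p + n. R t) \<longleftrightarrow> (\<forall>i<n. (\<forall>j<p. R (i * p + j)) \<and> R (n * (p::nat) + i))"
proof safe
  fix i j assume "\<forall>t<n * p + n. R t" "i < n" "j < p"
  then show "R (i * p + j)" using row_index_less[of i n j p] by auto
next
  fix t assume *: "\<forall>i<n. (\<forall>j<p. R (i * p + j)) \<and> R (n * p + i)" and t: "t < n * p + n"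
  show "R t"
  proof (cases "t < n * p")
    case True
    then have "p > 0" by (cases p) auto
    then have "t div p < n" "t mod p < p" using True by (auto simp: less_mult_imp_div_less)
    then have "R (t div p * p + t mod p)" using * by blast
    then show ?thesis by simp
  next
    case False
    then have "t - n * p < n" "t = n * p + (t - n * p)" using t by auto
    then show ?thesis using * by metis
  qed
qed auto

lemma measurable_data_vector:
  assumes X: "\<And>i j. i < n \<Longrightarrow> j < p \<Longrightarrow> (\<lambda>z. X z (i, j)) \<in> borel_measurable M"
    and y: "\<And>i. i < n \<Longrightarrow> (\<lambda>z. y z i) \<in> borel_measurable M"
  shows "(\<lambda>z. data_vector n p (X z) (y z)) \<in> measurable M (Rn (n * p + n))"
  unfolding data_vector_def data_dim_def
proof (rule measurable_restrict)
  fix t assume t: "t \<in> {..<n * p + n}"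
  show "(\<lambda>z. if t < n * p then X z (t div p, t mod p) else y z (t - n * p)) \<in> borel_measurable M"
  proof (cases "t < n * p")
    case True
    then have "p > 0" by (cases p) auto
    then show ?thesis using True X[of "t div p" "t mod p"] by (auto simp: less_mult_imp_div_less)
  next
    case False
    then have "t - n * p < n" using t by auto
    then show ?thesis using False y by simp
  qed
qed

lemma data_vector_in_box:
  "data_vector n p X y \<in> Pi\<^sub>E {..<n * p + n} A \<longleftrightarrow> (\<forall>i<n. (\<forall>j<p. X (i, j) \<in> A (i * p + j)) \<and> y i \<in> A (n * p + i))"
proof -
  have "data_vector n p X y \<in> Pi\<^sub>E {..<n * p + n} A \<longleftrightarrow> (\<forall>t<n * p + n. data_vector n p X y t \<in> A t)"
    by (auto simp: PiE_iff data_vector_def data_dim_def extensional_def)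
  then show ?thesis by (simp add: all_data_index)
qed

lemma encode_eq_data_vector: "encode n p \<zeta> = data_vector n p (\<lambda>(i, j). fst (\<zeta> i) j) (\<lambda>i. snd (\<zeta> i))"
  unfolding encode_def data_vector_def data_dim_def by (intro restrict_ext) simp

lemma prob_space_design: "prob_space (design n p)"
  unfolding design_def by (rule prob_space_gauss)

lemma measurable_design_coord: "i < n \<Longrightarrow> j < p \<Longrightarrow> (\<lambda>X. X (i, j)) \<in> borel_measurable (design n p)"
  unfolding design_def using measurable_component_singleton[of "(i, j)" "{..<n} \<times> {..<p}" "\<lambda>_. std"] by simp

lemma emeasure_design_response_box:
  assumes \<kappa>: "prob_space \<kappa>" and h[measurable]: "h \<in> borel_measurable \<kappa>"
    and A: "\<And>t. t < n * p + n \<Longrightarrow> A t \<in> sets borel"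
  shows "emeasure (distr (design n p \<Otimes>\<^sub>M Pi\<^sub>M {..<n} (\<lambda>_. \<kappa>)) (Rn (n * p + n)) (\<lambda>(X, w). data_vector n p X (\<lambda>i. h (w i))))
      (Pi\<^sub>E {..<n * p + n} A) =
    (\<Prod>i<n. (\<Prod>j<p. emeasure std (A (i * p + j))) * emeasure (distr \<kappa> borel h) (A (n * p + i)))"
proof -
  let ?K = "Pi\<^sub>M {..<n} (\<lambda>_. \<kappa>)"
  interpret \<kappa>: prob_space \<kappa> by fact
  interpret K: prob_space ?K by (intro prob_space_PiM \<kappa>)
  interpret std: product_sigma_finite "\<lambda>_. std"
    by (intro product_sigma_finite_prob_space prob_space_std)
  interpret \<kappa>s: product_sigma_finite "\<lambda>_. \<kappa>"
    by (intro product_sigma_finite_prob_space \<kappa>)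
  have mdv: "(\<lambda>(X, w). data_vector n p X (\<lambda>i. h (w i))) \<in> measurable (design n p \<Otimes>\<^sub>M ?K) (Rn (n * p + n))"
    unfolding case_prod_unfold
  proof (rule measurable_data_vector)
    show "(\<lambda>z. fst z (i, j)) \<in> borel_measurable (design n p \<Otimes>\<^sub>M ?K)" if "i < n" "j < p" for i j
      using measurable_compose[OF measurable_fst measurable_design_coord[OF that]] .
    show "(\<lambda>z. h (snd z i)) \<in> borel_measurable (design n p \<Otimes>\<^sub>M ?K)" if "i < n" for i
      by (rule measurable_compose[OF _ h], rule measurable_compose[OF measurable_snd], rule measurable_component_singleton)
         (use that in simp)
  qed
  have row: "A (i * p + j) \<in> sets borel" if "i < n" "j < p" for i j
    using A row_index_less[OF that] by auto
  have resp: "A (n * p + i) \<in> sets borel" if "i < n" for i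
    using A that by auto
  define B where "B = Pi\<^sub>E ({..<n} \<times> {..<p}) (\<lambda>(i, j). A (i * p + j))"
  define C where "C = Pi\<^sub>E {..<n} (\<lambda>i. h -` A (n * p + i) \<inter> space \<kappa>)"
  have box: "Pi\<^sub>E {..<n * p + n} A \<in> sets (Rn (n * p + n))"
    using A by (intro sets_PiM_I_finite) auto
  have B: "B \<in> sets (design n p)"
    unfolding B_def design_def by (intro sets_PiM_I_finite) (use row in auto)
  have C: "C \<in> sets ?K"
    unfolding C_def by (intro sets_PiM_I_finite) (use resp measurable_sets[OF h] in auto)
  have "emeasure (distr (design n p \<Otimes>\<^sub>M ?K) (Rn (n * p + n)) (\<lambda>(X, w). data_vector n p X (\<lambda>i. h (w i)))) (Pi\<^sub>E {..<n * p + n} A)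
     = emeasure (design n p \<Otimes>\<^sub>M ?K) (B \<times> C)"
  proof -
    have "z \<in> (\<lambda>(X, w). data_vector n p X (\<lambda>i. h (w i))) -` Pi\<^sub>E {..<n * p + n} A \<inter> space (design n p \<Otimes>\<^sub>M ?K) \<longleftrightarrow> z \<in> B \<times> C" for z
    proof -
      have "X \<in> B \<longleftrightarrow> X \<in> extensional ({..<n} \<times> {..<p}) \<and> (\<forall>i<n. \<forall>j<p. X (i, j) \<in> A (i * p + j))" for X
        unfolding B_def PiE_iff by auto
      moreover have "w \<in> C \<longleftrightarrow> w \<in> space ?K \<and> (\<forall>i<n. h (w i) \<in> A (n * p + i))" for w
        unfolding C_def space_PiM PiE_iff by auto
      moreover have "X \<in> space (design n p) \<longleftrightarrow> X \<in> extensional ({..<n} \<times> {..<p})" for X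
        unfolding design_def space_PiM PiE_iff by auto
      ultimately show ?thesis
        by (cases z) (simp only: Int_iff vimage_eq split_conv data_vector_in_box space_pair_measure mem_Times_iff fst_conv snd_conv, blast)
    qed
    then have "(\<lambda>(X, w). data_vector n p X (\<lambda>i. h (w i))) -` Pi\<^sub>E {..<n * p + n} A \<inter> space (design n p \<Otimes>\<^sub>M ?K) = B \<times> C"
      by blast
    then show ?thesis
      by (subst emeasure_distr[OF mdv box]) (rule arg_cong[where f = "emeasure _"])
  qed
  also have "\<dots> = emeasure (design n p) B * emeasure ?K C"
    by (rule K.emeasure_pair_measure_Times[OF B C])
  also have "emeasure (design n p) B = (\<Prod>i<n. \<Prod>j<p. emeasure std (A (i * p + j)))"
    unfolding B_def design_def
    by (subst std.emeasure_PiM) (use row in \<open>auto simp: prod.cartesian_product intro!: prod.cong\<close>)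
  also have "emeasure ?K C = (\<Prod>i<n. emeasure (distr \<kappa> borel h) (A (n * p + i)))"
    unfolding C_def
    by (subst \<kappa>s.emeasure_PiM) (use resp measurable_sets[OF h] in \<open>auto simp: emeasure_distr intro!: prod.cong\<close>)
  finally show ?thesis by (simp add: prod.distrib)
qed

text \<open>All entries are independent, so the two laws agree on boxes. The response may be any
  function h of some noise, since \<open>mslr_null\<close> scales standard noise whereas the change
  of measure below works with \<open>normal0 V\<close> itself.\<close>

lemma distr_design_response:
  assumes V: "V > 0" and \<kappa>: "prob_space \<kappa>" and h: "h \<in> borel_measurable \<kappa>"
    and law: "distr \<kappa> borel h = distr (normal0 V) borel (\<lambda>x. x)"
  shows "distr (design n p \<Otimes>\<^sub>M Pi\<^sub>M {..<n} (\<lambda>_. \<kappa>)) (Rn (n * p + n)) (\<lambda>(X, w). data_vector n p X (\<lambda>i. h (w i))) = null_law n p V"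
proof (rule measure_eqI_Rn[symmetric])
  show "prob_space (null_law n p V)" by (rule prob_space_null_law[OF V])
  fix A :: "nat \<Rightarrow> real set" assume A: "\<And>t. t < n * p + n \<Longrightarrow> A t \<in> sets borel"
  interpret obs: product_sigma_finite "\<lambda>_. obs p V" by (rule product_sigma_finite_obs[OF V])
  interpret N: prob_space "normal0 V" by (rule prob_space_normal0[OF V])
  interpret std: product_sigma_finite "\<lambda>_. std"
    by (intro product_sigma_finite_prob_space prob_space_std)
  have row: "A (i * p + j) \<in> sets borel" if "i < n" "j < p" for i j
    using A row_index_less[OF that] by auto
  have resp: "A (n * p + i) \<in> sets borel" if "i < n" for i
    using A that by auto
  have box: "Pi\<^sub>E {..<n * p + n} A \<in> sets (Rn (n * p + n))"
    using A by (intro sets_PiM_I_finite) auto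
  define B where "B = (\<lambda>i. Pi\<^sub>E {..<p} (\<lambda>j. A (i * p + j)))"
  have B: "B i \<in> sets (gauss {..<p})" if "i < n" for i
    unfolding B_def by (intro sets_PiM_I_finite) (use row that in auto)
  have "encode n p -` Pi\<^sub>E {..<n * p + n} A \<inter> space (sample n p V) = Pi\<^sub>E {..<n} (\<lambda>i. B i \<times> A (n * p + i))"
    unfolding set_eq_iff B_def Int_iff vimage_eq encode_eq_data_vector data_vector_in_box
    by (auto simp: sample_def obs_def space_PiM space_pair_measure PiE_iff Pi_iff mem_Times_iff)
  then have "emeasure (null_law n p V) (Pi\<^sub>E {..<n * p + n} A) = emeasure (sample n p V) (Pi\<^sub>E {..<n} (\<lambda>i. B i \<times> A (n * p + i)))"
    unfolding null_law_def by (simp add: emeasure_distr[OF measurable_encode box])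
  also have "\<dots> = (\<Prod>i<n. emeasure (obs p V) (B i \<times> A (n * p + i)))"
    unfolding sample_def by (rule obs.emeasure_PiM) (use B resp in \<open>auto simp: obs_def\<close>)
  also have "\<dots> = (\<Prod>i<n. emeasure (gauss {..<p}) (B i) * emeasure (normal0 V) (A (n * p + i)))"
    unfolding obs_def using B resp by (intro prod.cong refl N.emeasure_pair_measure_Times) auto
  also have "\<dots> = (\<Prod>i<n. (\<Prod>j<p. emeasure std (A (i * p + j))) * emeasure (distr \<kappa> borel h) (A (n * p + i)))"
  proof (intro prod.cong refl arg_cong2[where f = "(*)"])
    fix i assume i: "i \<in> {..<n}"
    show "emeasure (gauss {..<p}) (B i) = (\<Prod>j<p. emeasure std (A (i * p + j)))"
      unfolding B_def by (rule std.emeasure_PiM) (use row i in auto)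
    show "emeasure (normal0 V) (A (n * p + i)) = emeasure (distr \<kappa> borel h) (A (n * p + i))"
      unfolding law using resp i by (subst emeasure_distr) auto
  qed
  finally show "emeasure (null_law n p V) (Pi\<^sub>E {..<n * p + n} A) =
      emeasure (distr (design n p \<Otimes>\<^sub>M Pi\<^sub>M {..<n} (\<lambda>_. \<kappa>)) (Rn (n * p + n)) (\<lambda>(X, w). data_vector n p X (\<lambda>i. h (w i)))) (Pi\<^sub>E {..<n * p + n} A)"
    using emeasure_design_response_box[OF \<kappa> h A] by simp
qed (simp_all add: sets_null_law)

lemma mslr_null_eq: "mslr_null n p b \<sigma> = null_law n p (snr b \<sigma> + 1)"
proof -
  have V: "snr b \<sigma> + 1 > 0" by (simp add: snr_def add_nonneg_pos)
  have "distr std borel (\<lambda>w. sqrt (snr b \<sigma> + 1) * w) = distr (normal0 (snr b \<sigma> + 1)) borel (\<lambda>x. x)"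
    unfolding distr_std_scale[OF V, symmetric] by (subst distr_distr) (auto simp: comp_def)
  from distr_design_response[OF V prob_space_std _ this]
  show ?thesis by (simp add: mslr_null_def noise_def data_dim_def snr_def)
qed

lemma null_law_eq:
  assumes "V > 0"
  shows "null_law n p V = distr (design n p \<Otimes>\<^sub>M Pi\<^sub>M {..<n} (\<lambda>_. normal0 V)) (Rn (n * p + n)) (\<lambda>(X, y). data_vector n p X y)"
  using distr_design_response[OF assms prob_space_normal0[OF assms], of "\<lambda>x. x" n p] by simp

lemma nn_integral_distr':
  "T \<in> measurable M M' \<Longrightarrow> f \<in> borel_measurable M' \<Longrightarrow> (\<integral>\<^sup>+x. f x \<partial>distr M M' T) = (\<integral>\<^sup>+x. f (T x) \<partial>M)"
  by (simp add: nn_integral_distr)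

text \<open>Coordinatewise change of measure. Both sides factor over boxes, and boxes determine the
  measure.\<close>

lemma distr_noise_shift:
  assumes V: "V > 0"
  shows "distr (noise n) (Rn n) (\<lambda>w. \<lambda>i\<in>{..<n}. c i + w i) =
    density (distr (Pi\<^sub>M {..<n} (\<lambda>_. normal0 V)) (Rn n) (\<lambda>y. y)) (\<lambda>y. \<Prod>i<n. ennreal (shift_ratio V (c i) (y i)))"
proof (rule measure_eqI_Rn)
  interpret std: product_sigma_finite "\<lambda>_. std"
    by (intro product_sigma_finite_prob_space prob_space_std)
  interpret N: product_sigma_finite "\<lambda>_. normal0 V"
    by (intro product_sigma_finite_prob_space prob_space_normal0 V)
  have m1: "(\<lambda>w. \<lambda>i\<in>{..<n}. c i + w i) \<in> measurable (noise n) (Rn n)"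
    unfolding noise_def
    by (intro measurable_restrict borel_measurable_add borel_measurable_const measurable_component_singleton[of _ _ "\<lambda>_. std", simplified]) auto
  have m2: "(\<lambda>y. y) \<in> measurable (Pi\<^sub>M {..<n} (\<lambda>_. normal0 V)) (Rn n)"
    by (intro measurable_ident_sets sets_PiM_cong) auto
  show "prob_space (distr (noise n) (Rn n) (\<lambda>w. \<lambda>i\<in>{..<n}. c i + w i))"
    by (intro prob_space.prob_space_distr m1) (simp add: noise_def prob_space_gauss)
  fix A :: "nat \<Rightarrow> real set" assume A: "\<And>t. t < n \<Longrightarrow> A t \<in> sets borel"
  have box: "Pi\<^sub>E {..<n} A \<in> sets (Rn n)" using A by (intro sets_PiM_I_finite) auto
  have mr: "(\<lambda>y. \<Prod>i<n. ennreal (shift_ratio V (c i) (y i))) \<in> borel_measurable (Rn n)"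
    by measurable
  have "emeasure (distr (noise n) (Rn n) (\<lambda>w. \<lambda>i\<in>{..<n}. c i + w i)) (Pi\<^sub>E {..<n} A) = emeasure (gauss {..<n}) (Pi\<^sub>E {..<n} (\<lambda>i. {w. c i + w \<in> A i}))"
  proof (subst emeasure_distr[OF m1 box])
    have "(\<lambda>w. \<lambda>i\<in>{..<n}. c i + w i) -` Pi\<^sub>E {..<n} A \<inter> space (noise n) = Pi\<^sub>E {..<n} (\<lambda>i. {w. c i + w \<in> A i})"
      unfolding set_eq_iff Int_iff vimage_eq noise_def space_PiM PiE_iff by auto
    then show "emeasure (noise n) ((\<lambda>w. \<lambda>i\<in>{..<n}. c i + w i) -` Pi\<^sub>E {..<n} A \<inter> space (noise n)) = emeasure (gauss {..<n}) (Pi\<^sub>E {..<n} (\<lambda>i. {w. c i + w \<in> A i}))"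
      by (simp add: noise_def)
  qed
  also have "\<dots> = (\<Prod>i<n. emeasure std {w. c i + w \<in> A i})"
  proof (rule std.emeasure_PiM)
    fix i assume i: "i \<in> {..<n}"
    have "(\<lambda>w. c i + w) \<in> borel_measurable borel" by simp
    from measurable_sets[OF this, of "A i"] have "(\<lambda>w. c i + w) -` A i \<inter> space borel \<in> sets borel"
      using A i by simp
    also have "(\<lambda>w. c i + w) -` A i \<inter> space borel = {w. c i + w \<in> A i}" by auto
    finally show "{w. c i + w \<in> A i} \<in> sets std" by simp
  qed simp
  also have "\<dots> = (\<Prod>i<n. \<integral>\<^sup>+y. ennreal (shift_ratio V (c i) y) * indicator (A i) y \<partial>normal0 V)"
  proof (intro prod.cong refl)
    fix i assume i: "i \<in> {..<n}"
    then have [measurable]: "A i \<in> sets borel" using A by simp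
    have "(\<lambda>w. c i + w) \<in> borel_measurable borel" by simp
    from measurable_sets[OF this, of "A i"] have "(\<lambda>w. c i + w) -` A i \<inter> space borel \<in> sets borel"
      using A i by simp
    also have "(\<lambda>w. c i + w) -` A i \<inter> space borel = {w. c i + w \<in> A i}" by auto
    finally have [measurable]: "{w. c i + w \<in> A i} \<in> sets borel" .
    have "(\<integral>\<^sup>+y. ennreal (shift_ratio V (c i) y) * indicator (A i) y \<partial>normal0 V) = (\<integral>\<^sup>+w. indicator (A i) (c i + w) \<partial>std)"
      by (rule nn_integral_shift_ratio[OF V]) measurable
    also have "\<dots> = (\<integral>\<^sup>+w. indicator {w. c i + w \<in> A i} w \<partial>std)"
      by (intro nn_integral_cong) (auto simp: indicator_def)
    also have "\<dots> = emeasure std {w. c i + w \<in> A i}" by simp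
    finally show "emeasure std {w. c i + w \<in> A i} = (\<integral>\<^sup>+y. ennreal (shift_ratio V (c i) y) * indicator (A i) y \<partial>normal0 V)" by simp
  qed
  also have "\<dots> = (\<integral>\<^sup>+y. (\<Prod>i<n. ennreal (shift_ratio V (c i) (y i)) * indicator (A i) (y i)) \<partial>Pi\<^sub>M {..<n} (\<lambda>_. normal0 V))"
    by (intro N.product_nn_integral_prod[symmetric]) (use A in auto)
  also have "\<dots> = (\<integral>\<^sup>+y. (\<Prod>i<n. ennreal (shift_ratio V (c i) (y i))) * indicator (Pi\<^sub>E {..<n} A) y \<partial>Pi\<^sub>M {..<n} (\<lambda>_. normal0 V))"
  proof (intro nn_integral_cong)
    fix y assume "y \<in> space (Pi\<^sub>M {..<n} (\<lambda>_. normal0 V))"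
    then have "y \<in> extensional {..<n}" by (auto simp: space_PiM PiE_def)
    then have "(\<Prod>i<n. indicator (A i) (y i) :: ennreal) = indicator (Pi\<^sub>E {..<n} A) y"
    proof (cases "\<forall>i<n. y i \<in> A i")
      case False
      then obtain i where "i < n" "y i \<notin> A i" by auto
      then have "(\<Prod>i<n. indicator (A i) (y i) :: ennreal) = 0" by (intro prod_zero bexI[of _ i]) auto
      then show ?thesis using False by (auto simp: indicator_def PiE_iff)
    qed (auto simp: indicator_def PiE_iff)
    then show "(\<Prod>i<n. ennreal (shift_ratio V (c i) (y i)) * indicator (A i) (y i)) = (\<Prod>i<n. ennreal (shift_ratio V (c i) (y i))) * indicator (Pi\<^sub>E {..<n} A) y"
      by (simp add: prod.distrib)
  qed
  also have "\<dots> = (\<integral>\<^sup>+y. (\<Prod>i<n. ennreal (shift_ratio V (c i) (y i))) * indicator (Pi\<^sub>E {..<n} A) y \<partial>distr (Pi\<^sub>M {..<n} (\<lambda>_. normal0 V)) (Rn n) (\<lambda>y. y))"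
    using box mr by (intro nn_integral_distr'[OF m2, symmetric] borel_measurable_times_ennreal borel_measurable_indicator)
  also have "\<dots> = emeasure (density (distr (Pi\<^sub>M {..<n} (\<lambda>_. normal0 V)) (Rn n) (\<lambda>y. y)) (\<lambda>y. \<Prod>i<n. ennreal (shift_ratio V (c i) (y i)))) (Pi\<^sub>E {..<n} A)"
    by (rule emeasure_density[symmetric]) (use box mr in \<open>simp_all only: sets_distr measurable_distr_eq1\<close>)
  finally show "emeasure (distr (noise n) (Rn n) (\<lambda>w. \<lambda>i\<in>{..<n}. c i + w i)) (Pi\<^sub>E {..<n} A) = \<dots>" .
qed simp_all

definition mean_response :: "nat \<Rightarrow> real \<Rightarrow> (nat \<times> nat \<Rightarrow> real) \<Rightarrow> (nat \<Rightarrow> bool) \<Rightarrow> (nat \<Rightarrow> real) \<times> (nat \<Rightarrow> real) \<Rightarrow> nat \<Rightarrow> real" where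
  "mean_response p \<sigma> X z \<beta> i =
     1 / \<sigma> * (\<Sum>j<p. X (i, j) * fst \<beta> j) * of_bool (z i) + 1 / \<sigma> * (\<Sum>j<p. X (i, j) * snd \<beta> j) * (1 - of_bool (z i))"

lemma measurable_mean_response:
  assumes "\<And>j. j < p \<Longrightarrow> (\<lambda>x. X x (i, j)) \<in> borel_measurable M" "(\<lambda>x. of_bool (z x i) :: real) \<in> borel_measurable M"
    and "\<And>j. j < p \<Longrightarrow> (\<lambda>x. fst (\<beta> x) j) \<in> borel_measurable M" "\<And>j. j < p \<Longrightarrow> (\<lambda>x. snd (\<beta> x) j) \<in> borel_measurable M"
  shows "(\<lambda>x. mean_response p \<sigma> (X x) (z x) (\<beta> x) i) \<in> borel_measurable M"
  unfolding mean_response_def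
  by (intro borel_measurable_add borel_measurable_times borel_measurable_diff borel_measurable_const borel_measurable_sum assms) auto

lemma mean_response_antisym:
  assumes "\<And>j. j < p \<Longrightarrow> fst \<beta> j = - snd \<beta> j"
  shows "mean_response p \<sigma> X z \<beta> i = (if z i then 1 else -1) * lin p (\<lambda>j. X (i, j)) (\<lambda>j. fst \<beta> j / \<sigma>)"
proof -
  have "(\<Sum>j<p. X (i, j) * snd \<beta> j) = - (\<Sum>j<p. X (i, j) * fst \<beta> j)"
    using assms by (simp add: sum_negf[symmetric])
  then show ?thesis by (simp add: mean_response_def sum_divide_distrib)
qed

text \<open>The labels are independent fair coins, so the average of the product is the product of
  the averages.\<close>

lemma nn_integral_labels:
  assumes "V > 0"
  shows "(\<integral>\<^sup>+z. (\<Prod>i<n. ennreal (shift_ratio V ((if z i then 1 else -1) * a i) (y i))) \<partial>labels n (1/2)) = ennreal (\<Prod>i<n. sym_ratio V (a i) (y i))"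
proof -
  interpret product_sigma_finite "\<lambda>_. measure_pmf (bernoulli_pmf (1/2))"
    by (intro product_sigma_finite_prob_space measure_pmf.prob_space_axioms)
  have h: "ennreal x * ennreal (1/2) + ennreal y * ennreal (1/2) = ennreal ((x + y) / 2)" if "x \<ge> 0" "y \<ge> 0" for x y :: real
  proof -
    have "ennreal x * ennreal (1/2) + ennreal y * ennreal (1/2) = ennreal (x * (1/2) + y * (1/2))"
      using that by (simp only: ennreal_mult' ennreal_plus mult_nonneg_nonneg divide_nonneg_nonneg zero_le_one zero_le_numeral)
    then show ?thesis by (simp add: add_divide_distrib)
  qed
  have "(\<integral>\<^sup>+b. ennreal (shift_ratio V ((if b then 1 else -1) * a i) (y i)) \<partial>bernoulli_pmf (1/2)) = ennreal (sym_ratio V (a i) (y i))" for i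
    using h[OF shift_ratio_nonneg shift_ratio_nonneg, of V "a i" "y i" V "- a i" "y i"]
    by (subst nn_integral_bernoulli_pmf) (simp_all add: sym_ratio_def mult.commute)
  then show ?thesis
    unfolding labels_def
    by (subst product_nn_integral_prod) (simp_all add: prod_ennreal sym_ratio_nonneg)
qed

lemma measurable_signal_coords:
  fixes \<mu> :: "((nat \<Rightarrow> real) \<times> (nat \<Rightarrow> real)) measure"
  assumes "sets \<mu> = sets (Rn p \<Otimes>\<^sub>M Rn p)" "j < p"
  shows "(\<lambda>\<beta>. fst \<beta> j) \<in> borel_measurable \<mu>" "(\<lambda>\<beta>. snd \<beta> j) \<in> borel_measurable \<mu>"
  unfolding measurable_cong_sets[OF assms(1) refl]
  using measurable_compose[OF measurable_fst measurable_component_singleton] measurable_compose[OF measurable_snd measurable_component_singleton] assms(2) by auto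

lemma measurable_label_coord: "i < n \<Longrightarrow> (\<lambda>z. of_bool (z i) :: real) \<in> borel_measurable (labels n \<phi>)"
  unfolding labels_def by (rule measurable_compose[OF measurable_component_singleton]) simp_all

lemma measurable_noise_coord: "i < n \<Longrightarrow> (\<lambda>w. w i) \<in> borel_measurable (noise n)"
  unfolding noise_def using measurable_component_singleton[of i "{..<n}" "\<lambda>_. std"] by simp

lemma measurable_observation:
  fixes \<mu> :: "((nat \<Rightarrow> real) \<times> (nat \<Rightarrow> real)) measure"
  assumes "sets \<mu> = sets (Rn p \<Otimes>\<^sub>M Rn p)"
  shows "(\<lambda>(X, w, z, \<beta>). data_vector n p X (\<lambda>i. mean_response p \<sigma> X z \<beta> i + w i))
    \<in> measurable (design n p \<Otimes>\<^sub>M (noise n \<Otimes>\<^sub>M (labels n \<phi> \<Otimes>\<^sub>M \<mu>))) (Rn (n * p + n))"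
  unfolding case_prod_unfold
  by (intro measurable_data_vector borel_measurable_add measurable_mean_response
      measurable_compose[OF measurable_fst measurable_design_coord]
      measurable_compose[OF measurable_snd measurable_compose[OF measurable_fst measurable_noise_coord]]
      measurable_compose[OF measurable_snd measurable_compose[OF measurable_snd measurable_compose[OF measurable_fst measurable_label_coord]]]
      measurable_compose[OF measurable_snd measurable_compose[OF measurable_snd measurable_compose[OF measurable_snd measurable_signal_coords(1)[OF assms]]]]
      measurable_compose[OF measurable_snd measurable_compose[OF measurable_snd measurable_compose[OF measurable_snd measurable_signal_coords(2)[OF assms]]]])

lemma mslr_alternative_eq_distr:
  "mslr_alternative n p \<phi> \<sigma> \<mu> = distr (design n p \<Otimes>\<^sub>M (noise n \<Otimes>\<^sub>M (labels n \<phi> \<Otimes>\<^sub>M \<mu>))) (Rn (n * p + n))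
     (\<lambda>(X, w, z, \<beta>). data_vector n p X (\<lambda>i. mean_response p \<sigma> X z \<beta> i + w i))"
  by (simp add: mslr_alternative_def data_dim_def mean_response_def case_prod_unfold)

lemma prob_space_mslr_alternative:
  fixes \<mu> :: "((nat \<Rightarrow> real) \<times> (nat \<Rightarrow> real)) measure"
  assumes "prob_space \<mu>" "sets \<mu> = sets (Rn p \<Otimes>\<^sub>M Rn p)"
  shows "prob_space (mslr_alternative n p \<phi> \<sigma> \<mu>)"
  unfolding mslr_alternative_eq_distr
proof (rule prob_space.prob_space_distr[OF _ measurable_observation[OF assms(2)]])
  show "prob_space (design n p \<Otimes>\<^sub>M (noise n \<Otimes>\<^sub>M (labels n \<phi> \<Otimes>\<^sub>M \<mu>)))"
    unfolding noise_def labels_def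
    by (intro prob_space_pair prob_space_design prob_space_gauss prob_space_PiM measure_pmf.prob_space_axioms assms)
qed

text \<open>Given design, labels and signal, the responses are shifted noise and have a product
  density against the null responses. Tonelli moves the integral over labels and signal inside,
  where averaging over the labels yields \<open>sym_ratio\<close>. The first signal enters divided
  by \<sigma>, whence the form of \<open>\<nu>\<close>.\<close>

lemma mslr_alternative_eq:
  fixes \<mu> :: "((nat \<Rightarrow> real) \<times> (nat \<Rightarrow> real)) measure" and \<sigma> :: real
  assumes s: "s + 1 > 0" and \<mu>: "prob_space \<mu>" "sets \<mu> = sets (Rn p \<Otimes>\<^sub>M Rn p)" and anti: "antisymmetric_pairs p \<mu>"
  defines "\<nu> \<equiv> distr \<mu> (Rn p) (\<lambda>\<beta>. \<lambda>j\<in>{..<p}. fst \<beta> j / \<sigma>)"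
  shows "mslr_alternative n p (1/2) \<sigma> \<mu> = density (null_law n p (s + 1)) (\<lambda>v. \<integral>\<^sup>+u. ennreal (lr_given n p s u v) \<partial>\<nu>)"
proof (rule measure_eqI)
  let ?N = "n * p + n" and ?V = "s + 1" and ?Z = "labels n (1/2)"
  let ?Y = "Pi\<^sub>M {..<n} (\<lambda>_. normal0 ?V)"
  interpret \<mu>: prob_space \<mu> by fact
  interpret X: prob_space "design n p" by (rule prob_space_design)
  interpret W: prob_space "noise n" unfolding noise_def by (rule prob_space_gauss)
  interpret Y: prob_space ?Y by (intro prob_space_PiM prob_space_normal0 s)
  interpret Z: prob_space ?Z unfolding labels_def by (intro prob_space_PiM measure_pmf.prob_space_axioms)
  interpret Z\<mu>: pair_prob_space ?Z \<mu> ..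
  interpret WZ: pair_prob_space "noise n" "?Z \<Otimes>\<^sub>M \<mu>" ..
  interpret YZ: pair_prob_space ?Y "?Z \<Otimes>\<^sub>M \<mu>" ..
  interpret XY: pair_prob_space "design n p" ?Y ..
  show "sets (mslr_alternative n p (1/2) \<sigma> \<mu>) = sets (density (null_law n p ?V) (\<lambda>v. \<integral>\<^sup>+u. ennreal (lr_given n p s u v) \<partial>\<nu>))"
    by (simp add: mslr_alternative_def sets_null_law data_dim_def)
  fix A assume "A \<in> sets (mslr_alternative n p (1/2) \<sigma> \<mu>)"
  then have A: "A \<in> sets (Rn ?N)" by (simp add: mslr_alternative_def data_dim_def)
  define H where "H = (\<lambda>X y. indicator A (data_vector n p X y) :: ennreal)"
  note m\<beta> = measurable_signal_coords[OF \<mu>(2)] and mz = measurable_label_coord and mw = measurable_noise_coord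
  have my: "(\<lambda>w. w i) \<in> borel_measurable ?Y" if "i < n" for i
    using measurable_component_singleton[of i "{..<n}" "\<lambda>_. normal0 ?V"] that by simp
  let ?T = "\<lambda>(X, w, z, \<beta>). data_vector n p X (\<lambda>i. mean_response p \<sigma> X z \<beta> i + w i)"
  have T: "?T \<in> measurable (design n p \<Otimes>\<^sub>M (noise n \<Otimes>\<^sub>M (?Z \<Otimes>\<^sub>M \<mu>))) (Rn ?N)"
    by (rule measurable_observation[OF \<mu>(2)])
  note alt = mslr_alternative_eq_distr[of n p "1/2" \<sigma> \<mu>]
  define \<rho> where "\<rho> = (\<lambda>X y z \<beta>. \<Prod>i<n. ennreal (shift_ratio ?V (mean_response p \<sigma> X z \<beta> i) (y i)))"
  have HY: "H X \<in> borel_measurable (Rn n)" for X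
    unfolding H_def
    by (rule measurable_compose[OF measurable_data_vector borel_measurable_indicator[OF A]])
       (auto intro: measurable_component_singleton)
  have HY': "H X \<in> borel_measurable ?Y" for X
    using HY[of X] measurable_cong_sets[OF sets_PiM_cong refl, of "{..<n}" "{..<n}" "\<lambda>_. borel" "\<lambda>_. normal0 ?V" borel] by simp
  have inner: "(\<integral>\<^sup>+w. indicator A (data_vector n p X (\<lambda>i. c i + w i)) \<partial>noise n) = (\<integral>\<^sup>+y. H X y * (\<Prod>i<n. ennreal (shift_ratio ?V (c i) (y i))) \<partial>?Y)" for X c
  proof -
    have m1: "(\<lambda>w. \<lambda>i\<in>{..<n}. c i + w i) \<in> measurable (noise n) (Rn n)"
      by (intro measurable_restrict borel_measurable_add borel_measurable_const mw) auto
    have m2: "(\<lambda>y. y) \<in> measurable ?Y (Rn n)"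
      by (intro measurable_ident_sets sets_PiM_cong) auto
    have mr: "(\<lambda>y. \<Prod>i<n. ennreal (shift_ratio ?V (c i) (y i))) \<in> borel_measurable (Rn n)"
      by measurable
    have "(\<integral>\<^sup>+w. indicator A (data_vector n p X (\<lambda>i. c i + w i)) \<partial>noise n) = (\<integral>\<^sup>+w. H X (\<lambda>i\<in>{..<n}. c i + w i) \<partial>noise n)"
      unfolding H_def data_vector_restrict ..
    also have "\<dots> = (\<integral>\<^sup>+y. H X y \<partial>distr (noise n) (Rn n) (\<lambda>w. \<lambda>i\<in>{..<n}. c i + w i))"
      by (rule nn_integral_distr'[symmetric, OF m1 HY])
    also have "\<dots> = (\<integral>\<^sup>+y. (\<Prod>i<n. ennreal (shift_ratio ?V (c i) (y i))) * H X y \<partial>distr ?Y (Rn n) (\<lambda>y. y))"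
      unfolding distr_noise_shift[OF s] by (rule nn_integral_density) (use mr HY in auto)
    also have "\<dots> = (\<integral>\<^sup>+y. (\<Prod>i<n. ennreal (shift_ratio ?V (c i) (y i))) * H X y \<partial>?Y)"
      by (rule nn_integral_distr'[OF m2]) (use mr HY in auto)
    finally show ?thesis by (simp add: mult.commute)
  qed
  \<comment> \<open>Labels are integrated out before the signal, because the product over
    observations factors only for a fixed signal.\<close>
  have lr_int: "(\<integral>\<^sup>+q. \<rho> X y (fst q) (snd q) \<partial>(?Z \<Otimes>\<^sub>M \<mu>)) = (\<integral>\<^sup>+u. ennreal (lr_given n p s u (data_vector n p X y)) \<partial>\<nu>)" for X y
  proof -
    have m\<nu>: "(\<lambda>\<beta>. \<lambda>j\<in>{..<p}. fst \<beta> j / \<sigma>) \<in> measurable \<mu> (Rn p)"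
      by (intro measurable_restrict borel_measurable_divide borel_measurable_const m\<beta>(1)) auto
    have m\<rho>: "(\<lambda>q. \<rho> X y (fst q) (snd q)) \<in> borel_measurable (?Z \<Otimes>\<^sub>M \<mu>)"
      unfolding \<rho>_def
      by (intro borel_measurable_prod_ennreal measurable_compose[OF _ measurable_ennreal] borel_measurable_shift_ratio
          measurable_mean_response borel_measurable_const measurable_compose[OF measurable_fst mz]
          measurable_compose[OF measurable_snd m\<beta>(1)] measurable_compose[OF measurable_snd m\<beta>(2)]) auto
    have mlr: "(\<lambda>u. ennreal (lr_given n p s u v)) \<in> borel_measurable (Rn p)" for v
      unfolding lr_given_def
      by (intro measurable_compose[OF _ measurable_ennreal] borel_measurable_prod borel_measurable_sym_ratio borel_measurable_const measurable_lin
          measurable_component_singleton) auto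
    have "(\<integral>\<^sup>+q. \<rho> X y (fst q) (snd q) \<partial>(?Z \<Otimes>\<^sub>M \<mu>)) = (\<integral>\<^sup>+\<beta>. \<integral>\<^sup>+z. \<rho> X y z \<beta> \<partial>?Z \<partial>\<mu>)"
      using Z\<mu>.nn_integral_snd[of "\<lambda>q. \<rho> X y (fst q) (snd q)"] m\<rho> by (simp add: case_prod_unfold)
    also have "\<dots> = (\<integral>\<^sup>+\<beta>. ennreal (lr_given n p s (\<lambda>j\<in>{..<p}. fst \<beta> j / \<sigma>) (data_vector n p X y)) \<partial>\<mu>)"
    proof (rule nn_integral_cong_AE)
      have "AE \<beta> in \<mu>. \<forall>j<p. fst \<beta> j = - snd \<beta> j"
        using anti by (simp add: antisymmetric_pairs_def case_prod_unfold)
      then show "AE \<beta> in \<mu>. (\<integral>\<^sup>+z. \<rho> X y z \<beta> \<partial>?Z) = ennreal (lr_given n p s (\<lambda>j\<in>{..<p}. fst \<beta> j / \<sigma>) (data_vector n p X y))"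
      proof eventually_elim
        case (elim \<beta>)
        have "lr_given n p s (\<lambda>j\<in>{..<p}. fst \<beta> j / \<sigma>) (data_vector n p X y) = (\<Prod>i<n. sym_ratio ?V (lin p (\<lambda>j. X (i, j)) (\<lambda>j. fst \<beta> j / \<sigma>)) (y i))"
          unfolding lr_given_def by (intro prod.cong refl arg_cong2[where f = "sym_ratio ?V"] sum.cong) auto
        moreover have "mean_response p \<sigma> X z \<beta> i = (if z i then 1 else -1) * lin p (\<lambda>j. X (i, j)) (\<lambda>j. fst \<beta> j / \<sigma>)" for z i
          by (rule mean_response_antisym) (use elim in auto)
        ultimately show ?case
          unfolding \<rho>_def by (simp only: nn_integral_labels[OF s])
      qed
    qed
    also have "\<dots> = (\<integral>\<^sup>+u. ennreal (lr_given n p s u (data_vector n p X y)) \<partial>\<nu>)"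
      unfolding \<nu>_def by (rule nn_integral_distr'[symmetric, OF m\<nu> mlr])
    finally show ?thesis .
  qed
  have "emeasure (mslr_alternative n p (1/2) \<sigma> \<mu>) A = (\<integral>\<^sup>+v. indicator A v \<partial>mslr_alternative n p (1/2) \<sigma> \<mu>)"
    using A by (simp add: alt)
  also have "\<dots> = (\<integral>\<^sup>+q. indicator A (?T q) \<partial>(design n p \<Otimes>\<^sub>M (noise n \<Otimes>\<^sub>M (?Z \<Otimes>\<^sub>M \<mu>))))"
    unfolding alt by (rule nn_integral_distr'[OF T borel_measurable_indicator[OF A]])
  also have "\<dots> = (\<integral>\<^sup>+X. \<integral>\<^sup>+q. indicator A (?T (X, q)) \<partial>(noise n \<Otimes>\<^sub>M (?Z \<Otimes>\<^sub>M \<mu>)) \<partial>design n p)"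
    by (rule WZ.nn_integral_fst[symmetric]) (rule measurable_compose[OF T borel_measurable_indicator[OF A]])
  also have "\<dots> = (\<integral>\<^sup>+X. \<integral>\<^sup>+q. \<integral>\<^sup>+w. indicator A (data_vector n p X (\<lambda>i. mean_response p \<sigma> X (fst q) (snd q) i + w i)) \<partial>noise n \<partial>(?Z \<Otimes>\<^sub>M \<mu>) \<partial>design n p)"
  proof (rule nn_integral_cong)
    fix X assume X: "X \<in> space (design n p)"
    have "(\<lambda>q. indicator A (?T (X, q)) :: ennreal) \<in> borel_measurable (noise n \<Otimes>\<^sub>M (?Z \<Otimes>\<^sub>M \<mu>))"
      by (rule measurable_compose[OF measurable_compose[OF measurable_Pair1'[OF X] T] borel_measurable_indicator[OF A]])
    then show "(\<integral>\<^sup>+q. indicator A (?T (X, q)) \<partial>(noise n \<Otimes>\<^sub>M (?Z \<Otimes>\<^sub>M \<mu>))) =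
        (\<integral>\<^sup>+q. \<integral>\<^sup>+w. indicator A (data_vector n p X (\<lambda>i. mean_response p \<sigma> X (fst q) (snd q) i + w i)) \<partial>noise n \<partial>(?Z \<Otimes>\<^sub>M \<mu>))"
      using WZ.nn_integral_snd[of "\<lambda>(w, q). indicator A (data_vector n p X (\<lambda>i. mean_response p \<sigma> X (fst q) (snd q) i + w i))"]
      by (simp add: case_prod_unfold)
  qed
  also have "\<dots> = (\<integral>\<^sup>+X. \<integral>\<^sup>+q. \<integral>\<^sup>+y. H X y * \<rho> X y (fst q) (snd q) \<partial>?Y \<partial>(?Z \<Otimes>\<^sub>M \<mu>) \<partial>design n p)"
    by (simp only: inner \<rho>_def)
  \<comment> \<open>With labels and signal innermost, the indicator of the event becomes a constant
    factor of the inner integral.\<close>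
  also have "\<dots> = (\<integral>\<^sup>+X. \<integral>\<^sup>+y. \<integral>\<^sup>+q. H X y * \<rho> X y (fst q) (snd q) \<partial>(?Z \<Otimes>\<^sub>M \<mu>) \<partial>?Y \<partial>design n p)"
  proof (intro nn_integral_cong YZ.Fubini')
    fix X
    show "(\<lambda>(y, q). H X y * \<rho> X y (fst q) (snd q)) \<in> borel_measurable (?Y \<Otimes>\<^sub>M (?Z \<Otimes>\<^sub>M \<mu>))"
      unfolding \<rho>_def case_prod_unfold
      by (intro borel_measurable_times_ennreal measurable_compose[OF measurable_fst HY']
          borel_measurable_prod_ennreal measurable_compose[OF _ measurable_ennreal] borel_measurable_shift_ratio
          measurable_mean_response borel_measurable_const
          measurable_compose[OF measurable_fst my]
          measurable_compose[OF measurable_snd measurable_compose[OF measurable_fst mz]]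
          measurable_compose[OF measurable_snd measurable_compose[OF measurable_snd m\<beta>(1)]]
          measurable_compose[OF measurable_snd measurable_compose[OF measurable_snd m\<beta>(2)]]) auto
  qed
  also have "\<dots> = (\<integral>\<^sup>+X. \<integral>\<^sup>+y. H X y * (\<integral>\<^sup>+u. ennreal (lr_given n p s u (data_vector n p X y)) \<partial>\<nu>) \<partial>?Y \<partial>design n p)"
    unfolding lr_int[symmetric]
  proof (intro nn_integral_cong nn_integral_cmult)
    fix X y
    show "(\<lambda>q. \<rho> X y (fst q) (snd q)) \<in> borel_measurable (?Z \<Otimes>\<^sub>M \<mu>)"
      unfolding \<rho>_def
      by (intro borel_measurable_prod_ennreal measurable_compose[OF _ measurable_ennreal] borel_measurable_shift_ratio
          measurable_mean_response borel_measurable_const measurable_compose[OF measurable_fst mz]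
          measurable_compose[OF measurable_snd m\<beta>(1)] measurable_compose[OF measurable_snd m\<beta>(2)]) auto
  qed
  also have "\<dots> = (\<integral>\<^sup>+v. (\<integral>\<^sup>+u. ennreal (lr_given n p s u v) \<partial>\<nu>) * indicator A v \<partial>null_law n p ?V)"
  proof -
    interpret \<nu>: prob_space \<nu>
      unfolding \<nu>_def
      by (intro \<mu>.prob_space_distr measurable_restrict borel_measurable_divide borel_measurable_const m\<beta>(1)) auto
    have [measurable]: "(\<lambda>(v, u). lr_given n p s u v) \<in> borel_measurable (Rn ?N \<Otimes>\<^sub>M \<nu>)"
      by (rule measurable_lr_given) (simp_all add: \<nu>_def)
    have ml: "(\<lambda>v. (\<integral>\<^sup>+u. ennreal (lr_given n p s u v) \<partial>\<nu>) * indicator A v) \<in> borel_measurable (Rn ?N)"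
      using A by measurable
    have md: "(\<lambda>(X, y). data_vector n p X y) \<in> measurable (design n p \<Otimes>\<^sub>M ?Y) (Rn ?N)"
      unfolding case_prod_unfold
      by (intro measurable_data_vector measurable_compose[OF measurable_fst measurable_design_coord] measurable_compose[OF measurable_snd my])
    show ?thesis
      unfolding null_law_eq[OF s] nn_integral_distr'[OF md ml]
      by (subst Y.nn_integral_fst[symmetric, OF measurable_compose[OF md ml]]) (simp add: H_def mult.commute)
  qed
  also have "\<dots> = emeasure (density (null_law n p ?V) (\<lambda>v. \<integral>\<^sup>+u. ennreal (lr_given n p s u v) \<partial>\<nu>)) A"
  proof -
    interpret \<nu>: prob_space \<nu>
      unfolding \<nu>_def
      by (intro \<mu>.prob_space_distr measurable_restrict borel_measurable_divide borel_measurable_const m\<beta>(1)) auto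
    have [measurable]: "(\<lambda>(v, u). lr_given n p s u v) \<in> borel_measurable (null_law n p ?V \<Otimes>\<^sub>M \<nu>)"
      by (rule measurable_lr_given) (simp_all add: \<nu>_def sets_null_law)
    have "(\<lambda>v. \<integral>\<^sup>+u. ennreal (lr_given n p s u v) \<partial>\<nu>) \<in> borel_measurable (null_law n p ?V)" by measurable
    then show ?thesis using A by (intro emeasure_density[symmetric]) (simp_all add: sets_null_law)
  qed
  finally show "emeasure (mslr_alternative n p (1/2) \<sigma> \<mu>) A = \<dots>" .
qed

section \<open>Exchangeability of the signal prior\<close>

text \<open>Transpositions are Euclidean isometries that map the set of signals onto itself; this
  symmetry replaces any explicit description of the uniform law.\<close>

definition swap_coords :: "nat \<Rightarrow> nat \<Rightarrow> (nat \<Rightarrow> real) \<Rightarrow> nat \<Rightarrow> real" where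
  "swap_coords i j x = (\<lambda>l. x (Transposition.transpose i j l))"

lemma swap_coords_involutory [simp]: "swap_coords i j (swap_coords i j x) = x"
  by (simp add: swap_coords_def)

lemma bij_betw_transpose_lessThan:
  assumes "i < p" "j < (p::nat)"
  shows "bij_betw (Transposition.transpose i j) {..<p} {..<p}"
proof (rule bij_betw_byWitness[where f' = "Transposition.transpose i j"])
  show "Transposition.transpose i j ` {..<p} \<subseteq> {..<p}" "Transposition.transpose i j ` {..<p} \<subseteq> {..<p}"
    using assms by (auto simp: Transposition.transpose_def)
qed auto

lemma L2_set_swap_coords:
  assumes "i < p" "j < p"
  shows "L2_set (\<lambda>l. f (swap_coords i j x l) (swap_coords i j y l)) {..<p} = L2_set (\<lambda>l. f (x l) (y l)) {..<p}"
proof -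
  have "(\<Sum>l<p. (f (swap_coords i j x l) (swap_coords i j y l))\<^sup>2) = (\<Sum>l<p. (f (x l) (y l))\<^sup>2)"
    unfolding swap_coords_def by (rule sum.reindex_bij_betw[OF bij_betw_transpose_lessThan[OF assms]])
  then show ?thesis by (simp add: L2_set_def)
qed

text \<open>A covering is carried to a covering with the same diameters. Since the swap is an
  involution, the inequality also gives equality.\<close>

lemma hausdorff_measure_swap_coords_le:
  assumes "i < p" "j < p"
  shows "hausdorff_measure p s (swap_coords i j ` A) \<le> hausdorff_measure p s A"
  unfolding hausdorff_measure_def
proof (intro SUP_mono bexI INF_mono)
  let ?S = "\<lambda>U. swap_coords i j ` U"
  fix \<delta> :: real and U :: "nat \<Rightarrow> (nat \<Rightarrow> real) set"
  assume "\<delta> \<in> {0<..}"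
  then show "\<delta> \<in> {0<..}" .
  assume U: "U \<in> {U. A \<subseteq> (\<Union>i. U i) \<and> (\<forall>i. \<forall>x\<in>U i. \<forall>y\<in>U i. L2_set (\<lambda>j. x j - y j) {..<p} \<le> \<delta>)}"
  show "(\<lambda>l. ?S (U l)) \<in> {U. ?S A \<subseteq> (\<Union>i. U i) \<and> (\<forall>i. \<forall>x\<in>U i. \<forall>y\<in>U i. L2_set (\<lambda>j. x j - y j) {..<p} \<le> \<delta>)}"
    using U L2_set_swap_coords[OF assms, of "(-)"] by fastforce
  have diam: "diam p (?S U) = diam p U" for U
  proof -
    have "{L2_set (\<lambda>j. x j - y j) {..<p} | x y. x \<in> ?S U \<and> y \<in> ?S U} = {L2_set (\<lambda>j. x j - y j) {..<p} | x y. x \<in> U \<and> y \<in> U}"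
    proof (intro subset_antisym subsetI)
      fix r assume "r \<in> {L2_set (\<lambda>j. x j - y j) {..<p} | x y. x \<in> ?S U \<and> y \<in> ?S U}"
      then show "r \<in> {L2_set (\<lambda>j. x j - y j) {..<p} | x y. x \<in> U \<and> y \<in> U}"
        using L2_set_swap_coords[OF assms, of "(-)"] by auto
    next
      fix r assume "r \<in> {L2_set (\<lambda>j. x j - y j) {..<p} | x y. x \<in> U \<and> y \<in> U}"
      then obtain x y where "r = L2_set (\<lambda>l. swap_coords i j x l - swap_coords i j y l) {..<p}" "x \<in> U" "y \<in> U"
        using L2_set_swap_coords[OF assms, of "(-)"] by auto
      then show "r \<in> {L2_set (\<lambda>j. x j - y j) {..<p} | x y. x \<in> ?S U \<and> y \<in> ?S U}"
        by blast
    qed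
    then show ?thesis by (simp add: diam_def)
  qed
  show "(\<Sum>l. hausdorff_size p s (?S (U l))) \<le> (\<Sum>l. hausdorff_size p s (U l))"
    by (simp add: hausdorff_size_def diam cong: if_cong)
qed

lemma hausdorff_measure_swap_coords:
  assumes "i < p" "j < p"
  shows "hausdorff_measure p s (swap_coords i j ` A) = hausdorff_measure p s A"
proof (rule antisym)
  have "hausdorff_measure p s (swap_coords i j ` swap_coords i j ` A) \<le> hausdorff_measure p s (swap_coords i j ` A)"
    by (rule hausdorff_measure_swap_coords_le[OF assms])
  then show "hausdorff_measure p s A \<le> hausdorff_measure p s (swap_coords i j ` A)"
    by (simp add: image_image)
qed (rule hausdorff_measure_swap_coords_le[OF assms])

lemma swap_coords_space:
  assumes "i < p" "j < p" "x \<in> space (Rn p)"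
  shows "swap_coords i j x \<in> space (Rn p)"
  using assms by (auto simp: space_PiM PiE_iff swap_coords_def extensional_def Transposition.transpose_def)

lemma swap_coords_signals:
  assumes ij: "i < p" "j < p" and x: "x \<in> signals p k \<D> b"
  shows "swap_coords i j x \<in> signals p k \<D> b"
proof -
  have img: "Transposition.transpose i j ` {l. l < p \<and> swap_coords i j x l \<noteq> 0} = {l. l < p \<and> x l \<noteq> 0}"
  proof (intro subset_antisym subsetI)
    fix l assume "l \<in> {l. l < p \<and> x l \<noteq> 0}"
    then have "Transposition.transpose i j l \<in> {l. l < p \<and> swap_coords i j x l \<noteq> 0}"
      using ij by (auto simp: swap_coords_def) (auto simp: Transposition.transpose_def)
    then show "l \<in> Transposition.transpose i j ` {l. l < p \<and> swap_coords i j x l \<noteq> 0}"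
      by (metis (no_types, lifting) image_eqI transpose_involutory)
  qed (use ij in \<open>auto simp: swap_coords_def Transposition.transpose_def split: if_splits\<close>)
  have inj: "inj_on (Transposition.transpose i j) {l. l < p \<and> swap_coords i j x l \<noteq> 0}"
    by (rule inj_on_inverseI[where g = "Transposition.transpose i j"]) simp
  have "card {l. l < p \<and> x l \<noteq> 0} = card {l. l < p \<and> swap_coords i j x l \<noteq> 0}"
    unfolding img[symmetric] by (rule card_image[OF inj])
  moreover have "L2_set (swap_coords i j x) {..<p} = L2_set x {..<p}"
    using L2_set_swap_coords[OF ij, of "\<lambda>a _. a" x x] by simp
  moreover have "Transposition.transpose i j l < p" if "l < p" for l
    using ij that by (auto simp: Transposition.transpose_def)
  ultimately show ?thesis
    using x swap_coords_space[OF ij] by (auto simp: signals_def) (auto simp: swap_coords_def)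
qed

lemma measurable_swap_coords:
  assumes "i < p" "j < p"
  shows "swap_coords i j \<in> measurable (Rn p) (Rn p)"
proof -
  have "(\<lambda>x. \<lambda>l\<in>{..<p}. x (Transposition.transpose i j l)) \<in> measurable (Rn p) (Rn p)"
    using assms by (intro measurable_restrict measurable_component_singleton) (auto simp: Transposition.transpose_def)
  moreover have "swap_coords i j x = (\<lambda>l\<in>{..<p}. x (Transposition.transpose i j l))" if "x \<in> space (Rn p)" for x
    using swap_coords_space[OF assms that]
    by (auto simp: swap_coords_def space_PiM PiE_iff extensional_def fun_eq_iff)
  ultimately show ?thesis by (subst measurable_cong) auto
qed

lemma uniform_on_swap_coords:
  assumes u: "uniform_on p (signals p k \<D> b) \<mu>" and ij: "i < p" "j < p" and A: "A \<in> sets (Rn p)"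
  shows "emeasure \<mu> (swap_coords i j -` A \<inter> space (Rn p)) = emeasure \<mu> A"
proof -
  let ?B = "signals p k \<D> b"
  obtain s where sets: "sets \<mu> = sets (Rn p)"
    and em: "\<And>A. A \<in> sets \<mu> \<Longrightarrow> emeasure \<mu> A = hausdorff_measure p s (A \<inter> ?B) / hausdorff_measure p s ?B"
    using u by (auto simp: uniform_on_def)
  have "swap_coords i j ` (A \<inter> ?B) = (swap_coords i j -` A \<inter> space (Rn p)) \<inter> ?B"
  proof (intro subset_antisym subsetI)
    fix x assume "x \<in> (swap_coords i j -` A \<inter> space (Rn p)) \<inter> ?B"
    then have "swap_coords i j x \<in> A \<inter> ?B" "x = swap_coords i j (swap_coords i j x)"
      using swap_coords_signals[OF ij] by auto
    then show "x \<in> swap_coords i j ` (A \<inter> ?B)" by blast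
  next
    fix x assume "x \<in> swap_coords i j ` (A \<inter> ?B)"
    then show "x \<in> (swap_coords i j -` A \<inter> space (Rn p)) \<inter> ?B"
      using swap_coords_signals[OF ij] swap_coords_space[OF ij] by (auto simp: signals_def)
  qed
  then have "hausdorff_measure p s ((swap_coords i j -` A \<inter> space (Rn p)) \<inter> ?B) = hausdorff_measure p s (A \<inter> ?B)"
    by (metis hausdorff_measure_swap_coords[OF ij])
  then show ?thesis
    using A measurable_sets[OF measurable_swap_coords[OF ij] A] by (simp add: em sets)
qed

abbreviation support :: "nat \<Rightarrow> (nat \<Rightarrow> real) \<Rightarrow> nat set" where
  "support p x \<equiv> {j. j < p \<and> x j \<noteq> 0}"

text \<open>The set of signals need not be measurable, since \<open>\<D>\<close> is arbitrary. This predicate defines a measurable set that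
  contains it.\<close>
definition signal_like :: "nat \<Rightarrow> nat \<Rightarrow> real \<Rightarrow> real \<Rightarrow> real \<Rightarrow> (nat \<Rightarrow> real) \<Rightarrow> bool" where
  "signal_like p k m M b x \<longleftrightarrow> card (support p x) = k \<and> (\<Sum>j<p. (x j)\<^sup>2) = b\<^sup>2 \<and>
     (\<forall>j<p. \<bar>x j\<bar> \<le> M \<and> (x j \<noteq> 0 \<longrightarrow> m \<le> \<bar>x j\<bar>))"

lemma signal_like_signals:
  assumes "x \<in> signals p k \<D> b"
  shows "signal_like p k (beta_min \<D>) (beta_sup p k \<D> b) b x"
proof -
  \<comment> \<open>The common norm bounds all entries, so the supremum in \<open>beta_sup\<close>
    is over a bounded set.\<close>
  have b: "\<bar>y j\<bar> \<le> b" if "y \<in> signals p k \<D> b" "j < p" for y j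
    using member_le_L2_set[of "{..<p}" j "\<lambda>j. \<bar>y j\<bar>"] that by (auto simp: signals_def L2_set_def)
  have "bdd_above {\<bar>\<beta> j\<bar> | \<beta> j. \<beta> \<in> signals p k \<D> b \<and> j < p}"
    using b by (intro bdd_aboveI[of _ b]) auto
  then have "\<bar>x j\<bar> \<le> beta_sup p k \<D> b" if "j < p" for j
    unfolding beta_sup_def using assms that by (intro cSup_upper) auto
  moreover have "beta_min \<D> \<le> \<bar>x j\<bar>" if "j < p" "x j \<noteq> 0" for j
    unfolding beta_min_def using assms that by (intro cInf_lower bdd_belowI[of _ 0]) (auto simp: signals_def)
  moreover have "(\<Sum>j<p. (x j)\<^sup>2) = b\<^sup>2"
    using assms by (auto simp: signals_def L2_set_def sum_nonneg)
  ultimately show ?thesis using assms by (auto simp: signal_like_def signals_def)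
qed

lemma measurable_coord: "j < p \<Longrightarrow> (\<lambda>x. x j) \<in> borel_measurable (Rn p)"
  by (intro measurable_component_singleton) auto

lemma sets_signal_like: "{x \<in> space (Rn p). signal_like p k m M b x} \<in> sets (Rn p)"
proof -
  have *: "real (card (support p x)) = (\<Sum>j<p. if x j \<noteq> 0 then 1 else 0)" for x :: "nat \<Rightarrow> real"
    by (subst sum.inter_filter[symmetric]) (auto intro!: arg_cong[where f = card])
  have "signal_like p k m M b x \<longleftrightarrow> (\<Sum>j<p. if x j \<noteq> 0 then 1 else 0) = real k \<and> (\<Sum>j<p. (x j)\<^sup>2) = b\<^sup>2 \<and>
     (\<forall>j\<in>{..<p}. \<bar>x j\<bar> \<le> M \<and> (x j \<noteq> 0 \<longrightarrow> m \<le> \<bar>x j\<bar>))" for x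
    unfolding signal_like_def *[symmetric] by auto
  then show ?thesis
    using measurable_coord[of _ p] by simp
qed

text \<open>Any measurable superset of the signals has mass H / H = 1, where H is the Hausdorff
  measure of the signals; the quotient makes sense because H is positive and finite.\<close>

lemma AE_uniform_on_signal_like:
  assumes u: "uniform_on p (signals p k \<D> b) \<mu>" and "prob_space \<mu>"
  shows "AE x in \<mu>. signal_like p k (beta_min \<D>) (beta_sup p k \<D> b) b x"
proof -
  interpret prob_space \<mu> by fact
  let ?B = "signals p k \<D> b"
  let ?A = "{x \<in> space (Rn p). signal_like p k (beta_min \<D>) (beta_sup p k \<D> b) b x}"
  obtain s where s: "sets \<mu> = sets (Rn p)" "0 < hausdorff_measure p s ?B" "hausdorff_measure p s ?B < \<infinity>"
    and em: "\<And>A. A \<in> sets \<mu> \<Longrightarrow> emeasure \<mu> A = hausdorff_measure p s (A \<inter> ?B) / hausdorff_measure p s ?B"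
    using u by (auto simp: uniform_on_def)
  have A: "?A \<in> sets \<mu>" using sets_signal_like s(1) by simp
  have "?A \<inter> ?B = ?B"
    using signal_like_signals by (auto simp: signals_def)
  then have "emeasure \<mu> ?A = 1"
    using em[OF A] s by (simp add: ennreal_divide_self)
  then have "prob ?A = 1" by (simp add: measure_def)
  from prob_eq_1[OF A] this have "AE x in \<mu>. x \<in> ?A" by blast
  then show ?thesis by eventually_elim simp
qed

section \<open>Inclusion probabilities and overlap of a random support\<close>

context
  fixes p k :: nat and \<D> :: "real set" and b :: real and \<mu> :: "(nat \<Rightarrow> real) measure"
  assumes u: "uniform_on p (signals p k \<D> b) \<mu>" and prob: "prob_space \<mu>"
begin

interpretation prob_space \<mu> by (rule prob)

lemma sets_prior: "sets \<mu> = sets (Rn p)"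
  using u by (simp add: uniform_on_def)

lemma space_prior: "space \<mu> = space (Rn p)"
  by (rule sets_eq_imp_space_eq[OF sets_prior])

definition support_event :: "nat set \<Rightarrow> (nat \<Rightarrow> real) set" where
  "support_event T = {x \<in> space (Rn p). \<forall>j\<in>T. x j \<noteq> 0}"

lemma sets_support_event:
  assumes "T \<subseteq> {..<p}"
  shows "support_event T \<in> sets (Rn p)"
proof -
  have "finite T" using assms finite_subset by blast
  moreover have "(\<lambda>x. x j) \<in> borel_measurable (Rn p)" if "j \<in> T" for j
    using assms that by (intro measurable_coord) auto
  ultimately show ?thesis unfolding support_event_def by measurable
qed

lemma AE_card_support: "AE x in \<mu>. card (support p x) = k"
  using AE_uniform_on_signal_like[OF u prob] by eventually_elim (simp add: signal_like_def)

lemma sparsity_le: "k \<le> p"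
proof (rule ccontr)
  assume "\<not> k \<le> p"
  have "card (support p x) \<le> card {..<p}" for x :: "nat \<Rightarrow> real" by (intro card_mono) auto
  then have "card (support p x) \<noteq> k" for x :: "nat \<Rightarrow> real"
    using \<open>\<not> k \<le> p\<close> by (metis card_lessThan)
  then have "AE x in \<mu>. False" using AE_card_support by simp
  then show False by simp
qed

text \<open>Double counting over the coordinates outside T: by exchangeability all p - |T| of them
  have the same probability of joining T in the support, and exactly k - |T| do. This is the
  recursion of the hypergeometric law.\<close>

lemma prob_support_event_insert:
  assumes "T \<subseteq> {..<p}" "j < p" "j \<notin> T"
  shows "(real p - real (card T)) * prob (support_event (insert j T)) = (real k - real (card T)) * prob (support_event T)"
proof -
  have finT: "finite T" using assms(1) finite_subset by blast
  have ev: "support_event (insert j' T) \<in> sets \<mu>" if "j' < p" for j'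
    using sets_support_event[of "insert j' T"] assms that by (simp add: sets_prior)
  have evT: "support_event T \<in> sets \<mu>"
    using sets_support_event assms by (simp add: sets_prior)
  \<comment> \<open>Exchanging j and j', both outside T, leaves the conditions on T
    untouched.\<close>
  have swap: "prob (support_event (insert j' T)) = prob (support_event (insert j T))" if "j' \<in> {..<p} - T" for j'
  proof -
    have "swap_coords j j' -` support_event (insert j T) \<inter> space (Rn p) = support_event (insert j' T)"
    proof -
      have "(\<forall>l\<in>insert j T. swap_coords j j' x l \<noteq> 0) \<longleftrightarrow> (\<forall>l\<in>insert j' T. x l \<noteq> 0)" for x
        using assms that by (auto simp: swap_coords_def Transposition.transpose_def)
      then show ?thesis
        using swap_coords_space[of j p j'] assms that by (auto simp: support_event_def)
    qed
    moreover have "emeasure \<mu> (swap_coords j j' -` support_event (insert j T) \<inter> space (Rn p)) = emeasure \<mu> (support_event (insert j T))"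
      using assms that by (intro uniform_on_swap_coords[OF u] sets_support_event) auto
    ultimately show ?thesis by (simp add: measure_def)
  qed
  have "(\<Sum>j'\<in>{..<p} - T. prob (support_event (insert j' T))) = (\<Sum>j'\<in>{..<p} - T. \<integral>x. indicator (support_event (insert j' T)) x \<partial>\<mu>)"
    using ev by (intro sum.cong) auto
  also have "\<dots> = (\<integral>x. (\<Sum>j'\<in>{..<p} - T. indicator (support_event (insert j' T)) x) \<partial>\<mu>)"
    using ev by (intro Bochner_Integration.integral_sum[symmetric]) (auto simp: less_top[symmetric])
  \<comment> \<open>If T lies in the support, the sum counts the k - |T| other support points;
    otherwise all its terms vanish.\<close>
  also have "\<dots> = (\<integral>x. (real k - real (card T)) * indicator (support_event T) x \<partial>\<mu>)"
  proof (rule integral_cong_AE)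
    show "(\<lambda>x. \<Sum>j'\<in>{..<p} - T. indicator (support_event (insert j' T)) x :: real) \<in> borel_measurable \<mu>"
      using ev by (intro borel_measurable_sum borel_measurable_indicator) auto
    show "(\<lambda>x. (real k - real (card T)) * indicator (support_event T) x) \<in> borel_measurable \<mu>"
      using evT by measurable
    show "AE x in \<mu>. (\<Sum>j'\<in>{..<p} - T. indicator (support_event (insert j' T)) x) = (real k - real (card T)) * indicator (support_event T) x"
      using AE_card_support
    proof eventually_elim
      case (elim x)
      show ?case
      proof (cases "x \<in> support_event T")
        case True
        then have sub: "T \<subseteq> support p x" using assms(1) by (auto simp: support_event_def)
        have "(\<Sum>j'\<in>{..<p} - T. indicator (support_event (insert j' T)) x :: real) = (\<Sum>j'\<in>{..<p} - T. if x j' \<noteq> 0 then 1 else 0)"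
          using True by (intro sum.cong) (auto simp: support_event_def indicator_def)
        also have "\<dots> = real (card (support p x - T))"
          by (subst sum.inter_filter[symmetric]) (auto intro!: arg_cong[where f = card])
        also have "\<dots> = real k - real (card T)"
          using card_Diff_subset[OF finT sub] card_mono[OF _ sub] elim by (simp add: of_nat_diff)
        finally show ?thesis using True by simp
      next
        case False
        then have "indicator (support_event (insert j' T)) x = (0::real)" for j'
          by (auto simp: support_event_def indicator_def)
        then show ?thesis using False by simp
      qed
    qed
  qed
  also have "\<dots> = (real k - real (card T)) * prob (support_event T)"
    using evT by simp
  also have "(\<Sum>j'\<in>{..<p} - T. prob (support_event (insert j' T))) = (\<Sum>j'\<in>{..<p} - T. prob (support_event (insert j T)))"
    by (intro sum.cong refl swap)
  also have "\<dots> = (real p - real (card T)) * prob (support_event (insert j T))"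
    using card_Diff_subset[OF finT assms(1)] card_mono[OF _ assms(1)] by (simp add: of_nat_diff)
  finally show ?thesis .
qed

text \<open>Sampling without replacement: each further point is included with conditional
  probability at most k / p.\<close>

lemma prob_support_event_le:
  assumes "T \<subseteq> {..<p}"
  shows "prob (support_event T) \<le> (real k / real p) ^ card T"
proof -
  have "finite T" using assms finite_subset by blast
  then show ?thesis using assms
  proof (induction T rule: finite_induct)
    case (insert j T)
    let ?t = "card T"
    have "card (insert j T) \<le> card {..<p}" using insert.prems by (intro card_mono) auto
    then have tp: "?t < p" using insert.hyps by simp
    have "prob (support_event (insert j T)) = (real k - real ?t) / (real p - real ?t) * prob (support_event T)"
      using prob_support_event_insert[of T j] insert.prems insert.hyps tp by (simp add: field_simps)
    also have "\<dots> \<le> real k / real p * prob (support_event T)"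
    proof (rule mult_right_mono)
      \<comment> \<open>From k <= p. The differences are real, so the estimate also covers |T| > k,
        where the left quotient is negative.\<close>
      have "real ?t * real k \<le> real ?t * real p" using sparsity_le by (intro mult_left_mono) auto
      then show "(real k - real ?t) / (real p - real ?t) \<le> real k / real p"
        using tp by (simp add: divide_simps) (simp add: algebra_simps)
    qed simp
    also have "\<dots> \<le> real k / real p * (real k / real p) ^ ?t"
      using insert by (intro mult_left_mono) auto
    finally show ?case using insert.hyps by simp
  qed simp
qed

text \<open>Writing 3 = 1 + 2, the power is a product over S of 1 + 2 [x_j is nonzero], which
  expands over subsets T of S. After bounding the inclusion probabilities by (k / p)^|T|, the same
  expansion read backwards gives the product.\<close>

lemma integral_overlap_le:
  assumes S: "S \<subseteq> {..<p}"
  shows "integrable \<mu> (\<lambda>x. 3 ^ card (support p x \<inter> S) :: real)"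
    and "(\<integral>x. 3 ^ card (support p x \<inter> S) \<partial>\<mu>) \<le> (1 + 2 * real k / real p) ^ card S"
proof -
  have fin: "finite S" using S finite_subset by blast
  have ev: "support_event T \<in> sets \<mu>" if "T \<in> Pow S" for T
    using sets_support_event[of T] S that by (auto simp: sets_prior)
  have eq: "3 ^ card (support p x \<inter> S) = (\<Sum>T\<in>Pow S. 2 ^ card T * indicator (support_event T) x :: real)"
    if x: "x \<in> space \<mu>" for x
  proof -
    have "3 ^ card (support p x \<inter> S) = (\<Prod>j\<in>S. if x j \<noteq> 0 then 3 else 1 :: real)"
    proof -
      have "support p x \<inter> S = {j \<in> S. x j \<noteq> 0}" using S by auto
      then show ?thesis using fin by (simp add: prod.inter_filter[symmetric])
    qed
    also have "\<dots> = (\<Prod>j\<in>S. (if x j \<noteq> 0 then 2 else 0) + 1)"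
      by (intro prod.cong) auto
    also have "\<dots> = (\<Sum>T\<in>Pow S. (\<Prod>j\<in>T. if x j \<noteq> 0 then 2 else 0) * (\<Prod>j\<in>S - T. 1))"
      by (rule prod_add[OF fin])
    also have "\<dots> = (\<Sum>T\<in>Pow S. 2 ^ card T * indicator (support_event T) x)"
    proof (intro sum.cong refl)
      fix T assume T: "T \<in> Pow S"
      then have finT: "finite T" using fin finite_subset by auto
      show "(\<Prod>j\<in>T. if x j \<noteq> 0 then 2 else 0) * (\<Prod>j\<in>S - T. 1) = (2 ^ card T * indicator (support_event T) x :: real)"
      proof (cases "x \<in> support_event T")
        case True
        then have "(\<Prod>j\<in>T. if x j \<noteq> 0 then 2 else 0 :: real) = (\<Prod>j\<in>T. 2)"
          by (intro prod.cong) (auto simp: support_event_def)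
        then show ?thesis using True by simp
      next
        case False
        then obtain j where "j \<in> T" "x j = 0" using x by (auto simp: support_event_def space_prior)
        then have "(\<Prod>j\<in>T. if x j \<noteq> 0 then 2 else 0 :: real) = 0" using finT by (intro prod_zero) auto
        then show ?thesis using False by simp
      qed
    qed
    finally show ?thesis .
  qed
  have int: "integrable \<mu> (\<lambda>x. \<Sum>T\<in>Pow S. 2 ^ card T * indicator (support_event T) x :: real)"
    using ev by (intro Bochner_Integration.integrable_sum integrable_mult_right) (auto simp: less_top[symmetric])
  show "integrable \<mu> (\<lambda>x. 3 ^ card (support p x \<inter> S) :: real)"
    using int by (subst Bochner_Integration.integrable_cong[OF refl eq]) auto
  have "(\<integral>x. 3 ^ card (support p x \<inter> S) \<partial>\<mu>) = (\<integral>x. (\<Sum>T\<in>Pow S. 2 ^ card T * indicator (support_event T) x :: real) \<partial>\<mu>)"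
    by (intro Bochner_Integration.integral_cong refl eq)
  also have "\<dots> = (\<Sum>T\<in>Pow S. 2 ^ card T * prob (support_event T))"
    using ev by (subst Bochner_Integration.integral_sum) (auto intro!: integrable_mult_right sum.cong simp: less_top[symmetric])
  also have "\<dots> \<le> (\<Sum>T\<in>Pow S. 2 ^ card T * (real k / real p) ^ card T)"
    using S by (intro sum_mono mult_left_mono prob_support_event_le) auto
  also have "\<dots> = (\<Sum>T\<in>Pow S. (\<Prod>j\<in>T. 2 * real k / real p) * (\<Prod>j\<in>S - T. 1))"
    by (simp add: power_mult_distrib[symmetric])
  also have "\<dots> = (\<Prod>j\<in>S. 2 * real k / real p + 1)"
    by (rule prod_add[OF fin, symmetric])
  finally show "(\<integral>x. 3 ^ card (support p x \<inter> S) \<partial>\<mu>) \<le> (1 + 2 * real k / real p) ^ card S"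
    by (simp add: add.commute)
qed

end

section \<open>The overlap kernel\<close>

lemma inverse_one_minus_le_exp:
  fixes x :: real
  assumes "0 \<le> x" "x \<le> 1 / 2"
  shows "1 / (1 - x) \<le> exp (2 * x)"
proof -
  have "1 / (1 - x) \<le> 1 + 2 * x"
  proof -
    have "x * (2 * x) \<le> x * 1" using assms by (intro mult_left_mono) auto
    then have "1 \<le> (1 + 2 * x) * (1 - x)" by (simp add: algebra_simps)
    then show ?thesis using assms by (simp add: divide_simps)
  qed
  also have "\<dots> \<le> exp (2 * x)" by (rule exp_ge_add_one_self)
  finally show ?thesis .
qed

lemma sum_even_powers_le:
  fixes x :: real
  assumes "x\<^sup>2 \<le> 1 / 2"
  shows "(\<Sum>e\<in>{e. e \<le> D \<and> even e}. \<bar>x\<bar> ^ e) \<le> exp (2 * x\<^sup>2)"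
proof -
  have "(\<Sum>e\<in>{e. e \<le> D \<and> even e}. \<bar>x\<bar> ^ e) \<le> (\<Sum>e\<in>(\<lambda>m. 2 * m) ` {..<Suc D}. \<bar>x\<bar> ^ e)"
    by (intro sum_mono2) (auto elim!: evenE)
  also have "\<dots> = (\<Sum>m<Suc D. (x\<^sup>2) ^ m)"
    by (subst sum.reindex) (auto simp: inj_on_def power_mult)
  also have "\<dots> \<le> 1 / (1 - x\<^sup>2)"
    using assms by (subst sum_gp_strict) (auto simp: divide_simps)
  also have "\<dots> \<le> exp (2 * x\<^sup>2)"
    using assms by (intro inverse_one_minus_le_exp) auto
  finally show ?thesis .
qed

text \<open>Damping by \<open>\<theta>\<close> trades the constraint on the total degree for a factor \<open>\<theta>\<close> to the power \<open>-D\<close>, after which the sum factorizes.\<close>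
lemma even_degrees_sum_le:
  fixes r \<theta> :: real
  assumes \<theta>: "0 < \<theta>" "\<theta> \<le> 1" and r: "(\<theta> * r)\<^sup>2 \<le> 1 / 2"
  shows "(\<Sum>b\<in>even_degrees n D. \<Prod>i<n. r ^ b i) \<le> (1 / \<theta>) ^ D * exp (2 * real n * (\<theta> * r)\<^sup>2)"
proof -
  have "(\<Sum>b\<in>even_degrees n D. \<Prod>i<n. r ^ b i) \<le> (\<Sum>b\<in>even_degrees n D. (1 / \<theta>) ^ D * (\<Prod>i<n. \<bar>\<theta> * r\<bar> ^ b i))"
  proof (rule sum_mono)
    fix b assume b: "b \<in> even_degrees n D"
    have "(\<Prod>i<n. r ^ b i) \<le> (\<Prod>i<n. \<bar>r\<bar> ^ b i)"
      by (rule order_trans[OF abs_ge_self]) (simp add: abs_prod power_abs)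
    also have "\<dots> \<le> (1 / \<theta>) ^ D * \<theta> ^ (\<Sum>i<n. b i) * (\<Prod>i<n. \<bar>r\<bar> ^ b i)"
    proof -
      have "\<theta> ^ D \<le> \<theta> ^ (\<Sum>i<n. b i)"
        using b \<theta> by (intro power_decreasing) (auto simp: even_degrees_def)
      then have "1 \<le> (1 / \<theta>) ^ D * \<theta> ^ (\<Sum>i<n. b i)"
        using \<theta> by (simp add: power_divide divide_simps)
      then have "1 * (\<Prod>i<n. \<bar>r\<bar> ^ b i) \<le> (1 / \<theta>) ^ D * \<theta> ^ (\<Sum>i<n. b i) * (\<Prod>i<n. \<bar>r\<bar> ^ b i)"
        by (intro mult_right_mono prod_nonneg) auto
      then show ?thesis by simp
    qed
    also have "\<theta> ^ (\<Sum>i<n. b i) = (\<Prod>i<n. \<theta> ^ b i)" by (rule power_sum)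
    finally show "(\<Prod>i<n. r ^ b i) \<le> (1 / \<theta>) ^ D * (\<Prod>i<n. \<bar>\<theta> * r\<bar> ^ b i)"
      using \<theta> by (simp add: abs_mult power_mult_distrib prod.distrib mult.assoc)
  qed
  also have "\<dots> = (1 / \<theta>) ^ D * (\<Sum>b\<in>even_degrees n D. \<Prod>i<n. \<bar>\<theta> * r\<bar> ^ b i)"
    by (rule sum_distrib_left[symmetric])
  also have "(\<Sum>b\<in>even_degrees n D. \<Prod>i<n. \<bar>\<theta> * r\<bar> ^ b i) \<le> (\<Sum>b\<in>Pi\<^sub>E {..<n} (\<lambda>_. {e. e \<le> D \<and> even e}). \<Prod>i<n. \<bar>\<theta> * r\<bar> ^ b i)"
    by (intro sum_mono2 finite_PiE prod_nonneg) (auto simp: even_degrees_def PiE_iff extensional_def)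
  also have "\<dots> = (\<Prod>i<n. \<Sum>e\<in>{e. e \<le> D \<and> even e}. \<bar>\<theta> * r\<bar> ^ e)"
    by (intro prod_sum_PiE[symmetric]) auto
  also have "\<dots> \<le> (\<Prod>i<n. exp (2 * (\<theta> * r)\<^sup>2))"
    by (intro prod_mono conjI sum_nonneg sum_even_powers_le r) auto
  also have "\<dots> = exp (2 * real n * (\<theta> * r)\<^sup>2)"
    by (simp add: exp_of_nat_mult[symmetric] mult_ac)
  finally show ?thesis using \<theta> by (simp add: mult_left_mono)
qed

text \<open>The normalized inner product satisfies |r| <= 1 and |r| <= C^2 (l / k) SNR / (SNR + 1),
  so n r^2 \<Delta> <= C^4 l^2. For small l the second bound suffices without using the degree; for
  large l the degree bound takes over. The threshold \<Delta> / (2 C^4) serves both cases.\<close>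

lemma signal_kernel_le:
  fixes C \<sigma> b m M \<Delta> :: real
  assumes x: "signal_like p k m M b x" and y: "signal_like p k m M b y"
    and m: "m > 0" and C: "C \<ge> 1" "M \<le> C * m" and k: "k \<ge> 1" and n: "n \<ge> 1" and \<sigma>: "\<sigma> > 0"
    and SNR: "SNR = b\<^sup>2 / \<sigma>\<^sup>2"
    and \<Delta>: "\<Delta> > 0" "real n * SNR\<^sup>2 * \<Delta> \<le> (real k)\<^sup>2 * (SNR + 1)\<^sup>2" "\<Delta> \<le> real n"
    and D: "real D * ln (real n + 1) \<le> \<Delta> / (2 * C ^ 4)"
  shows "signal_kernel n p D SNR (\<lambda>j\<in>{..<p}. x j / \<sigma>) (\<lambda>j\<in>{..<p}. y j / \<sigma>) \<le> exp 1 * 3 ^ card (support p x \<inter> support p y)"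
proof -
  define l where "l = card (support p x \<inter> support p y)"
  define t where "t = (\<Sum>j<p. x j * y j)"
  define r where "r = t / \<sigma>\<^sup>2 / (SNR + 1)"
  have SNR0: "SNR \<ge> 0" using SNR by simp
  have kernel: "signal_kernel n p D SNR (\<lambda>j\<in>{..<p}. x j / \<sigma>) (\<lambda>j\<in>{..<p}. y j / \<sigma>) = (\<Sum>d\<in>even_degrees n D. \<Prod>i<n. r ^ d i)"
    unfolding signal_kernel_def r_def t_def by (simp add: power2_eq_square sum_divide_distrib)
  have xs: "(\<Sum>j<p. (x j)\<^sup>2) = b\<^sup>2" "card (support p x) = k" "\<And>j. j < p \<Longrightarrow> \<bar>x j\<bar> \<le> M" "\<And>j. j < p \<Longrightarrow> x j \<noteq> 0 \<Longrightarrow> m \<le> \<bar>x j\<bar>"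
    and ys: "(\<Sum>j<p. (y j)\<^sup>2) = b\<^sup>2" "\<And>j. j < p \<Longrightarrow> \<bar>y j\<bar> \<le> M"
    using x y by (auto simp: signal_like_def)
  \<comment> \<open>Nonzero entries are at least m in absolute value, so the overlap bound l (C m)^2
    becomes a fraction C^2 l / k of the squared norm.\<close>
  have b: "real k * m\<^sup>2 \<le> b\<^sup>2"
  proof -
    have "real k * m\<^sup>2 = (\<Sum>j\<in>support p x. m\<^sup>2)" using xs(2) by simp
    also have "\<dots> \<le> (\<Sum>j\<in>support p x. (x j)\<^sup>2)"
    proof (rule sum_mono)
      fix j assume "j \<in> support p x"
      then have "m \<le> \<bar>x j\<bar>" using xs(4) by auto
      then show "m\<^sup>2 \<le> (x j)\<^sup>2" using m by (metis abs_le_square_iff abs_of_pos)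
    qed
    also have "\<dots> \<le> (\<Sum>j<p. (x j)\<^sup>2)" by (intro sum_mono2) auto
    finally show ?thesis using xs(1) by simp
  qed
  have b0: "b\<^sup>2 > 0"
  proof -
    have "0 < real k * m\<^sup>2" using m k by (intro mult_pos_pos) auto
    then show ?thesis using b by linarith
  qed
  have t1: "t\<^sup>2 \<le> (b\<^sup>2)\<^sup>2"
    using Cauchy_Schwarz_ineq_sum[of x y "{..<p}"] xs(1) ys(1) by (simp add: t_def power2_eq_square)
  have t2: "\<bar>t\<bar> \<le> real l * (C * m)\<^sup>2"
  proof -
    have "\<bar>t\<bar> \<le> (\<Sum>j<p. \<bar>x j * y j\<bar>)" unfolding t_def by (rule sum_abs)
    also have "\<dots> = (\<Sum>j\<in>support p x \<inter> support p y. \<bar>x j * y j\<bar>)"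
      by (intro sum.mono_neutral_right) auto
    also have "\<dots> \<le> (\<Sum>j\<in>support p x \<inter> support p y. (C * m)\<^sup>2)"
    proof (rule sum_mono)
      fix j assume "j \<in> support p x \<inter> support p y"
      then have "\<bar>x j\<bar> \<le> C * m" "\<bar>y j\<bar> \<le> C * m" using xs(3)[of j] ys(2)[of j] C by auto
      then show "\<bar>x j * y j\<bar> \<le> (C * m)\<^sup>2"
        unfolding abs_mult power2_eq_square by (intro mult_mono) auto
    qed
    finally show ?thesis by (simp add: l_def)
  qed
  have sb: "\<sigma>\<^sup>2 * (SNR + 1) = b\<^sup>2 + \<sigma>\<^sup>2" "\<sigma>\<^sup>2 * SNR = b\<^sup>2"
    using SNR \<sigma> by (auto simp: field_simps)
  have r: "r = t / (b\<^sup>2 + \<sigma>\<^sup>2)" unfolding r_def sb(1)[symmetric] by simp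
  have r1: "r\<^sup>2 \<le> 1"
  proof -
    have "t\<^sup>2 \<le> (b\<^sup>2 + \<sigma>\<^sup>2)\<^sup>2" using t1 by (rule order_trans) (intro power_mono, auto)
    then show ?thesis unfolding r using b0 by (simp add: power_divide divide_simps)
  qed
  \<comment> \<open>The second bound on |r|, squared and combined with the upper bound on \<Delta>;
    a positive SNR can be cancelled.\<close>
  have r2: "real n * r\<^sup>2 * \<Delta> \<le> C ^ 4 * (real l)\<^sup>2"
  proof -
    have "real k * \<bar>r\<bar> * (SNR + 1) \<le> SNR * real l * C\<^sup>2"
    proof -
      have "real k * \<bar>t\<bar> \<le> real k * (real l * (C * m)\<^sup>2)"
        using t2 by (intro mult_left_mono) auto
      also have "\<dots> = real l * C\<^sup>2 * (real k * m\<^sup>2)" by (simp add: power_mult_distrib mult_ac)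
      also have "\<dots> \<le> real l * C\<^sup>2 * b\<^sup>2" using b by (intro mult_left_mono) auto
      finally have "real k * \<bar>t\<bar> / \<sigma>\<^sup>2 \<le> real l * C\<^sup>2 * SNR"
        using \<sigma> by (simp add: SNR divide_right_mono)
      moreover have "\<bar>r\<bar> * (SNR + 1) = \<bar>t\<bar> / \<sigma>\<^sup>2"
        using SNR0 by (simp add: r_def abs_div)
      then have "real k * \<bar>r\<bar> * (SNR + 1) = real k * \<bar>t\<bar> / \<sigma>\<^sup>2"
        by (simp only: mult.assoc times_divide_eq_right)
      ultimately show ?thesis by (simp add: mult_ac)
    qed
    then have "(real k * \<bar>r\<bar> * (SNR + 1))\<^sup>2 \<le> (SNR * real l * C\<^sup>2)\<^sup>2"
      using SNR0 by (intro power_mono) auto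
    then have le: "((real k)\<^sup>2 * (SNR + 1)\<^sup>2) * r\<^sup>2 \<le> SNR\<^sup>2 * (C ^ 4 * (real l)\<^sup>2)"
      by (simp add: power_mult_distrib mult_ac flip: power_mult)
    have "(real n * SNR\<^sup>2 * \<Delta>) * r\<^sup>2 \<le> ((real k)\<^sup>2 * (SNR + 1)\<^sup>2) * r\<^sup>2"
      using \<Delta>(2) by (intro mult_right_mono) auto
    with le have "SNR\<^sup>2 * (real n * r\<^sup>2 * \<Delta>) \<le> SNR\<^sup>2 * (C ^ 4 * (real l)\<^sup>2)"
      by (simp add: mult_ac)
    moreover have "SNR\<^sup>2 > 0" using SNR b0 \<sigma> by simp
    ultimately show ?thesis by simp
  qed
  have C4: "C ^ 4 \<ge> 1" using C by simp
  \<comment> \<open>e is rounded up to 3 = 1 + 2, the form expanded in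
    \<open>integral_overlap_le\<close>.\<close>
  have e3: "exp (real l) \<le> 3 ^ l"
    using power_mono[OF exp_le, of l] by (simp add: exp_of_nat_mult[symmetric])
  have "(\<Sum>d\<in>even_degrees n D. \<Prod>i<n. r ^ d i) \<le> exp 1 * exp (real l)"
  proof (cases "real l \<le> \<Delta> / (2 * C ^ 4)")
    \<comment> \<open>Small overlap: no damping, that is \<theta> = 1. The bound \<Delta> <= n
      ensures r^2 <= 1/2, which the geometric series needs.\<close>
    case True
    moreover have "0 < 2 * C ^ 4" using C by simp
    ultimately have lD: "2 * C ^ 4 * real l \<le> \<Delta>" by (simp only: pos_le_divide_eq mult.commute)
    have n2: "2 * real n * r\<^sup>2 \<le> real l"
    proof -
      have "2 * real n * r\<^sup>2 * \<Delta> \<le> (2 * C ^ 4 * real l) * real l"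
        using r2 by (simp add: power2_eq_square mult_ac)
      also have "\<dots> \<le> \<Delta> * real l" using lD by (intro mult_right_mono) auto
      finally show ?thesis using \<Delta>(1) by simp
    qed
    have "real n * (2 * r\<^sup>2) \<le> real n * 1"
    proof -
      have "real l \<le> C ^ 4 * real l" using C4 by (simp add: mult_le_cancel_right1)
      also have "\<dots> \<le> \<Delta>"
      proof -
        have "0 \<le> C ^ 4 * real l" using C by simp
        then show ?thesis using lD by linarith
      qed
      finally show ?thesis using n2 \<Delta>(3) by simp
    qed
    then have "r\<^sup>2 \<le> 1 / 2" using n by simp
    then have "(\<Sum>d\<in>even_degrees n D. \<Prod>i<n. r ^ d i) \<le> exp (2 * real n * r\<^sup>2)"
      using even_degrees_sum_le[of 1 r n D] by simp
    also have "\<dots> \<le> exp (real l)" using n2 by simp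
    also have "\<dots> \<le> exp 1 * exp (real l)" by simp
    finally show ?thesis .
  next
    \<comment> \<open>Large overlap: only |r| <= 1 is available. Damping by 1 / (n + 1) makes the
      factorized sum at most e, and its price (n + 1)^D is at most e^l by the assumption on
      D.\<close>
    case False
    define \<theta> where "\<theta> = 1 / (real n + 1)"
    have \<theta>: "0 < \<theta>" "\<theta> \<le> 1" by (auto simp: \<theta>_def)
    have n\<theta>: "2 * real n * \<theta>\<^sup>2 \<le> 1"
      unfolding \<theta>_def by (simp add: power_divide divide_simps) (simp add: power2_eq_square algebra_simps)
    have \<theta>r: "(\<theta> * r)\<^sup>2 \<le> \<theta>\<^sup>2"
      using r1 by (simp add: power_mult_distrib mult_left_le)
    have "2 * \<theta>\<^sup>2 \<le> 2 * real n * \<theta>\<^sup>2" using n by (intro mult_right_mono) auto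
    then have "\<theta>\<^sup>2 \<le> 1 / 2" using n\<theta> by simp
    with \<theta>r have "(\<theta> * r)\<^sup>2 \<le> 1 / 2" by linarith
    from even_degrees_sum_le[OF \<theta> this, of n D]
    have "(\<Sum>d\<in>even_degrees n D. \<Prod>i<n. r ^ d i) \<le> (1 / \<theta>) ^ D * exp (2 * real n * (\<theta> * r)\<^sup>2)" .
    also have "\<dots> \<le> exp (real l) * exp 1"
    proof (intro mult_mono)
      have "(1 / \<theta>) ^ D = exp (real D * ln (real n + 1))"
        by (simp add: \<theta>_def exp_of_nat_mult)
      also have "\<dots> \<le> exp (real l)" using D False by simp
      finally show "(1 / \<theta>) ^ D \<le> exp (real l)" .
      have "2 * real n * (\<theta> * r)\<^sup>2 \<le> 2 * real n * \<theta>\<^sup>2" using \<theta>r by (intro mult_left_mono) auto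
      then show "exp (2 * real n * (\<theta> * r)\<^sup>2) \<le> exp 1" using n\<theta> by simp
    qed auto
    finally show ?thesis by (simp add: mult.commute)
  qed
  also have "\<dots> \<le> exp 1 * 3 ^ l" using e3 by (intro mult_left_mono) auto
  finally show ?thesis unfolding kernel l_def .
qed

lemma measurable_rescale: "(\<lambda>x. \<lambda>j\<in>{..<p}. x j / \<sigma>) \<in> measurable (Rn p) (Rn p)"
  by (intro measurable_restrict borel_measurable_divide borel_measurable_const measurable_coord) auto

text \<open>The nonasymptotic statement for one problem. Since the second signal is minus the first,
  the mixture is over the first marginal alone. Averaging over one signal with the other fixed
  reduces the overlap to a fixed set S of size k.\<close>

lemma mslr_low_degree_bound:
  fixes C \<sigma> b \<Delta> :: real
  assumes prior: "signal_prior p k \<D> b \<mu>" and anti: "antisymmetric_pairs p \<mu>"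
    and m: "beta_min \<D> > 0" and C: "C \<ge> 1" "beta_sup p k \<D> b \<le> C * beta_min \<D>"
    and k: "k \<ge> 1" and n: "n \<ge> 1" and \<sigma>: "\<sigma> > 0"
    and SNR: "SNR = snr b \<sigma>" "SNR > 0"
    and \<Delta>: "\<Delta> > 0" "real n * SNR\<^sup>2 * \<Delta> \<le> (real k)\<^sup>2 * (SNR + 1)\<^sup>2" "\<Delta> \<le> real n"
    and D: "real D * ln (real n + 1) \<le> \<Delta> / (2 * C ^ 4)"
  defines "P \<equiv> mslr_alternative n p (1/2) \<sigma> \<mu>" and "Q \<equiv> mslr_null n p b \<sigma>"
  shows "testing_pair (data_dim n p) P Q"
    and "chi2_low_degree (data_dim n p) D P Q \<le> exp 1 * exp (2 * ((real k)\<^sup>2 / real p)) - 1"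
proof -
  define \<mu>1 where "\<mu>1 = distr \<mu> (Rn p) fst"
  let ?sc = "\<lambda>x. \<lambda>j\<in>{..<p}. x j / \<sigma>"
  define \<nu> where "\<nu> = distr \<mu>1 (Rn p) ?sc"
  have \<mu>: "prob_space \<mu>" "sets \<mu> = sets (Rn p \<Otimes>\<^sub>M Rn p)" and u: "uniform_on p (signals p k \<D> b) \<mu>1"
    using prior by (auto simp: signal_prior_def \<mu>1_def)
  have mfst: "fst \<in> measurable \<mu> (Rn p)"
    by (subst measurable_cong_sets[OF \<mu>(2) refl]) (rule measurable_fst)
  have \<mu>1: "prob_space \<mu>1" unfolding \<mu>1_def by (rule prob_space.prob_space_distr[OF \<mu>(1) mfst])
  interpret \<mu>1: prob_space \<mu>1 by (rule \<mu>1)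
  have s\<mu>1: "sets \<mu>1 = sets (Rn p)" by (simp add: \<mu>1_def)
  have sc: "?sc \<in> measurable \<mu>1 (Rn p)"
    unfolding measurable_cong_sets[OF s\<mu>1 refl] by (rule measurable_rescale)
  have \<nu>_eq: "\<nu> = distr \<mu> (Rn p) (\<lambda>\<beta>. \<lambda>j\<in>{..<p}. fst \<beta> j / \<sigma>)"
    unfolding \<nu>_def \<mu>1_def by (subst distr_distr[OF measurable_rescale mfst]) (simp add: comp_def)
  have \<nu>: "prob_space \<nu>" "sets \<nu> = sets (Rn p)"
    unfolding \<nu>_def using \<mu>1.prob_space_distr[OF sc] by auto
  have AE: "AE x in \<mu>1. signal_like p k (beta_min \<D>) (beta_sup p k \<D> b) b x"
    by (rule AE_uniform_on_signal_like[OF u \<mu>1])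
  have norm: "AE v in \<nu>. (\<Sum>j<p. (v j)\<^sup>2) = SNR"
  proof -
    have "{v \<in> space (Rn p). (\<Sum>j<p. (v j)\<^sup>2) = SNR} \<in> sets (Rn p)"
      using measurable_coord[of _ p] by measurable
    moreover have "AE x in \<mu>1. (\<Sum>j<p. (?sc x j)\<^sup>2) = SNR"
      using AE by eventually_elim (simp add: signal_like_def SNR snr_def power_divide sum_divide_distrib[symmetric])
    ultimately show ?thesis unfolding \<nu>_def by (subst AE_distr_iff[OF sc]) auto
  qed
  have Q: "Q = null_law n p (SNR + 1)" unfolding Q_def mslr_null_eq SNR ..
  have P: "P = density Q (\<lambda>v. \<integral>\<^sup>+u. ennreal (lr_given n p SNR u v) \<partial>\<nu>)"
    unfolding P_def Q \<nu>_eq using SNR(2) by (intro mslr_alternative_eq \<mu> anti) simp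
  have probP: "prob_space P" unfolding P_def by (rule prob_space_mslr_alternative[OF \<mu>])
  show "testing_pair (data_dim n p) P Q"
    unfolding data_dim_def by (rule testing_pair_mixture[OF SNR(2) \<nu> norm Q probP P])
  have "\<mu>1.expectation (\<lambda>x. \<integral>v. signal_kernel n p D SNR (?sc x) v \<partial>\<nu>) \<le> \<mu>1.expectation (\<lambda>_. exp 1 * exp (2 * ((real k)\<^sup>2 / real p)))"
  proof (rule integral_mono_AE')
    show "AE x in \<mu>1. (\<integral>v. signal_kernel n p D SNR (?sc x) v \<partial>\<nu>) \<le> exp 1 * exp (2 * ((real k)\<^sup>2 / real p))"
      using AE
    proof eventually_elim
      case x: (elim x)
      let ?S = "support p x"
      have mk: "signal_kernel n p D SNR (?sc x) \<in> borel_measurable (Rn p)"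
        unfolding signal_kernel_def
        by (intro borel_measurable_sum borel_measurable_prod borel_measurable_power borel_measurable_divide borel_measurable_times
            borel_measurable_const measurable_coord) auto
      have "(\<integral>v. signal_kernel n p D SNR (?sc x) v \<partial>\<nu>) = (\<integral>y. signal_kernel n p D SNR (?sc x) (?sc y) \<partial>\<mu>1)"
        unfolding \<nu>_def by (rule integral_distr[OF sc mk])
      also have "\<dots> \<le> (\<integral>y. exp 1 * (3::real) ^ card (support p y \<inter> ?S) \<partial>\<mu>1)"
      proof (rule integral_mono_AE')
        show "integrable \<mu>1 (\<lambda>y. exp 1 * (3::real) ^ card (support p y \<inter> ?S))"
          by (intro integrable_mult_right integral_overlap_le(1)[OF u \<mu>1]) auto
        show "AE y in \<mu>1. signal_kernel n p D SNR (?sc x) (?sc y) \<le> exp 1 * (3::real) ^ card (support p y \<inter> ?S)"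
          using AE
        proof eventually_elim
          case (elim y)
          show ?case
            using signal_kernel_le[OF x elim m C k n \<sigma> SNR(1)[unfolded snr_def] \<Delta> D] by (simp add: Int_commute)
        qed
      qed auto
      also have "\<dots> = exp 1 * (\<integral>y. (3::real) ^ card (support p y \<inter> ?S) \<partial>\<mu>1)" by simp
      \<comment> \<open>The power k from the size of the fixed support turns 2 k / p into 2 k^2 / p,
        which is bounded exactly in the regime k = O(sqrt p).\<close>
      also have "\<dots> \<le> exp 1 * (1 + 2 * real k / real p) ^ card ?S"
        by (intro mult_left_mono integral_overlap_le(2)[OF u \<mu>1]) auto
      also have "\<dots> \<le> exp 1 * exp (2 * real k / real p) ^ card ?S"
        by (intro mult_left_mono power_mono exp_ge_add_one_self) auto
      also have "exp (2 * real k / real p) ^ card ?S = exp (2 * ((real k)\<^sup>2 / real p))"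
        using x by (simp add: signal_like_def exp_of_nat_mult[symmetric] power2_eq_square)
      finally show ?case .
    qed
  qed auto
  then have "\<mu>1.expectation (\<lambda>x. \<integral>v. signal_kernel n p D SNR (?sc x) v \<partial>\<nu>) \<le> exp 1 * exp (2 * ((real k)\<^sup>2 / real p))"
    by (simp add: \<mu>1.prob_space)
  moreover have "(\<integral>u. \<integral>v. signal_kernel n p D SNR u v \<partial>\<nu> \<partial>\<nu>) = \<mu>1.expectation (\<lambda>x. \<integral>v. signal_kernel n p D SNR (?sc x) v \<partial>\<nu>)"
  proof -
    interpret \<nu>: prob_space \<nu> by (rule \<nu>)
    have c: "(\<lambda>v. v j) \<in> borel_measurable \<nu>" if "j < p" for j
      unfolding measurable_cong_sets[OF \<nu>(2) refl] using that by (rule measurable_coord)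
    have [measurable]: "(\<lambda>(u, v). signal_kernel n p D SNR u v) \<in> borel_measurable (Rn p \<Otimes>\<^sub>M \<nu>)"
      unfolding signal_kernel_def case_prod_unfold
      by (intro borel_measurable_sum borel_measurable_prod borel_measurable_power borel_measurable_divide borel_measurable_times
            measurable_compose[OF measurable_fst measurable_coord] measurable_compose[OF measurable_snd c]
            borel_measurable_const) auto
    have "(\<lambda>u. \<integral>v. signal_kernel n p D SNR u v \<partial>\<nu>) \<in> borel_measurable (Rn p)" by measurable
    from integral_distr[OF sc this] show ?thesis by (simp add: \<nu>_def)
  qed
  moreover have "chi2_low_degree (data_dim n p) D P Q \<le> (\<integral>u. \<integral>v. signal_kernel n p D SNR u v \<partial>\<nu> \<partial>\<nu>) - 1"
    unfolding data_dim_def by (rule chi2_low_degree_le[OF SNR(2) \<nu> norm Q probP P])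
  ultimately show "chi2_low_degree (data_dim n p) D P Q \<le> exp 1 * exp (2 * ((real k)\<^sup>2 / real p)) - 1"
    by linarith
qed

section \<open>Running time\<close>

lemma runs_in_time_pos: "runs_in_time A N T \<Longrightarrow> T \<ge> 1"
proof -
  assume "runs_in_time A N T"
  then have "\<exists>t. length A + t < T" unfolding runs_in_time_def by blast
  then show "T \<ge> 1" by auto
qed

lemma half_le_nat_floor:
  fixes x :: real
  assumes "x \<ge> 2"
  shows "x / 2 \<le> real (nat \<lfloor>x\<rfloor>)"
proof -
  have "real (nat \<lfloor>x\<rfloor>) = of_int \<lfloor>x\<rfloor>" using assms by (intro of_nat_nat) simp
  then show ?thesis using assms by linarith
qed

lemma detectable_in_time_subseq:
  assumes "detectable_in_time N P Q T" "strict_mono r"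
  shows "detectable_in_time (\<lambda>i. N (r i)) (\<lambda>i. P (r i)) (\<lambda>i. Q (r i)) (\<lambda>i. T (r i))"
proof -
  obtain A where A: "\<And>i. runs_in_time (A i) (N i) (T i)"
    and P: "(\<lambda>i. accept_prob (A i) (N i) (P i)) \<longlonglongrightarrow> 1"
    and Q: "(\<lambda>i. accept_prob (A i) (N i) (Q i)) \<longlonglongrightarrow> 0"
    using assms(1) by (auto simp: detectable_in_time_def strongly_detects_def)
  show ?thesis
    unfolding detectable_in_time_def strongly_detects_def
    using A LIMSEQ_subseq_LIMSEQ[OF P assms(2)] LIMSEQ_subseq_LIMSEQ[OF Q assms(2)]
    by (intro exI[of _ "\<lambda>i. A (r i)"]) (simp add: comp_def)
qed

lemma requires_exp_timeI:
  assumes "\<And>T. detectable_in_time N P Q T \<Longrightarrow>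
      \<exists>c>0. \<exists>C::nat. \<exists>K. eventually (\<lambda>i. exp (c * D i / ln (real (N i)) ^ C) \<le> K * real (T i)) sequentially"
  shows "requires_exp_time N P Q D"
  unfolding requires_exp_time_def
proof (intro allI impI)
  fix T assume T: "detectable_in_time N P Q T"
  then obtain c C K where c: "c > 0"
    and ev: "eventually (\<lambda>i. exp (c * D i / ln (real (N i)) ^ C) \<le> K * real (T i)) sequentially"
    using assms by blast
  have "(\<lambda>i. exp (c * D i / ln (real (N i)) ^ C)) \<in> O(\<lambda>i. real (T i))"
    using ev by (intro bigoI[of _ K]) simp
  then have "(\<lambda>i. real (T i)) \<in> \<Omega>(\<lambda>i. exp (c * D i / ln (real (N i)) ^ C))"
    by (simp add: bigomega_iff_bigo)
  then show "\<exists>c>0. \<exists>C. (\<lambda>i. real (T i)) \<in> \<Omega>(\<lambda>i. exp (c * D i / ln (real (N i)) ^ C))"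
    using c by blast
qed

text \<open>Indices with a large exponent are enumerated as a subsequence, which supplies the
  constants; at all other indices the claimed bound is a constant once four more logarithms are
  hidden. The parameter \<open>m0\<close> lets \<open>sub\<close> rely on facts that hold only
  eventually.\<close>

lemma requires_exp_time_split:
  fixes N :: "nat \<Rightarrow> nat" and \<Delta> :: "nat \<Rightarrow> real"
  assumes N: "eventually (\<lambda>m. ln (real (N m)) \<ge> 2) sequentially"
    and sub: "\<And>r. strict_mono r \<Longrightarrow> (\<And>i. \<Delta> (r i) > ln (real (N (r i))) ^ 4) \<Longrightarrow> (\<And>i. r i \<ge> m0) \<Longrightarrow>
      requires_exp_time (\<lambda>i. N (r i)) (\<lambda>i. P (r i)) (\<lambda>i. Q (r i)) (\<lambda>i. real (nat \<lfloor>\<Delta> (r i) / ln (real (N (r i))) ^ 2\<rfloor>))"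
  shows "requires_exp_time N P Q \<Delta>"
proof (rule requires_exp_timeI)
  fix T assume T: "detectable_in_time N P Q T"
  \<comment> \<open>The strict inequality in \<open>runs_in_time\<close> makes T positive, which is
    all that a constant lower bound asks for.\<close>
  then have T1: "real (T i) \<ge> 1" for i
    using runs_in_time_pos by (fastforce simp: detectable_in_time_def)
  define S where "S = {m. m \<ge> m0 \<and> \<Delta> m > ln (real (N m)) ^ 4}"
  \<comment> \<open>Four hidden logarithms bring an exponent of at most (ln N)^4 down to the
    constant c.\<close>
  have small: "exp (c * \<Delta> m / ln (real (N m)) ^ (C + 4)) \<le> exp c * real (T m)"
    if "\<Delta> m \<le> ln (real (N m)) ^ 4" "ln (real (N m)) \<ge> 2" "c > 0" for m c and C :: nat
  proof -
    let ?L = "ln (real (N m))"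
    have "?L ^ 4 \<le> ?L ^ (C + 4)" using that(2) by (intro power_increasing) auto
    then have "\<Delta> m \<le> ?L ^ (C + 4)" using that(1) by linarith
    then have "c * \<Delta> m \<le> c * ?L ^ (C + 4)" using that(3) by (intro mult_left_mono) auto
    then have "c * \<Delta> m / ?L ^ (C + 4) \<le> c" using that(2) by (simp add: divide_simps)
    then have "exp (c * \<Delta> m / ?L ^ (C + 4)) \<le> exp c * 1" by simp
    also have "\<dots> \<le> exp c * real (T m)" using T1 by (intro mult_left_mono) auto
    finally show ?thesis .
  qed
  show "\<exists>c>0. \<exists>C::nat. \<exists>K. eventually (\<lambda>i. exp (c * \<Delta> i / ln (real (N i)) ^ C) \<le> K * real (T i)) sequentially"
  proof (cases "finite S")
    \<comment> \<open>There is no subsequence to pass to; the constant bound holds from some index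
      on.\<close>
    case True
    have "eventually (\<lambda>m. m \<notin> S) sequentially"
      using True by (simp add: cofinite_eq_sequentially[symmetric] eventually_cofinite)
    then have "eventually (\<lambda>m. exp (1 * \<Delta> m / ln (real (N m)) ^ (0 + 4)) \<le> exp 1 * real (T m)) sequentially"
      using N eventually_ge_at_top[of m0]
    proof eventually_elim
      case (elim m)
      then show ?case by (intro small) (auto simp: S_def)
    qed
    then show ?thesis by (intro exI[of _ 1] exI[of _ "0 + 4"] exI[of _ "exp 1"] conjI) auto
  next
    case inf: False
    define r where "r = enumerate S"
    have r: "strict_mono r" unfolding r_def by (rule strict_mono_enumerate[OF inf])
    have rS: "r i \<in> S" for i unfolding r_def by (rule enumerate_in_set[OF inf])
    let ?D = "\<lambda>m. real (nat \<lfloor>\<Delta> m / ln (real (N m)) ^ 2\<rfloor>)"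
    have "requires_exp_time (\<lambda>i. N (r i)) (\<lambda>i. P (r i)) (\<lambda>i. Q (r i)) (\<lambda>i. ?D (r i))"
      by (rule sub[OF r]) (use rS in \<open>auto simp: S_def\<close>)
    from this[unfolded requires_exp_time_def, rule_format, OF detectable_in_time_subseq[OF T r]]
    obtain c C where c: "c > 0" and Om: "(\<lambda>i. real (T (r i))) \<in> \<Omega>(\<lambda>i. exp (c * ?D (r i) / ln (real (N (r i))) ^ C))"
      by blast
    then have "(\<lambda>i. exp (c * ?D (r i) / ln (real (N (r i))) ^ C)) \<in> O(\<lambda>i. real (T (r i)))"
      by (simp add: bigomega_iff_bigo)
    then obtain K where K: "K > 0" and "eventually (\<lambda>i. exp (c * ?D (r i) / ln (real (N (r i))) ^ C) \<le> K * real (T (r i))) sequentially"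
      by (auto elim!: landau_o.bigE)
    then obtain i0 where i0: "\<And>i. i \<ge> i0 \<Longrightarrow> exp (c * ?D (r i) / ln (real (N (r i))) ^ C) \<le> K * real (T (r i))"
      by (auto simp: eventually_sequentially)
    \<comment> \<open>c is halved for the rounding in \<open>?D\<close>. On \<open>S\<close> two of
      the extra logarithms undo the division in \<open>?D\<close>; off \<open>S\<close> all four are
      used. Members of \<open>S\<close> beyond \<open>r i0\<close> have positions at least
      \<open>i0\<close> in the enumeration.\<close>
    have "eventually (\<lambda>m. exp (c / 2 * \<Delta> m / ln (real (N m)) ^ (C + 4)) \<le> max K (exp (c / 2)) * real (T m)) sequentially"
      using N eventually_ge_at_top[of "max m0 (r i0)"]
    proof eventually_elim
      case (elim m)
      let ?L = "ln (real (N m))"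
      show ?case
      proof (cases "m \<in> S")
        case True
        then obtain i where i: "m = r i" unfolding r_def using enumerate_Ex[OF inf True] by auto
        then have "i \<ge> i0" using elim r by (metis max.bounded_iff strict_mono_less_eq)
        have big: "\<Delta> m > ?L ^ 4" using True by (simp add: S_def)
        have L2: "?L ^ 2 > 0" using elim by simp
        have "?L ^ 2 * ?L ^ 2 < \<Delta> m" using big by (simp flip: power_add)
        then have "?L ^ 2 < \<Delta> m / ?L ^ 2" using L2 by (simp add: pos_less_divide_eq)
        moreover have "2 * 2 \<le> ?L * ?L" using elim by (intro mult_mono) auto
        ultimately have x4: "\<Delta> m / ?L ^ 2 \<ge> 4" by (simp add: power2_eq_square)
        then have "\<Delta> m / ?L ^ 2 / 2 \<le> ?D m" by (intro half_le_nat_floor) simp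
        then have "c / ?L ^ C * (\<Delta> m / ?L ^ 2 / 2) \<le> c / ?L ^ C * ?D m"
          using c elim by (intro mult_left_mono) auto
        moreover have "c / 2 * \<Delta> m / ?L ^ (C + 4) \<le> c / 2 * \<Delta> m / ?L ^ (C + 2)"
        proof (rule divide_left_mono)
          show "?L ^ (C + 2) \<le> ?L ^ (C + 4)" using elim by (intro power_increasing) auto
          have "\<Delta> m > 0" using x4 L2 by (smt (verit) divide_nonpos_pos)
          then show "0 \<le> c / 2 * \<Delta> m" using c by simp
          show "0 < ?L ^ (C + 4) * ?L ^ (C + 2)" using elim by simp
        qed
        moreover have "c / 2 * \<Delta> m / ?L ^ (C + 2) = c / ?L ^ C * (\<Delta> m / ?L ^ 2 / 2)"
          by (simp add: power_add power2_eq_square)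
        moreover have "c / ?L ^ C * ?D m = c * ?D m / ?L ^ C" by simp
        ultimately have "c / 2 * \<Delta> m / ?L ^ (C + 4) \<le> c * ?D m / ?L ^ C"
          by linarith
        then have "exp (c / 2 * \<Delta> m / ?L ^ (C + 4)) \<le> K * real (T m)"
          using i0[OF \<open>i \<ge> i0\<close>] i by (smt (verit) exp_le_cancel_iff)
        also have "\<dots> \<le> max K (exp (c / 2)) * real (T m)" by (intro mult_right_mono) auto
        finally show ?thesis .
      next
        case False
        then have "exp (c / 2 * \<Delta> m / ?L ^ (C + 4)) \<le> exp (c / 2) * real (T m)"
          using elim c by (intro small) (auto simp: S_def)
        also have "\<dots> \<le> max K (exp (c / 2)) * real (T m)" by (intro mult_right_mono) auto
        finally show ?thesis .
      qed
    qed
    then show ?thesis using c by (intro exI[of _ "c / 2"] exI[of _ "C + 4"] exI[of _ "max K (exp (c / 2))"] conjI) auto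
  qed
qed

theorem theorem2p2:
  fixes p n k :: "nat \<Rightarrow> nat" and \<sigma> b SNR :: "nat \<Rightarrow> real" and \<D> :: "nat \<Rightarrow> real set"
    and \<mu> :: "nat \<Rightarrow> ((nat \<Rightarrow> real) \<times> (nat \<Rightarrow> real)) measure"
    and N :: "nat \<Rightarrow> nat" and P Q :: "nat \<Rightarrow> (nat \<Rightarrow> real) measure"
  assumes sigma_pos: "\<And>m. \<sigma> m > 0"
    and beta_min_pos: "\<And>m. beta_min (\<D> m) > 0"
    and prior: "\<And>m. signal_prior (p m) (k m) (\<D> m) (b m) (\<mu> m)"
    and symmetric: "\<And>m. antisymmetric_pairs (p m) (\<mu> m)"
    and SNR: "\<And>m. SNR m = snr (b m) (\<sigma> m)"
    and N: "\<And>m. N m = data_dim (n m) (p m)"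
    and Q: "\<And>m. Q m = mslr_null (n m) (p m) (b m) (\<sigma> m)"
    and P: "\<And>m. P m = mslr_alternative (n m) (p m) (1/2) (\<sigma> m) (\<mu> m)"
    and bounded_amplitude:
      "(\<lambda>m. beta_min (\<D> m)) \<in> \<Theta>(\<lambda>m. beta_sup (p m) (k m) (\<D> m) (b m))"
    and p_limit: "filterlim p at_top sequentially"
    and k_small: "(\<lambda>m. real (k m)) \<in> o(\<lambda>m. sqrt (real (p m)))"
    and n_large: "(\<lambda>m. real (n m)) \<in> \<omega>(\<lambda>m. max (real (k m)) (ln (real (p m))))"
    and n_small: "(\<lambda>m. real (n m)) \<in>
      o(\<lambda>m. (real (k m))\<^sup>2 * (SNR m + 1)\<^sup>2 / (SNR m)\<^sup>2 * (1 / ln (real (p m))))"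
    and conjecture: "\<And>r :: nat \<Rightarrow> nat. strict_mono r \<Longrightarrow>
      low_degree_conjecture (\<lambda>i. N (r i)) (\<lambda>i. P (r i)) (\<lambda>i. Q (r i))"
  shows "requires_exp_time N P Q
      (\<lambda>m. min ((real (k m))\<^sup>2 * (SNR m + 1)\<^sup>2 / (real (n m) * (SNR m)\<^sup>2)) (real (n m)))"
proof -
  define \<Delta> where "\<Delta> = (\<lambda>m. min ((real (k m))\<^sup>2 * (SNR m + 1)\<^sup>2 / (real (n m) * (SNR m)\<^sup>2)) (real (n m)))"
  have SNR_nonneg: "SNR m \<ge> 0" for m by (simp add: SNR snr_def)
  have "(\<lambda>m. beta_sup (p m) (k m) (\<D> m) (b m)) \<in> O(\<lambda>m. beta_min (\<D> m))"
    using bounded_amplitude by (simp add: bigtheta_def bigomega_iff_bigo)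
  then obtain c0 where "c0 > 0" and c0: "eventually (\<lambda>m. \<bar>beta_sup (p m) (k m) (\<D> m) (b m)\<bar> \<le> c0 * \<bar>beta_min (\<D> m)\<bar>) sequentially"
    by (auto elim!: landau_o.bigE)
  define C where "C = max 1 c0"
  have C1: "C \<ge> 1" by (simp add: C_def)
  have ev_C: "eventually (\<lambda>m. beta_sup (p m) (k m) (\<D> m) (b m) \<le> C * beta_min (\<D> m)) sequentially"
    using c0
  proof eventually_elim
    case (elim m)
    have "c0 * \<bar>beta_min (\<D> m)\<bar> \<le> C * beta_min (\<D> m)"
      using beta_min_pos[of m] by (simp add: C_def)
    then show ?case using elim by linarith
  qed
  \<comment> \<open>3 exceeds e, so ln p >= 1, and then the growth of n over ln p yields n >=
    1.\<close>
  have ev_p: "eventually (\<lambda>m. p m \<ge> 3) sequentially"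
    using p_limit by (simp add: filterlim_at_top)
  have ev_k: "eventually (\<lambda>m. (real (k m))\<^sup>2 / real (p m) \<le> 1) sequentially"
    using landau_o.smallD[OF k_small zero_less_one] ev_p
  proof eventually_elim
    case (elim m)
    then have "(real (k m))\<^sup>2 \<le> (sqrt (real (p m)))\<^sup>2" by (intro power_mono) auto
    then show ?case using elim by (simp add: divide_simps)
  qed
  have ev_n: "eventually (\<lambda>m. n m \<ge> 1) sequentially"
    using landau_omega.smallD[OF n_large zero_less_one] ev_p
  proof eventually_elim
    case (elim m)
    have "exp 1 \<le> real (p m)" using elim(2) exp_le by linarith
    then have "ln (exp 1) \<le> ln (real (p m))" using elim(2) by (subst ln_le_cancel_iff) auto
    then have "1 \<le> real (n m)" using elim(1) by simp
    then show ?case by simp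
  qed
  have ev_N: "eventually (\<lambda>m. N m \<ge> p m) sequentially"
    using ev_n
  proof eventually_elim
    case (elim m)
    then have "1 * p m \<le> n m * p m" by (intro mult_le_mono1)
    then show ?case unfolding N data_dim_def by linarith
  qed
  have N_lim: "filterlim N at_top sequentially"
    using filterlim_at_top_mono[OF p_limit ev_N] .
  have lnN_lim: "filterlim (\<lambda>m. ln (real (N m))) at_top sequentially"
    by (rule filterlim_compose[OF ln_at_top filterlim_compose[OF filterlim_real_sequentially N_lim]])
  \<comment> \<open>The bound 2 is for \<open>requires_exp_time_split\<close>; 2 C^4 lets one
    logarithm absorb the constant in the degree condition of
    \<open>signal_kernel_le\<close>.\<close>
  have ev_ln: "eventually (\<lambda>m. ln (real (N m)) \<ge> max 2 (2 * C ^ 4)) sequentially"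
    using lnN_lim unfolding filterlim_at_top by blast
  \<comment> \<open>The conjecture asks for a testing pair at every index, not just eventually;
    hence one threshold past which the subsequence starts.\<close>
  from eventually_conj[OF ev_C eventually_conj[OF ev_p eventually_conj[OF ev_k eventually_conj[OF ev_n ev_ln]]]]
  obtain m0 where m0: "\<And>m. m \<ge> m0 \<Longrightarrow> beta_sup (p m) (k m) (\<D> m) (b m) \<le> C * beta_min (\<D> m) \<and> p m \<ge> 3 \<and>
      (real (k m))\<^sup>2 / real (p m) \<le> 1 \<and> n m \<ge> 1 \<and> ln (real (N m)) \<ge> max 2 (2 * C ^ 4)"
    unfolding eventually_sequentially by blast
  have "requires_exp_time N P Q \<Delta>"
  proof (rule requires_exp_time_split)
    show "eventually (\<lambda>m. ln (real (N m)) \<ge> 2) sequentially"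
      using ev_ln by eventually_elim simp
    fix r :: "nat \<Rightarrow> nat"
    assume r: "strict_mono r" and big: "\<And>i. \<Delta> (r i) > ln (real (N (r i))) ^ 4" and rm0: "\<And>i. r i \<ge> m0"
    define D where "D = (\<lambda>m. nat \<lfloor>\<Delta> m / ln (real (N m)) ^ 2\<rfloor>)"
    have bound: "testing_pair (N (r i)) (P (r i)) (Q (r i)) \<and>
        chi2_low_degree (N (r i)) (D (r i)) (P (r i)) (Q (r i)) \<le> exp 1 * exp 2 - 1 \<and>
        ln (real (N (r i))) ^ 2 \<le> 2 * real (D (r i))" for i
    proof -
      define m where "m = r i"
      let ?L = "ln (real (N m))"
      have good: "beta_sup (p m) (k m) (\<D> m) (b m) \<le> C * beta_min (\<D> m)" "p m \<ge> 3"
        "(real (k m))\<^sup>2 / real (p m) \<le> 1" "n m \<ge> 1" "?L \<ge> 2" "?L \<ge> 2 * C ^ 4"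
        using m0[OF rm0[of i]] by (auto simp: m_def)
      have \<Delta>L: "\<Delta> m > ?L ^ 4" using big[of i] by (simp add: m_def)
      have L0: "?L > 0" using good by simp
      have \<Delta>0: "\<Delta> m > 0" using \<Delta>L L0 by (meson less_trans zero_less_power)
      have \<Delta>n: "\<Delta> m \<le> real (n m)" and \<Delta>k: "\<Delta> m \<le> (real (k m))\<^sup>2 * (SNR m + 1)\<^sup>2 / (real (n m) * (SNR m)\<^sup>2)"
        by (simp_all add: \<Delta>_def)
      \<comment> \<open>If k or the SNR were 0, this quotient would be 0, in the second case through
        division by zero, contradicting \<Delta> > 0.\<close>
      have "(real (k m))\<^sup>2 * (SNR m + 1)\<^sup>2 / (real (n m) * (SNR m)\<^sup>2) \<noteq> 0" using \<Delta>k \<Delta>0 by linarith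
      then have "k m \<noteq> 0" "SNR m \<noteq> 0" by auto
      then have SNR0: "SNR m > 0" and k1: "k m \<ge> 1" using SNR_nonneg[of m] by auto
      have \<Delta>k': "real (n m) * (SNR m)\<^sup>2 * \<Delta> m \<le> (real (k m))\<^sup>2 * (SNR m + 1)\<^sup>2"
        using \<Delta>k good(4) SNR0 by (simp add: pos_le_divide_eq mult_ac)
      \<comment> \<open>Since \<Delta> > (ln N)^4, dividing by (ln N)^2 leaves at least (ln N)^2 >=
        4; rounding down then costs at most a factor 2, and D still outgrows ln N.\<close>
      have x4: "\<Delta> m / ?L ^ 2 \<ge> ?L ^ 2"
        using \<Delta>L L0 by (simp add: pos_le_divide_eq flip: power_add)
      have L4: "?L ^ 2 \<ge> 4" using power_mono[OF good(5), of 2] by simp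
      have D_up: "real (D m) \<le> \<Delta> m / ?L ^ 2" unfolding D_def using x4 L4 by (intro of_nat_floor) linarith
      have "\<Delta> m / ?L ^ 2 / 2 \<le> real (D m)" unfolding D_def using x4 L4 by (intro half_le_nat_floor) linarith
      then have D_lo: "?L ^ 2 \<le> 2 * real (D m)" using x4 by argo
      have lnn: "ln (real (n m) + 1) \<le> ?L"
      proof -
        have "n m * 1 \<le> n m * p m" using good by (intro mult_le_mono2) simp
        then have "real (n m + 1) \<le> real (N m)" using good unfolding N data_dim_def by (intro of_nat_mono) linarith
        then show ?thesis by (subst ln_le_cancel_iff) auto
      qed
      have D_ln: "real (D m) * ln (real (n m) + 1) \<le> \<Delta> m / (2 * C ^ 4)"
      proof -
        \<comment> \<open>One of the two logarithms divided out of \<Delta> is spent here on ln (n +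
          1), the other on 2 C^4.\<close>
        have "real (D m) * ln (real (n m) + 1) \<le> \<Delta> m / ?L ^ 2 * ?L"
          using D_up lnn L0 \<Delta>0 by (intro mult_mono) auto
        also have "\<dots> = \<Delta> m / ?L" using L0 by (simp add: power2_eq_square)
        also have "\<dots> \<le> \<Delta> m / (2 * C ^ 4)"
          using good(6) C1 \<Delta>0 L0 by (intro divide_left_mono) auto
        finally show ?thesis .
      qed
      note lb = mslr_low_degree_bound[OF prior symmetric beta_min_pos C1 good(1) k1 good(4) sigma_pos SNR SNR0 \<Delta>0 \<Delta>k' \<Delta>n D_ln]
      have "chi2_low_degree (N m) (D m) (P m) (Q m) \<le> exp 1 * exp (2 * ((real (k m))\<^sup>2 / real (p m))) - 1"
        using lb(2) by (simp add: N P Q)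
      also have "\<dots> \<le> exp 1 * exp 2 - 1" using good(3) by simp
      finally show ?thesis using lb(1) D_lo by (simp add: N P Q m_def)
    qed
    have r_lim: "filterlim r at_top sequentially" by (rule filterlim_subseq[OF r])
    have "filterlim (\<lambda>i. N (r i)) at_top sequentially" by (rule filterlim_compose[OF N_lim r_lim])
    moreover have "(\<lambda>i. real (D (r i))) \<in> \<omega>(\<lambda>i. ln (real (N (r i))))"
    proof (rule landau_omega.smallI)
      fix c :: real assume "c > 0"
      have "filterlim (\<lambda>i. ln (real (N (r i)))) at_top sequentially" by (rule filterlim_compose[OF lnN_lim r_lim])
      then have "eventually (\<lambda>i. ln (real (N (r i))) \<ge> max 1 (2 * c)) sequentially" unfolding filterlim_at_top by blast
      then show "eventually (\<lambda>i. norm (real (D (r i))) \<ge> c * norm (ln (real (N (r i))))) sequentially"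
      proof eventually_elim
        case (elim i)
        let ?L = "ln (real (N (r i)))"
        have "2 * c * ?L \<le> ?L * ?L" using elim by (intro mult_right_mono) auto
        also have "\<dots> \<le> 2 * real (D (r i))" using bound[of i] by (simp add: power2_eq_square)
        finally show ?case using elim by simp
      qed
    qed
    moreover have "(\<lambda>i. chi2_low_degree (N (r i)) (D (r i)) (P (r i)) (Q (r i))) \<in> O(\<lambda>_. 1)"
    proof (rule bigoI[of _ "exp 1 * exp 2"], rule always_eventually, rule allI)
      fix i
      \<comment> \<open>The upper bound alone does not control the absolute value; from below, a
        mean of squares minus 1 is at least -1.\<close>
      have "chi2_low_degree (N (r i)) (D (r i)) (P (r i)) (Q (r i)) \<ge> -1"
        by (simp add: chi2_low_degree_def)
      moreover have "1 \<le> exp 1 * exp (2::real)" by (simp flip: exp_add)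
      ultimately show "norm (chi2_low_degree (N (r i)) (D (r i)) (P (r i)) (Q (r i))) \<le> exp 1 * exp 2 * norm (1::real)"
        using bound[of i] unfolding real_norm_def by (simp only: abs_one) linarith
    qed
    ultimately have prem: "filterlim (\<lambda>i. N (r i)) at_top sequentially \<and>
        (\<forall>i. testing_pair (N (r i)) (P (r i)) (Q (r i))) \<and>
        (\<lambda>i. real (D (r i))) \<in> \<omega>(\<lambda>i. ln (real (N (r i)))) \<and>
        (\<lambda>i. chi2_low_degree (N (r i)) (D (r i)) (P (r i)) (Q (r i))) \<in> O(\<lambda>_. 1)"
      using bound by (intro conjI allI) auto
    from conjecture[OF r, unfolded low_degree_conjecture_def, THEN spec, THEN mp, OF prem, THEN conjunct2]
    show "requires_exp_time (\<lambda>i. N (r i)) (\<lambda>i. P (r i)) (\<lambda>i. Q (r i)) (\<lambda>i. real (nat \<lfloor>\<Delta> (r i) / ln (real (N (r i))) ^ 2\<rfloor>))"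
      unfolding D_def .
  qed
  then show ?thesis by (simp add: \<Delta>_def)
qed

end
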